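(* There exists an absolute constant $\kappa > 0$ such that the following holds. Let $p$ be a prime, let $S$ be a non-empty subset of $\mathbb{F}_p$, let $n$ be a positive integer, and let $P:\mathbb{F}_p^n \to \mathbb{F}_p$ be a polynomial with degree $2$. 1. If $P(S^n) \neq \mathbb{F}_p$, then there exist an affine polynomial $L: \mathbb{F}_p^n \to \mathbb{F}_p$, a degree-$2$ polynomial $A: \mathbb{F}_p \to \mathbb{F}_p$, and a $\kappa p^{15}$-determined polynomial $J$ with degree at most $2$ such that $P$ coincides on $S^n$ with $A \circ L + J$. (Equivalently, with $A L^2 + J$ for some $A \in \mathbb{F}_p$, with $J$ changed by a constant.) 2. If furthermore $P(S^n)$ does not contain any affine translate of $Q_p$, then $P$ coincides on $S^n$ with a $\kappa p^{15}$-determined polynomial that has degree at most $2$.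
   Context: An affine polynomial is a polynomial with degree at most $1$ (possibly constant). A polynomial $J:\mathbb{F}_p^n\to\mathbb{F}_p$ depends on $x_i$ if the coordinate $x_i$ appears in one of the monomials of $J$; $J$ is $k$-determined if the set of $i\in\{1,\dots,n\}$ such that $J$ depends on $x_i$ has size at most $k$. $Q_p=\{y^2: y\in\mathbb{F}_p\}$ is the set of mod-$p$ quadratic residues (including $0$). An affine translate of $Q_p$ is a subset of $\mathbb{F}_p$ of the form $aQ_p+b$ with $a\in\mathbb{F}_p^*$ and $b\in\mathbb{F}_p$. *)

theory Defs
  imports
    Complex_Main
    "HOL-Number_Theory.Residues"
    "HOL-Algebra.Indexed_Polynomials"
begin

text \<open>
  Since the constant of the theorem is chosen before the prime \<open>p\<close>, the field cannot be a type
  depending on \<open>p\<close>; it is the ring \<^const>\<open>residue_ring\<close> with carrier \<open>{0..p - 1}\<close>.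
  Polynomials are formal, so that degrees and occurring variables refer to monomials and not to the
  induced function (the two differ only for \<open>p = 2\<close> in degree at most 2).
\<close>

abbreviation prime_field :: "nat \<Rightarrow> int ring" where
  "prime_field p \<equiv> residue_ring (int p)"

abbreviation mpolys :: "('a, 'b) ring_scheme \<Rightarrow> nat \<Rightarrow> (nat multiset \<Rightarrow> 'a) set" where
  "mpolys R n \<equiv> ring.indexed_pset R {1..n} (carrier R)"

definition monomials :: "('a, 'b) ring_scheme \<Rightarrow> ('c multiset \<Rightarrow> 'a) \<Rightarrow> 'c multiset set" where
  "monomials R P = {m. P m \<noteq> \<zero>\<^bsub>R\<^esub>}"

text \<open>Total degree; the zero polynomial gets degree 0.\<close>

definition total_degree :: "('a, 'b) ring_scheme \<Rightarrow> ('c multiset \<Rightarrow> 'a) \<Rightarrow> nat" where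
  "total_degree R P = Max (insert 0 (size ` monomials R P))"

definition mpoly_eval :: "('a, 'b) ring_scheme \<Rightarrow> ('c multiset \<Rightarrow> 'a) \<Rightarrow> ('c \<Rightarrow> 'a) \<Rightarrow> 'a" where
  "mpoly_eval R P x =
     (\<Oplus>\<^bsub>R\<^esub>m\<in>monomials R P. P m \<otimes>\<^bsub>R\<^esub> (\<Otimes>\<^bsub>R\<^esub>i\<in>set_mset m. x i [^]\<^bsub>R\<^esub> count m i))"

abbreviation depends_on :: "('a, 'b) ring_scheme \<Rightarrow> ('c multiset \<Rightarrow> 'a) \<Rightarrow> 'c \<Rightarrow> bool" where
  "depends_on R J i \<equiv> \<not> ring.index_free R J i"

text \<open>The bound \<open>k\<close> is real because it is instantiated with \<open>\<kappa> p\<^sup>1\<^sup>5\<close> for a real \<open>\<kappa>\<close>.\<close>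

definition determined :: "('a, 'b) ring_scheme \<Rightarrow> nat \<Rightarrow> real \<Rightarrow> (nat multiset \<Rightarrow> 'a) \<Rightarrow> bool" where
  "determined R n k J \<longleftrightarrow> real (card {i \<in> {1..n}. depends_on R J i}) \<le> k"

abbreviation cartesian_power :: "'a set \<Rightarrow> nat \<Rightarrow> (nat \<Rightarrow> 'a) set" where
  "cartesian_power S n \<equiv> {1..n} \<rightarrow>\<^sub>E S"

definition quadratic_residues :: "nat \<Rightarrow> int set" where
  "quadratic_residues p = (\<lambda>y. y [^]\<^bsub>prime_field p\<^esub> (2::nat)) ` carrier (prime_field p)"

definition is_affine_translate :: "nat \<Rightarrow> int set \<Rightarrow> bool" where
  "is_affine_translate p T \<longleftrightarrow>
     (\<exists>a \<in> carrier (prime_field p) - {\<zero>\<^bsub>prime_field p\<^esub>}. \<exists>b \<in> carrier (prime_field p).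
        T = (\<lambda>q. a \<otimes>\<^bsub>prime_field p\<^esub> q \<oplus>\<^bsub>prime_field p\<^esub> b) ` quadratic_residues p)"

end

theory Submission
  imports Defs
begin

text \<open>
  Let \<open>P\<close> miss a value on \<open>S^n\<close>. The interesting case is \<open>p\<close> odd and \<open>S\<close> with two distinct elements
  \<open>s\<close>, \<open>t\<close>; otherwise \<open>P\<close> is constant on \<open>S^n\<close>. Write \<open>P\<close> on \<open>S^n\<close> as a sum of functions \<open>g i\<close> of single
  coordinates and of a symmetric bilinear part with matrix \<open>H\<close> and zero diagonal. The proof shows that, after
  the deletion of \<open>O(p^9)\<close> coordinates, \<open>H\<close> is the off-diagonal part of a matrix \<open>A l i l j\<close> and that everything else
  is compatible with the linear form \<open>l\<close>, so that a square can be completed.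

  \<^emph>\<open>Rank at most one up to sparse errors.\<close> Suppose that \<open>H\<close> has many disjoint pairs of columns such that no nontrivial
  combination of the two columns of a pair is sparse. Let \<open>U\<close> be the remaining coordinates and let all
  coordinates range over \<open>{s, t}\<close>. For fixed values of the columns, \<open>P\<close> is a function of the coordinates in
  \<open>U\<close>; if it misses a value, then two independent uniform points collide under it with probability at least
  \<open>1/(p - 1)\<close>. Now average over the columns. A pair of points whose images under \<open>H\<close> differ in many columns
  collides with probability about \<open>1/p\<close>, and by independence of the columns only a proportion of about
  \<open>1/p^2\<close> of the pairs of points is not of this kind. The total \<open>1/p + 1/p^2 - 1/p^3\<close> is smaller than
  \<open>1/(p - 1)\<close>, a contradiction (\<open>robust_pairs_imp_surj\<close>); with a single independent column the proportion
  would be \<open>1/p\<close>, and indeed squares of linear forms miss values. Hence almost all columns of \<open>H\<close> are pairwise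
  proportional up to sparse errors, and the symmetry of \<open>H\<close> turns this into \<open>H i j = A l i l j\<close> up to sparse
  errors (\<open>near_parallel_columns\<close>, \<open>symmetric_near_rank_one\<close>).

  \<^emph>\<open>Removing the errors.\<close> If some coordinates are partitioned into blocks which interact only through
  \<open>A \<Phi>^2\<close> with \<open>\<Phi>\<close> linear, then \<open>P\<close> is \<open>A \<Phi>^2 + \<Psi>\<close> with \<open>\<Phi>\<close> and \<open>\<Psi>\<close> sums of independent contributions of the
  blocks. A growing set of attainable pairs \<open>(\<Phi>, \<Psi>)\<close> in the plane over the field with \<open>p\<close> elements stops
  growing after fewer than \<open>p^2\<close> blocks, and then it is invariant under the moves of all other blocks. So
  unless, for some \<open>\<alpha>\<close>, all but fewer than \<open>p^2\<close> blocks move along the line \<open>\<Psi> = - \<alpha> \<Phi>\<close>, some vertical line is attained completely and \<open>P\<close>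
  misses nothing (\<open>block_sums_fill_fibre\<close>, \<open>few_moving_blocks\<close>). With the edges of an induced matching
  of the error graph as blocks this bounds the matching, and the sparsity of the errors then bounds the
  number of coordinates that have errors (\<open>few_error_edges\<close>). With single coordinates as blocks it shows that
  the univariate parts agree with a common multiple of \<open>l\<close>; comparing two values of a deleted coordinate
  shows that on the kept coordinates its column of \<open>H\<close> is a multiple of \<open>l\<close> as well (\<open>rank_one_structure\<close>).

  \<^emph>\<open>Conclusion.\<close> Completing the square gives \<open>A L^2 + J\<close> with \<open>J\<close> in the deleted coordinates. If \<open>l\<close> has fewer than \<open>p^2\<close>
  nonzero entries, these coordinates are deleted too and \<open>P\<close> coincides with \<open>J\<close>. Otherwise \<open>L\<close> takes all
  values while the deleted coordinates stay fixed, and the image contains an affine translate of the quadratic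
  residues (\<open>quadratic_structure\<close>).
\<close>

section \<open>Additive characters modulo a prime\<close>

definition add_char :: "int \<Rightarrow> int \<Rightarrow> complex" where
  "add_char p z = cis (2 * pi * (of_int z / of_int p))"

lemma add_char_add: "add_char p (a + b) = add_char p a * add_char p b"
  by (simp add: add_char_def cis_mult add_divide_distrib distrib_left)

lemma add_char_0 [simp]: "add_char p 0 = 1"
  by (simp add: add_char_def)

lemma norm_add_char [simp]: "norm (add_char p z) = 1"
  by (simp add: add_char_def)

lemma cnj_add_char: "cnj (add_char p z) = add_char p (- z)"
  by (simp add: add_char_def cis_cnj)

lemma add_char_mult_nat: "add_char p (int k * z) = add_char p z ^ k"
  by (induction k) (simp_all add: add_char_add distrib_right)

lemma add_char_eq_1_iff:
  assumes "p > 0"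
  shows "add_char p z = 1 \<longleftrightarrow> p dvd z"
proof
  assume "p dvd z"
  then obtain k where "z = p * k" by (rule dvdE)
  with assms have "2 * pi * (of_int z / of_int p) = 2 * pi * real_of_int k" by simp
  then show "add_char p z = 1" unfolding add_char_def by simp
next
  assume "add_char p z = 1"
  then have "Re (add_char p z) = 1" by simp
  then have "cos (2 * pi * (of_int z / of_int p)) = 1" by (simp add: add_char_def)
  then obtain k :: int where "2 * pi * (of_int z / of_int p) = of_int k * 2 * pi"
    using cos_one_2pi_int by blast
  then have "real_of_int z = of_int k * of_int p" using assms by (simp add: field_simps)
  then have "z = k * p" by (metis of_int_eq_iff of_int_mult)
  then show "p dvd z" by simp
qed

lemma sum_add_char:
  fixes p :: nat
  assumes "p > 0"
  shows "(\<Sum>a<p. add_char (int p) (int a * z)) = (if int p dvd z then of_nat p else 0)"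
proof (cases "int p dvd z")
  case True
  then have "add_char (int p) z = 1" using assms add_char_eq_1_iff by simp
  then show ?thesis using True by (simp add: add_char_mult_nat)
next
  case False
  let ?w = "add_char (int p) z"
  have "?w ^ p = 1"
    using assms by (simp flip: add_char_mult_nat add: add_char_eq_1_iff)
  moreover have "?w \<noteq> 1" using False assms add_char_eq_1_iff by simp
  ultimately have "(\<Sum>a<p. ?w ^ a) = 0" by (simp add: geometric_sum)
  then show ?thesis using False by (simp add: add_char_mult_nat)
qed

lemma norm_one_plus_unit_sq:
  fixes w :: complex
  assumes "norm w = 1"
  shows "(norm (1 + w))\<^sup>2 = 4 - (norm (1 - w))\<^sup>2"
proof -
  have "(Re w)\<^sup>2 + (Im w)\<^sup>2 = 1" using assms by (simp add: norm_complex_def)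
  then show ?thesis unfolding cmod_power2 by (simp add: power2_eq_square algebra_simps)
qed

text \<open>
  For a nontrivial \<open>p\<close>-th root of unity \<open>w\<close> the powers of \<open>w\<close> sum to zero, so \<open>p\<close> is the sum of the numbers
  \<open>1 - w^k\<close>, whose norms are at most \<open>k\<close> times the norm of \<open>1 - w\<close>. This keeps \<open>w\<close> at distance at
  least \<open>2/p\<close> from 1, without any estimate of trigonometric functions.
\<close>

lemma norm_one_plus_add_char:
  fixes p :: nat
  assumes "p > 0" "\<not> int p dvd z"
  shows "(norm (1 + add_char (int p) z) / 2)\<^sup>2 \<le> 1 - 1 / (real p)\<^sup>2"
proof -
  let ?w = "add_char (int p) z"
  have bd: "norm (1 - ?w ^ k) \<le> real k * norm (1 - ?w)" for k
  proof (induction k)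
    case (Suc k)
    have "1 - ?w ^ Suc k = (1 - ?w ^ k) + ?w ^ k * (1 - ?w)" by (simp add: algebra_simps)
    then have "norm (1 - ?w ^ Suc k) \<le> norm (1 - ?w ^ k) + norm (?w ^ k * (1 - ?w))"
      by (metis norm_triangle_ineq)
    also have "norm (?w ^ k * (1 - ?w)) = norm (1 - ?w)" by (simp add: norm_mult norm_power)
    finally show ?case using Suc.IH by (simp add: algebra_simps)
  qed simp
  have "(\<Sum>k<p. ?w ^ k) = 0"
    using sum_add_char[OF assms(1), of z] assms(2) by (simp add: add_char_mult_nat)
  then have "of_nat p = (\<Sum>k<p. 1 - ?w ^ k)" by (simp add: sum_subtractf)
  then have "real p = norm (\<Sum>k<p. 1 - ?w ^ k)" by (metis norm_of_nat)
  also have "\<dots> \<le> (\<Sum>k<p. real k * norm (1 - ?w))"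
    using bd by (intro sum_norm_le) blast
  also have "\<dots> \<le> (\<Sum>k<p. real k) * norm (1 - ?w)" by (simp add: sum_distrib_right)
  also have "(\<Sum>k<p. real k) \<le> (real p)\<^sup>2 / 2"
  proof (induction p)
    case (Suc p)
    then show ?case by (simp add: power2_eq_square field_simps)
  qed simp
  finally have "real p \<le> (real p)\<^sup>2 / 2 * norm (1 - ?w)" by (simp add: mult_right_mono)
  then have "2 / real p \<le> norm (1 - ?w)"
    using assms(1) by (simp add: power2_eq_square field_simps)
  then have "(2 / real p)\<^sup>2 \<le> (norm (1 - ?w))\<^sup>2" by (intro power_mono) auto
  then show ?thesis
    using norm_one_plus_unit_sq[of ?w] by (simp add: power_divide)
qed

lemma norm_one_plus_add_char_le1: "norm (1 + add_char p z) / 2 \<le> 1"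
  using norm_triangle_ineq[of 1 "add_char p z"] by simp

lemma sum_Pow_add_char:
  assumes "finite U"
  shows "(\<Sum>B\<in>Pow U. add_char p (\<Sum>i\<in>B. c i)) = (\<Prod>i\<in>U. 1 + add_char p (c i))"
  using assms
proof (induction U)
  case (insert x U)
  have disj: "Pow U \<inter> insert x ` Pow U = {}" using insert.hyps by auto
  have inj: "inj_on (insert x) (Pow U)" using insert.hyps by (auto simp: inj_on_def)
  have "(\<Sum>B\<in>insert x ` Pow U. add_char p (\<Sum>i\<in>B. c i))
      = (\<Sum>B\<in>Pow U. add_char p (\<Sum>i\<in>insert x B. c i))"
    using inj by (simp add: sum.reindex)
  also have "\<dots> = (\<Sum>B\<in>Pow U. add_char p (c x) * add_char p (\<Sum>i\<in>B. c i))"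
  proof (rule sum.cong)
    fix B assume "B \<in> Pow U"
    then have "finite B" "x \<notin> B" using insert.hyps finite_subset by auto
    then show "add_char p (\<Sum>i\<in>insert x B. c i) = add_char p (c x) * add_char p (\<Sum>i\<in>B. c i)"
      by (simp add: add_char_add)
  qed simp
  also have "\<dots> = add_char p (c x) * (\<Prod>i\<in>U. 1 + add_char p (c i))"
    using insert.IH by (simp flip: sum_distrib_left)
  finally show ?case
    using insert disj by (simp add: Pow_insert sum.union_disjoint distrib_right)
qed simp

text \<open>
  The quantitative source of randomness: for a uniformly chosen subset \<open>B\<close> of \<open>U\<close>, the residue of the sum of \<open>c\<close>
  over \<open>B\<close> is close to uniform as soon as \<open>c\<close> has many nonzero entries, because the character sum factorises.
\<close>

lemma norm_sum_Pow_add_char: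
  fixes p :: nat
  assumes "finite U" "p > 0" "K \<le> card {i\<in>U. \<not> int p dvd c i}"
  shows "(norm (\<Sum>B\<in>Pow U. add_char (int p) (\<Sum>i\<in>B. c i)))\<^sup>2
           \<le> 4 ^ card U * (1 - 1 / (real p)\<^sup>2) ^ K"
proof -
  let ?t = "\<lambda>i. (norm (1 + add_char (int p) (c i)) / 2)\<^sup>2"
  let ?\<rho> = "1 - 1 / (real p)\<^sup>2"
  let ?Z = "{i\<in>U. \<not> int p dvd c i}"
  have \<rho>: "0 \<le> ?\<rho>" "?\<rho> \<le> 1" using assms(2) by simp_all
  have "(norm (\<Sum>B\<in>Pow U. add_char (int p) (\<Sum>i\<in>B. c i)))\<^sup>2
      = (\<Prod>i\<in>U. 4 * ?t i)"
    using assms(1) by (simp add: sum_Pow_add_char prod_norm power_divide prod_power_distrib flip: prod_norm)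
  also have "\<dots> = 4 ^ card U * (\<Prod>i\<in>U. ?t i)" by (simp only: prod.distrib prod_constant)
  also have "(\<Prod>i\<in>U. ?t i) \<le> (\<Prod>i\<in>U. if \<not> int p dvd c i then ?\<rho> else 1)"
  proof (rule prod_mono)
    fix i assume "i \<in> U"
    have "?t i \<le> 1"
      using norm_one_plus_add_char_le1[of "int p" "c i"] by (intro power_le_one) auto
    then show "0 \<le> ?t i \<and> ?t i \<le> (if \<not> int p dvd c i then ?\<rho> else 1)"
      using norm_one_plus_add_char[OF assms(2), of "c i"] by auto
  qed
  also have "\<dots> = ?\<rho> ^ card ?Z"
    using assms(1) by (simp add: prod.If_cases Int_def)
  also have "\<dots> \<le> ?\<rho> ^ K" using \<rho> assms(3) by (intro power_decreasing) auto
  finally show ?thesis by simp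
qed

section \<open>Collisions and missed values\<close>

lemma norm_char_sum_sq:
  "of_real ((norm (\<Sum>x\<in>\<Omega>. add_char p (h x)))\<^sup>2) = (\<Sum>x\<in>\<Omega>. \<Sum>y\<in>\<Omega>. add_char p (h x - h y))"
proof -
  have "of_real ((norm (\<Sum>x\<in>\<Omega>. add_char p (h x)))\<^sup>2)
      = (\<Sum>x\<in>\<Omega>. add_char p (h x)) * (\<Sum>y\<in>\<Omega>. add_char p (- h y))"
    by (simp only: complex_norm_square cnj_sum cnj_add_char)
  also have "\<dots> = (\<Sum>x\<in>\<Omega>. \<Sum>y\<in>\<Omega>. add_char p (h x - h y))"
    by (simp add: sum_product flip: add_char_add)
  finally show ?thesis .
qed

text \<open>
  Parseval's identity for the distribution of \<open>h\<close> modulo \<open>p\<close>.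
\<close>

lemma sum_norm_char_sum_sq:
  fixes p :: nat
  assumes "p > 0" "finite \<Omega>"
  shows "(\<Sum>a<p. (norm (\<Sum>x\<in>\<Omega>. add_char (int p) (int a * h x)))\<^sup>2)
       = real p * card {(x, y) \<in> \<Omega> \<times> \<Omega>. int p dvd h x - h y}"
proof -
  have "complex_of_real (\<Sum>a<p. (norm (\<Sum>x\<in>\<Omega>. add_char (int p) (int a * h x)))\<^sup>2)
      = (\<Sum>a<p. \<Sum>x\<in>\<Omega>. \<Sum>y\<in>\<Omega>. add_char (int p) (int a * (h x - h y)))"
    by (simp only: of_real_sum norm_char_sum_sq right_diff_distrib)
  also have "\<dots> = (\<Sum>x\<in>\<Omega>. \<Sum>y\<in>\<Omega>. \<Sum>a<p. add_char (int p) (int a * (h x - h y)))"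
    by (subst sum.swap, intro sum.cong refl, subst sum.swap) simp
  also have "\<dots> = (\<Sum>z\<in>\<Omega>\<times>\<Omega>. if int p dvd h (fst z) - h (snd z) then of_nat p else 0)"
    by (simp add: sum_add_char[OF assms(1)] sum.cartesian_product case_prod_beta)
  also have "\<dots> = of_nat p * of_nat (card {z \<in> \<Omega> \<times> \<Omega>. int p dvd h (fst z) - h (snd z)})"
    using assms(2) by (simp add: sum.If_cases Int_def)
  also have "{z \<in> \<Omega> \<times> \<Omega>. int p dvd h (fst z) - h (snd z)}
      = {(x, y) \<in> \<Omega> \<times> \<Omega>. int p dvd h x - h y}" by auto
  finally have "complex_of_real (\<Sum>a<p. (norm (\<Sum>x\<in>\<Omega>. add_char (int p) (int a * h x)))\<^sup>2)
      = complex_of_real (real p * card {(x, y) \<in> \<Omega> \<times> \<Omega>. int p dvd h x - h y})" by simp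
  then show ?thesis by (simp only: of_real_eq_iff)
qed

text \<open>
  A function with at most \<open>p - 1\<close> values has at least \<open>1/(p - 1)\<close> of all pairs as collisions, by the Cauchy-Schwarz
  inequality, whereas the trivial character accounts only for \<open>1/p\<close>. The excess must come from the
  other characters.
\<close>

lemma sum_norm_char_sum_sq_ge:
  fixes p :: nat
  assumes p: "p \<ge> 2" and fin: "finite \<Omega>" and miss: "\<And>x. x \<in> \<Omega> \<Longrightarrow> \<not> int p dvd h x - z"
  shows "(real (card \<Omega>))\<^sup>2 / (real p - 1)
       \<le> (\<Sum>a\<in>{1..<p}. (norm (\<Sum>x\<in>\<Omega>. add_char (int p) (int a * h x)))\<^sup>2)"
proof -
  define R where "R = {0..<int p} - {z mod int p}"
  define N where "N r = card {x\<in>\<Omega>. h x mod int p = r}" for r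
  define t where "t = real (card \<Omega>) / (real p - 1)"
  have p1: "real p - 1 > 0" using p by simp
  have cR: "real (card R) = real p - 1"
    using p by (simp add: R_def card_Diff_singleton)
  have finR: "finite R" by (simp add: R_def)
  have hR: "h x mod int p \<in> R" if "x \<in> \<Omega>" for x
    using miss[OF that] p by (auto simp: R_def mod_eq_dvd_iff)
  have cov: "\<Omega> = (\<Union>r\<in>R. {x\<in>\<Omega>. h x mod int p = r})" using hR by auto
  have sumN: "card \<Omega> = (\<Sum>r\<in>R. N r)"
    unfolding N_def by (subst cov, subst card_UN_disjoint) (use fin finR in auto)
  have "{(x, y) \<in> \<Omega> \<times> \<Omega>. int p dvd h x - h y}
      = (\<Union>r\<in>R. {x\<in>\<Omega>. h x mod int p = r} \<times> {x\<in>\<Omega>. h x mod int p = r})"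
    using hR by (auto simp flip: mod_eq_dvd_iff)
  then have col: "card {(x, y) \<in> \<Omega> \<times> \<Omega>. int p dvd h x - h y} = (\<Sum>r\<in>R. N r * N r)"
    unfolding N_def
    by (simp add: card_UN_disjoint card_cartesian_product fin finR disjoint_iff)
  have "0 \<le> (\<Sum>r\<in>R. (real (N r) - t)\<^sup>2)" by (intro sum_nonneg) simp
  also have "\<dots> = (\<Sum>r\<in>R. real (N r * N r)) - 2 * t * (\<Sum>r\<in>R. real (N r)) + card R * t\<^sup>2"
    by (simp add: power2_eq_square algebra_simps sum.distrib sum_subtractf sum_distrib_left)
  also have "(\<Sum>r\<in>R. real (N r)) = card \<Omega>" by (simp add: sumN)
  also have "(\<Sum>r\<in>R. real (N r * N r)) = card {(x, y) \<in> \<Omega> \<times> \<Omega>. int p dvd h x - h y}"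
    by (simp only: col of_nat_sum)
  also have "real (card R) * t\<^sup>2 = real (card \<Omega>) * t"
    using p1 unfolding cR by (simp add: t_def power2_eq_square)
  finally have "real (card \<Omega>) * t \<le> card {(x, y) \<in> \<Omega> \<times> \<Omega>. int p dvd h x - h y}"
    by (simp add: mult.commute)
  then have "real p * (real (card \<Omega>) * t)
      \<le> (\<Sum>a<p. (norm (\<Sum>x\<in>\<Omega>. add_char (int p) (int a * h x)))\<^sup>2)"
    using sum_norm_char_sum_sq[OF _ fin, of p h] p by simp
  also have "{..<p} = insert 0 {1..<p}" using p by auto
  also have "(\<Sum>a\<in>insert 0 {1..<p}. (norm (\<Sum>x\<in>\<Omega>. add_char (int p) (int a * h x)))\<^sup>2)
      = (real (card \<Omega>))\<^sup>2 + (\<Sum>a\<in>{1..<p}. (norm (\<Sum>x\<in>\<Omega>. add_char (int p) (int a * h x)))\<^sup>2)"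
    by (simp add: power2_eq_square)
  finally have "real p * (real (card \<Omega>) * t) - (real (card \<Omega>))\<^sup>2
      \<le> (\<Sum>a\<in>{1..<p}. (norm (\<Sum>x\<in>\<Omega>. add_char (int p) (int a * h x)))\<^sup>2)" by simp
  moreover have "real p * (real (card \<Omega>) * t) - (real (card \<Omega>))\<^sup>2 = (real (card \<Omega>))\<^sup>2 / (real p - 1)"
    using p1 by (simp add: t_def power2_eq_square field_simps)
  ultimately show ?thesis by simp
qed

text \<open>
  Two independent random subsets have the same \<open>c\<close>-sum and the same \<open>d\<close>-sum with probability close to
  \<open>1/p^2\<close>: the pair of sums is nearly uniform in the plane, since no nontrivial combination of \<open>c\<close> and
  \<open>d\<close> is sparse.
\<close>

lemma card_pair_kernel_le:
  fixes p :: nat and c d :: "'a \<Rightarrow> int"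
  assumes p: "p > 0" and fin: "finite U"
    and robust: "\<And>\<alpha> \<beta>. \<not> (int p dvd \<alpha> \<and> int p dvd \<beta>) \<Longrightarrow>
      K \<le> card {i\<in>U. \<not> int p dvd \<alpha> * c i + \<beta> * d i}"
  shows "card {(B, B') \<in> Pow U \<times> Pow U. int p dvd sum c B - sum c B' \<and> int p dvd sum d B - sum d B'}
      \<le> 4 ^ card U * (1 / (real p)\<^sup>2 + (1 - 1 / (real p)\<^sup>2) ^ K)"
    (is "real (card ?ker) \<le> _")
proof -
  let ?e = "add_char (int p)"
  let ?S = "\<lambda>a b. norm (\<Sum>B\<in>Pow U. ?e (\<Sum>i\<in>B. int a * c i + int b * d i))"
  let ?\<rho> = "1 - 1 / (real p)\<^sup>2"
  have finP: "finite (Pow U)" using fin by simp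
  have \<rho>: "0 \<le> ?\<rho>" using p by simp
  have "complex_of_real (\<Sum>a<p. \<Sum>b<p. (?S a b)\<^sup>2)
     = (\<Sum>a<p. \<Sum>b<p. \<Sum>B\<in>Pow U. \<Sum>B'\<in>Pow U.
          ?e (int a * (sum c B - sum c B')) * ?e (int b * (sum d B - sum d B')))"
  proof -
    have "?e ((\<Sum>i\<in>B. int a * c i + int b * d i) - (\<Sum>i\<in>B'. int a * c i + int b * d i))
       = ?e (int a * (sum c B - sum c B')) * ?e (int b * (sum d B - sum d B'))" for a b B B'
    proof -
      have "(\<Sum>i\<in>B. int a * c i + int b * d i) - (\<Sum>i\<in>B'. int a * c i + int b * d i)
         = int a * (sum c B - sum c B') + int b * (sum d B - sum d B')"
        by (simp only: sum.distrib sum_distrib_left right_diff_distrib)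
      then show ?thesis by (simp only: add_char_add)
    qed
    then show ?thesis by (simp only: of_real_sum norm_char_sum_sq)
  qed
  also have "\<dots> = (\<Sum>a<p. \<Sum>B\<in>Pow U. \<Sum>b<p. \<Sum>B'\<in>Pow U.
          ?e (int a * (sum c B - sum c B')) * ?e (int b * (sum d B - sum d B')))"
    by (intro sum.cong refl sum.swap)
  also have "\<dots> = (\<Sum>B\<in>Pow U. \<Sum>a<p. \<Sum>B'\<in>Pow U. \<Sum>b<p.
          ?e (int a * (sum c B - sum c B')) * ?e (int b * (sum d B - sum d B')))"
    by (subst sum.swap, intro sum.cong refl sum.swap)
  also have "\<dots> = (\<Sum>B\<in>Pow U. \<Sum>B'\<in>Pow U. \<Sum>a<p. \<Sum>b<p.
          ?e (int a * (sum c B - sum c B')) * ?e (int b * (sum d B - sum d B')))"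
    by (intro sum.cong refl sum.swap)
  also have "\<dots> = (\<Sum>B\<in>Pow U. \<Sum>B'\<in>Pow U.
          (\<Sum>a<p. ?e (int a * (sum c B - sum c B'))) * (\<Sum>b<p. ?e (int b * (sum d B - sum d B'))))"
    by (simp only: sum_product)
  also have "\<dots> = (\<Sum>z\<in>Pow U \<times> Pow U.
        if int p dvd sum c (fst z) - sum c (snd z) \<and> int p dvd sum d (fst z) - sum d (snd z)
        then of_nat (p * p) else 0)"
    unfolding sum_add_char[OF p] sum.cartesian_product
    by (intro sum.cong) auto
  also have "\<dots> = of_nat (p * p) * of_nat (card {z \<in> Pow U \<times> Pow U.
        int p dvd sum c (fst z) - sum c (snd z) \<and> int p dvd sum d (fst z) - sum d (snd z)})"
    using finP by (subst sum.If_cases) (auto simp: Int_def mult.commute)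
  also have "{z \<in> Pow U \<times> Pow U.
        int p dvd sum c (fst z) - sum c (snd z) \<and> int p dvd sum d (fst z) - sum d (snd z)} = ?ker"
    by auto
  finally have "complex_of_real (\<Sum>a<p. \<Sum>b<p. (?S a b)\<^sup>2) = complex_of_real (real (p * p) * card ?ker)"
    by simp
  then have eq: "(\<Sum>a<p. \<Sum>b<p. (?S a b)\<^sup>2) = real (p * p) * card ?ker"
    by (simp only: of_real_eq_iff)
  have bd: "(?S a b)\<^sup>2 \<le> 4 ^ card U * (if a = 0 \<and> b = 0 then 1 else 0) + 4 ^ card U * ?\<rho> ^ K"
    if "a < p" "b < p" for a b
  proof (cases "a = 0 \<and> b = 0")
    case True
    then have "?S a b = 2 ^ card U" using fin by (simp add: card_Pow norm_power)
    then have "(?S a b)\<^sup>2 = 4 ^ card U" by (simp add: power2_eq_square flip: power_mult_distrib)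
    then show ?thesis using True \<rho> by simp
  next
    case False
    then have "\<not> (int p dvd int a \<and> int p dvd int b)"
      using that by (auto dest: nat_dvd_not_less)
    from norm_sum_Pow_add_char[OF fin p robust[OF this]] False show ?thesis by auto
  qed
  have "real (p * p) * card ?ker \<le>
    (\<Sum>a<p. \<Sum>b<p. 4 ^ card U * (if a = 0 \<and> b = 0 then 1 else 0) + 4 ^ card U * ?\<rho> ^ K)"
    unfolding eq[symmetric] using bd by (intro sum_mono) auto
  also have "\<dots> = 4 ^ card U * (\<Sum>a<p. \<Sum>b<p. (if a = 0 \<and> b = 0 then 1 else 0)) + real (p * p) * (4 ^ card U * ?\<rho> ^ K)"
    by (simp add: sum.distrib sum_distrib_left)
  also have "(\<Sum>a<p. \<Sum>b<p. (if a = 0 \<and> b = 0 then 1 else 0 :: real)) = (\<Sum>a<p. if a = 0 then 1 else 0)"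
    using p by (intro sum.cong refl) (auto simp: sum.delta)
  also have "\<dots> = 1" using p by (simp add: sum.delta)
  finally show ?thesis using p by (simp add: field_simps power2_eq_square)
qed

text \<open>
  The convex function \<open>n \<mapsto> \<theta>^n\<close> lies below its chord from 0 to \<open>m\<close>. In the application \<open>m - n\<close> is the number of pairs
  of columns that cannot distinguish two given points; the chord makes the estimate linear in this number,
  so that it can be averaged over the points.
\<close>

lemma power_le_chord:
  fixes \<theta> :: real
  assumes "0 \<le> \<theta>" "\<theta> \<le> 1" "n \<le> m"
  shows "real m * \<theta> ^ n \<le> real n * \<theta> ^ m + (real m - real n)"
  using assms(3)
proof (induction m rule: dec_induct)
  case (step m)
  have "real n * \<theta> ^ m * (1 - \<theta>) \<le> 1 - \<theta> ^ n"
  proof -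
    have "1 - \<theta> ^ n = (1 - \<theta>) * (\<Sum>i<n. \<theta> ^ i)" by (simp add: one_diff_power_eq)
    also have "(\<Sum>i<n. \<theta> ^ i) \<ge> (\<Sum>i<n. \<theta> ^ m)"
      using assms step.hyps by (intro sum_mono power_decreasing) auto
    then have "(1 - \<theta>) * (\<Sum>i<n. \<theta> ^ i) \<ge> (1 - \<theta>) * (real n * \<theta> ^ m)"
      using assms by (intro mult_left_mono) auto
    finally show ?thesis by (simp add: algebra_simps)
  qed
  with step.IH show ?case by (simp add: algebra_simps)
qed simp

section \<open>Robustly independent pairs of columns\<close>

text \<open>
  By Bernoulli's inequality, \<open>p^5\<close> factors suffice to make the error terms of size \<open>1/p^3\<close>.
\<close>

lemma power_one_minus_inverse_sq_le:
  fixes p :: nat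
  assumes "p > 0"
  shows "(1 - 1 / (real p)\<^sup>2) ^ (p ^ 5) \<le> 1 / real p ^ 3"
proof -
  define x where "x = 1 / (real p)\<^sup>2"
  have x: "0 \<le> x" "x \<le> 1" using assms by (simp_all add: x_def)
  have "(1 - x) ^ (p ^ 5) * (1 + x) ^ (p ^ 5) = (1 - x\<^sup>2) ^ (p ^ 5)"
    by (simp add: power2_eq_square algebra_simps flip: power_mult_distrib)
  also have "\<dots> \<le> 1" using x by (intro power_le_one) (auto simp: power_le_one)
  finally have le1: "(1 - x) ^ (p ^ 5) * (1 + x) ^ (p ^ 5) \<le> 1" .
  have "real p ^ 3 = real (p ^ 5) * x"
    using assms by (simp add: x_def field_simps flip: power_add)
  also have "\<dots> \<le> (1 + x) ^ (p ^ 5)"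
    using Bernoulli_inequality[of x "p ^ 5"] x by simp
  finally have "(1 - x) ^ (p ^ 5) * real p ^ 3 \<le> (1 - x) ^ (p ^ 5) * (1 + x) ^ (p ^ 5)"
    using x by (intro mult_left_mono) auto
  then have "(1 - x) ^ (p ^ 5) * real p ^ 3 \<le> 1" using le1 by linarith
  then show ?thesis using assms by (simp add: x_def field_simps)
qed

text \<open>
  Expanding the square and summing over \<open>C\<close> first leaves, for every pair \<open>(B, B')\<close>, a product over the columns in
  which each column that distinguishes \<open>B\<close> from \<open>B'\<close> contributes a factor bounded away from 1. The pairs of
  columns that do not distinguish them are controlled on average by \<open>card_pair_kernel_le\<close>.
\<close>

lemma bilinear_char_sum_le:
  fixes p a :: nat and M :: "'a \<Rightarrow> 'b \<Rightarrow> int" and u v :: "'k \<Rightarrow> 'b"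
  assumes p: "Factorial_Ring.prime p" and a: "\<not> p dvd a" and finU: "finite U" and finT: "finite T" and T: "T \<noteq> {}"
    and inj: "inj_on u T" "inj_on v T" "u ` T \<inter> v ` T = {}"
    and robust: "\<And>k \<alpha> \<beta>. k \<in> T \<Longrightarrow> \<not> (int p dvd \<alpha> \<and> int p dvd \<beta>) \<Longrightarrow>
      K \<le> card {i\<in>U. \<not> int p dvd \<alpha> * M i (u k) + \<beta> * M i (v k)}"
  defines "Y \<equiv> u ` T \<union> v ` T"
  defines "\<rho> \<equiv> 1 - 1 / (real p)\<^sup>2"
  shows "(\<Sum>C\<in>Pow Y. (norm (\<Sum>B\<in>Pow U.
            add_char (int p) (int a * (q B + r C + (\<Sum>j\<in>C. \<Sum>i\<in>B. M i j)))))\<^sup>2)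
       \<le> 2 ^ card Y * 4 ^ card U * (sqrt \<rho> ^ card T + 1 / (real p)\<^sup>2 + \<rho> ^ K)"
proof -
  let ?e = "add_char (int p)"
  let ?N = "\<lambda>j B. \<Sum>i\<in>B. M i j"
  let ?D = "\<lambda>B B' j. ?N j B - ?N j B'"
  define t where "t B B' j = norm (1 + ?e (int a * ?D B B' j)) / 2" for B B' j
  have p0: "p > 0" using p by (rule prime_gt_0_nat)
  have finY: "finite Y" and finP: "finite (Pow U)" using finT finU by (simp_all add: Y_def)
  have \<rho>: "0 \<le> \<rho>" "\<rho> \<le> 1" using p0 by (simp_all add: \<rho>_def)
  have cU: "real (card (Pow U)) * real (card (Pow U)) = 4 ^ card U"
    using finU by (simp add: card_Pow flip: power_mult_distrib)
  \<comment> \<open>The term \<open>r C\<close> cancels between \<open>B\<close> and \<open>B'\<close>, so the sum over \<open>C\<close> factorises.\<close>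
  have "complex_of_real (\<Sum>C\<in>Pow Y. (norm (\<Sum>B\<in>Pow U. ?e (int a * (q B + r C + (\<Sum>j\<in>C. ?N j B)))))\<^sup>2)
      = (\<Sum>C\<in>Pow Y. \<Sum>B\<in>Pow U. \<Sum>B'\<in>Pow U.
           ?e (int a * (q B - q B')) * ?e (\<Sum>j\<in>C. int a * ?D B B' j))"
  proof -
    have "?e (int a * (q B + r C + (\<Sum>j\<in>C. ?N j B)) - int a * (q B' + r C + (\<Sum>j\<in>C. ?N j B')))
       = ?e (int a * (q B - q B')) * ?e (\<Sum>j\<in>C. int a * ?D B B' j)" for B B' C
    proof -
      have "int a * (q B + r C + (\<Sum>j\<in>C. ?N j B)) - int a * (q B' + r C + (\<Sum>j\<in>C. ?N j B'))
         = int a * (q B - q B') + int a * (\<Sum>j\<in>C. ?D B B' j)"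
        by (simp only: sum_subtractf) (simp only: algebra_simps)
      then show ?thesis by (simp only: add_char_add sum_distrib_left)
    qed
    then show ?thesis by (simp only: of_real_sum norm_char_sum_sq)
  qed
  also have "\<dots> = (\<Sum>B\<in>Pow U. \<Sum>C\<in>Pow Y. \<Sum>B'\<in>Pow U.
           ?e (int a * (q B - q B')) * ?e (\<Sum>j\<in>C. int a * ?D B B' j))"
    by (rule sum.swap)
  also have "\<dots> = (\<Sum>B\<in>Pow U. \<Sum>B'\<in>Pow U. \<Sum>C\<in>Pow Y.
           ?e (int a * (q B - q B')) * ?e (\<Sum>j\<in>C. int a * ?D B B' j))"
    by (intro sum.cong refl sum.swap)
  also have "\<dots> = (\<Sum>B\<in>Pow U. \<Sum>B'\<in>Pow U.
           ?e (int a * (q B - q B')) * (\<Prod>j\<in>Y. 1 + ?e (int a * ?D B B' j)))"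
    by (simp only: sum_Pow_add_char[OF finY] sum_distrib_left[where A = "Pow Y", symmetric])
  finally have eq: "complex_of_real (\<Sum>C\<in>Pow Y. (norm (\<Sum>B\<in>Pow U. ?e (int a * (q B + r C + (\<Sum>j\<in>C. ?N j B)))))\<^sup>2)
      = (\<Sum>B\<in>Pow U. \<Sum>B'\<in>Pow U. ?e (int a * (q B - q B')) * (\<Prod>j\<in>Y. 1 + ?e (int a * ?D B B' j)))"
    (is "complex_of_real ?L = ?R") .
  have "0 \<le> ?L" by (intro sum_nonneg) simp
  then have "?L = norm (complex_of_real ?L)" by (simp only: norm_of_real abs_of_nonneg)
  also have "\<dots> \<le> (\<Sum>B\<in>Pow U. \<Sum>B'\<in>Pow U. \<Prod>j\<in>Y. norm (1 + ?e (int a * ?D B B' j)))"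
    unfolding eq by (intro sum_norm_le) (simp add: norm_mult prod_norm)
  also have "\<dots> = (\<Sum>B\<in>Pow U. \<Sum>B'\<in>Pow U. 2 ^ card Y * (\<Prod>j\<in>Y. t B B' j))"
    by (simp add: t_def prod_dividef)
  also have "\<dots> = 2 ^ card Y * (\<Sum>B\<in>Pow U. \<Sum>B'\<in>Pow U. \<Prod>j\<in>Y. t B B' j)"
    by (simp only: sum_distrib_left)
  finally have L: "?L \<le> 2 ^ card Y * (\<Sum>B\<in>Pow U. \<Sum>B'\<in>Pow U. \<Prod>j\<in>Y. t B B' j)" .
  define ker where "ker k = {(B, B') \<in> Pow U \<times> Pow U. int p dvd ?D B B' (u k) \<and> int p dvd ?D B B' (v k)}" for k
  have cker: "card (ker k) \<le> 4 ^ card U * (1 / (real p)\<^sup>2 + \<rho> ^ K)" if "k \<in> T" for k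
    unfolding ker_def \<rho>_def using p0 finU robust[OF that] by (rule card_pair_kernel_le)
  have t01: "0 \<le> t B B' j" "t B B' j \<le> 1" for B B' j
    using norm_one_plus_add_char_le1[of "int p"] by (simp_all add: t_def)
  have t\<theta>: "t B B' j \<le> sqrt \<rho>" if "\<not> int p dvd ?D B B' j" for B B' j
  proof -
    have "\<not> int p dvd int a * ?D B B' j"
      using that a p by (simp add: prime_dvd_mult_iff)
    from norm_one_plus_add_char[OF p0 this] show ?thesis
      unfolding t_def \<rho>_def by (rule real_le_rsqrt)
  qed
  have prod_le: "real (card T) * (\<Prod>j\<in>Y. t B B' j)
      \<le> real (card T) * sqrt \<rho> ^ card T + (\<Sum>k\<in>T. if (B, B') \<in> ker k then 1 else 0)"
    if BB: "B \<in> Pow U" "B' \<in> Pow U" for B B'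
  proof -
    let ?Z = "{k\<in>T. (B, B') \<in> ker k}"
    let ?n = "card T - card ?Z"
    have cZ: "card ?Z \<le> card T" using finT by (intro card_mono) auto
    have "(\<Prod>j\<in>Y. t B B' j) = (\<Prod>k\<in>T. t B B' (u k)) * (\<Prod>k\<in>T. t B B' (v k))"
      unfolding Y_def using finT inj by (subst prod.union_disjoint) (auto simp: prod.reindex)
    also have "\<dots> = (\<Prod>k\<in>T. t B B' (u k) * t B B' (v k))" by (simp add: prod.distrib)
    also have "\<dots> \<le> (\<Prod>k\<in>T. if (B, B') \<in> ker k then 1 else sqrt \<rho>)"
    proof (rule prod_mono, intro conjI)
      fix k assume "k \<in> T"
      show "0 \<le> t B B' (u k) * t B B' (v k)" by (simp add: t01)
      show "t B B' (u k) * t B B' (v k) \<le> (if (B, B') \<in> ker k then 1 else sqrt \<rho>)"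
      proof (cases "(B, B') \<in> ker k")
        case True
        then show ?thesis by (simp add: mult_le_one t01)
      next
        case False
        then have "t B B' (u k) \<le> sqrt \<rho> \<or> t B B' (v k) \<le> sqrt \<rho>"
          using BB t\<theta> by (auto simp: ker_def)
        then have "t B B' (u k) * t B B' (v k) \<le> sqrt \<rho>"
        proof
          assume "t B B' (u k) \<le> sqrt \<rho>"
          then show ?thesis using mult_mono[of "t B B' (u k)" "sqrt \<rho>" "t B B' (v k)" 1] t01 \<rho> by simp
        next
          assume "t B B' (v k) \<le> sqrt \<rho>"
          then show ?thesis using mult_mono[of "t B B' (u k)" 1 "t B B' (v k)" "sqrt \<rho>"] t01 \<rho> by simp
        qed
        then show ?thesis using False by simp
      qed
    qed
    also have "\<dots> = sqrt \<rho> ^ card (T - ?Z)"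
    proof -
      have "T \<inter> - {k. (B, B') \<in> ker k} = T - ?Z" by auto
      then show ?thesis using finT by (simp add: prod.If_cases)
    qed
    also have "card (T - ?Z) = ?n" using finT by (subst card_Diff_subset) auto
    finally have "real (card T) * (\<Prod>j\<in>Y. t B B' j) \<le> real (card T) * sqrt \<rho> ^ ?n"
      by (intro mult_left_mono) auto
    also have "\<dots> \<le> real ?n * sqrt \<rho> ^ card T + (real (card T) - real ?n)"
      using \<rho> by (intro power_le_chord) auto
    also have "\<dots> \<le> real (card T) * sqrt \<rho> ^ card T + real (card ?Z)"
      using cZ \<rho> by (intro add_mono mult_right_mono) auto
    also have "real (card ?Z) = (\<Sum>k\<in>T. if (B, B') \<in> ker k then 1 else 0)"
      using finT by (simp add: sum.If_cases Int_def)
    finally show ?thesis .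
  qed
  have "real (card T) * (\<Sum>B\<in>Pow U. \<Sum>B'\<in>Pow U. \<Prod>j\<in>Y. t B B' j)
     \<le> (\<Sum>B\<in>Pow U. \<Sum>B'\<in>Pow U. real (card T) * sqrt \<rho> ^ card T + (\<Sum>k\<in>T. if (B, B') \<in> ker k then 1 else 0))"
    unfolding sum_distrib_left using prod_le by (intro sum_mono) auto
  also have "\<dots> = 4 ^ card U * (real (card T) * sqrt \<rho> ^ card T)
      + (\<Sum>B\<in>Pow U. \<Sum>B'\<in>Pow U. \<Sum>k\<in>T. if (B, B') \<in> ker k then 1 else 0)"
    by (simp add: sum.distrib flip: cU)
  also have "(\<Sum>B\<in>Pow U. \<Sum>B'\<in>Pow U. \<Sum>k\<in>T. if (B, B') \<in> ker k then 1 else (0::real))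
      = (\<Sum>z\<in>Pow U \<times> Pow U. \<Sum>k\<in>T. if z \<in> ker k then 1 else 0)"
    by (subst sum.cartesian_product[where A = "Pow U" and B = "Pow U"]) (simp add: case_prod_beta)
  also have "\<dots> = (\<Sum>k\<in>T. \<Sum>z\<in>Pow U \<times> Pow U. if z \<in> ker k then 1 else 0)"
    by (rule sum.swap)
  also have "\<dots> = (\<Sum>k\<in>T. real (card (ker k)))"
  proof (rule sum.cong)
    fix k
    have "Pow U \<times> Pow U \<inter> ker k = ker k" by (auto simp: ker_def)
    then show "(\<Sum>z\<in>Pow U \<times> Pow U. if z \<in> ker k then 1 else 0) = real (card (ker k))"
      using finU by (simp add: sum.If_cases)
  qed simp
  also have "\<dots> \<le> (\<Sum>k\<in>T. 4 ^ card U * (1 / (real p)\<^sup>2 + \<rho> ^ K))"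
    using cker by (intro sum_mono) auto
  also have "\<dots> = real (card T) * (4 ^ card U * (1 / (real p)\<^sup>2 + \<rho> ^ K))" by simp
  finally have "real (card T) * (\<Sum>B\<in>Pow U. \<Sum>B'\<in>Pow U. \<Prod>j\<in>Y. t B B' j)
     \<le> real (card T) * (4 ^ card U * (sqrt \<rho> ^ card T + 1 / (real p)\<^sup>2 + \<rho> ^ K))"
    by (simp add: algebra_simps)
  then have "(\<Sum>B\<in>Pow U. \<Sum>B'\<in>Pow U. \<Prod>j\<in>Y. t B B' j)
     \<le> 4 ^ card U * (sqrt \<rho> ^ card T + 1 / (real p)\<^sup>2 + \<rho> ^ K)"
    using finT T by (simp add: card_gt_0_iff)
  then have "2 ^ card Y * (\<Sum>B\<in>Pow U. \<Sum>B'\<in>Pow U. \<Prod>j\<in>Y. t B B' j)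
     \<le> 2 ^ card Y * (4 ^ card U * (sqrt \<rho> ^ card T + 1 / (real p)\<^sup>2 + \<rho> ^ K))"
    by (intro mult_left_mono) auto
  with L have "?L \<le> 2 ^ card Y * (4 ^ card U * (sqrt \<rho> ^ card T + 1 / (real p)\<^sup>2 + \<rho> ^ K))"
    by (rule order_trans)
  then show ?thesis by (simp only: mult.assoc)
qed

text \<open>
  If the value \<open>z\<close> were missed, then for every choice of \<open>C\<close> the nontrivial characters would carry the excess
  \<open>1/(p - 1)\<close> of \<open>sum_norm_char_sum_sq_ge\<close>, while on average over \<open>C\<close> they carry at most \<open>(p - 1) (1/p^2 + 2/p^3)\<close>.
  These are incompatible since \<open>(p - 1)^2 (p + 2) < p^3\<close>.
\<close>

lemma robust_pairs_imp_surj: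
  fixes p :: nat and M :: "'a \<Rightarrow> 'b \<Rightarrow> int" and u v :: "'k \<Rightarrow> 'b"
  assumes p: "Factorial_Ring.prime p" and finU: "finite U" and finT: "finite T"
    and inj: "inj_on u T" "inj_on v T" "u ` T \<inter> v ` T = {}"
    and robust: "\<And>k \<alpha> \<beta>. k \<in> T \<Longrightarrow> \<not> (int p dvd \<alpha> \<and> int p dvd \<beta>) \<Longrightarrow>
      p ^ 5 \<le> card {i\<in>U. \<not> int p dvd \<alpha> * M i (u k) + \<beta> * M i (v k)}"
    and cT: "2 * p ^ 5 \<le> card T"
  shows "\<exists>B\<subseteq>U. \<exists>C\<subseteq>u ` T \<union> v ` T. int p dvd q B + r C + (\<Sum>j\<in>C. \<Sum>i\<in>B. M i j) - z"
proof (rule ccontr)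
  assume no: "\<not> ?thesis"
  let ?Y = "u ` T \<union> v ` T"
  let ?F = "\<lambda>a C. (norm (\<Sum>B\<in>Pow U.
            add_char (int p) (int a * (q B + r C + (\<Sum>j\<in>C. \<Sum>i\<in>B. M i j)))))\<^sup>2"
  define \<rho> where "\<rho> = 1 - 1 / (real p)\<^sup>2"
  define W where "W = (2::real) ^ card ?Y * 4 ^ card U"
  have W: "W > 0" by (simp add: W_def)
  have p2: "p \<ge> 2" using p by (rule prime_ge_2_nat)
  have \<rho>: "0 \<le> \<rho>" "\<rho> \<le> 1" using p2 by (simp_all add: \<rho>_def)
  have Tne: "T \<noteq> {}" using cT p2 by auto
  have \<rho>p: "\<rho> ^ (p ^ 5) \<le> 1 / real p ^ 3"
    unfolding \<rho>_def using p2 by (intro power_one_minus_inverse_sq_le) simp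
  \<comment> \<open>A pair of columns gains only the factor \<open>sqrt \<rho>\<close>, which is why \<open>2 p^5\<close> pairs are required.\<close>
  have "sqrt \<rho> ^ card T \<le> sqrt \<rho> ^ (2 * p ^ 5)" using cT \<rho> by (intro power_decreasing) auto
  also have "\<dots> = \<rho> ^ (p ^ 5)" using \<rho> by (simp add: power_mult)
  finally have \<theta>p: "sqrt \<rho> ^ card T \<le> 1 / real p ^ 3" using \<rho>p by linarith
  have "(\<Sum>C\<in>Pow ?Y. (real (card (Pow U)))\<^sup>2 / (real p - 1)) \<le> (\<Sum>C\<in>Pow ?Y. \<Sum>a\<in>{1..<p}. ?F a C)"
    using no finU p2 by (intro sum_mono sum_norm_char_sum_sq_ge) auto
  also have "(\<Sum>C\<in>Pow ?Y. (real (card (Pow U)))\<^sup>2 / (real p - 1)) = W / (real p - 1)"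
    using finU finT by (simp add: W_def card_Pow power2_eq_square flip: power_mult_distrib)
  also have "(\<Sum>C\<in>Pow ?Y. \<Sum>a\<in>{1..<p}. ?F a C) = (\<Sum>a\<in>{1..<p}. \<Sum>C\<in>Pow ?Y. ?F a C)"
    by (rule sum.swap)
  also have "\<dots> \<le> (\<Sum>a\<in>{1..<p}. W * (sqrt \<rho> ^ card T + 1 / (real p)\<^sup>2 + \<rho> ^ (p ^ 5)))"
  proof (rule sum_mono)
    fix a assume "a \<in> {1..<p}"
    then have "\<not> p dvd a" by (auto dest: nat_dvd_not_less)
    then show "(\<Sum>C\<in>Pow ?Y. ?F a C) \<le> W * (sqrt \<rho> ^ card T + 1 / (real p)\<^sup>2 + \<rho> ^ (p ^ 5))"
      unfolding W_def \<rho>_def by (intro bilinear_char_sum_le p finU finT Tne inj robust)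
  qed
  also have "\<dots> \<le> (\<Sum>a\<in>{1..<p}. W * (1 / real p ^ 3 + 1 / (real p)\<^sup>2 + 1 / real p ^ 3))"
    using W \<rho>p \<theta>p by (intro sum_mono mult_left_mono add_mono) auto
  also have "\<dots> = (real p - 1) * W * (1 / real p ^ 3 + 1 / (real p)\<^sup>2 + 1 / real p ^ 3)"
    using p2 by (simp add: of_nat_diff)
  finally have "W / (real p - 1) \<le> W * ((real p - 1) * (1 / real p ^ 3 + 1 / (real p)\<^sup>2 + 1 / real p ^ 3))"
    by (simp add: mult_ac)
  then have "W * (1 / (real p - 1)) \<le> W * ((real p - 1) * (1 / real p ^ 3 + 1 / (real p)\<^sup>2 + 1 / real p ^ 3))"
    by simp
  then have "1 / (real p - 1) \<le> (real p - 1) * (1 / real p ^ 3 + 1 / (real p)\<^sup>2 + 1 / real p ^ 3)"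
    using W by (simp only: mult_le_cancel_left_pos)
  also have "1 / real p ^ 3 + 1 / (real p)\<^sup>2 + 1 / real p ^ 3 = (real p + 2) / real p ^ 3"
    using p2 by (simp add: field_simps power2_eq_square power3_eq_cube)
  finally have "real p ^ 3 \<le> (real p - 1) * (real p - 1) * (real p + 2)"
    using p2 by (simp add: field_simps)
  also have "\<dots> = real p ^ 3 - 3 * real p + 2" by (simp add: power3_eq_cube algebra_simps)
  finally show False using p2 by simp
qed

section \<open>Sums of independent blocks\<close>

text \<open>
  The attainable pairs of sums are recorded as pairs of residues, which makes the set finite and lets it be compared with
  the whole plane.
\<close>

definition reach :: "nat \<Rightarrow> ('k \<Rightarrow> 'o set) \<Rightarrow> ('k \<Rightarrow> 'o \<Rightarrow> int) \<Rightarrow> ('k \<Rightarrow> 'o \<Rightarrow> int) \<Rightarrow> 'k set \<Rightarrow> (int \<times> int) set" where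
  "reach p Opt \<phi> \<psi> T = {((\<Sum>k\<in>T. \<phi> k (\<omega> k)) mod int p, (\<Sum>k\<in>T. \<psi> k (\<omega> k)) mod int p) | \<omega>. \<forall>k\<in>T. \<omega> k \<in> Opt k}"

lemma reach_subset:
  assumes "p > 0"
  shows "reach p Opt \<phi> \<psi> T \<subseteq> {0..<int p} \<times> {0..<int p}"
  using assms by (auto simp: reach_def)

lemma reach_insert:
  assumes "finite T" "k \<notin> T" "o1 \<in> Opt k" "(y, z) \<in> reach p Opt \<phi> \<psi> T"
  shows "((y + \<phi> k o1) mod int p, (z + \<psi> k o1) mod int p) \<in> reach p Opt \<phi> \<psi> (insert k T)"
proof -
  obtain \<omega> where \<omega>: "\<forall>k\<in>T. \<omega> k \<in> Opt k" "y = (\<Sum>k\<in>T. \<phi> k (\<omega> k)) mod int p"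
    "z = (\<Sum>k\<in>T. \<psi> k (\<omega> k)) mod int p"
    using assms(4) by (auto simp: reach_def)
  define \<omega>' where "\<omega>' = \<omega>(k := o1)"
  have "(\<Sum>k\<in>insert k T. f k (\<omega>' k)) = f k o1 + (\<Sum>k\<in>T. f k (\<omega> k))" for f :: "'a \<Rightarrow> 'b \<Rightarrow> int"
  proof -
    have "(\<Sum>k\<in>T. f k (\<omega>' k)) = (\<Sum>k\<in>T. f k (\<omega> k))"
      using assms(2) by (intro sum.cong) (auto simp: \<omega>'_def)
    then show ?thesis using assms(1,2) by (simp add: \<omega>'_def)
  qed
  moreover have "\<forall>k\<in>insert k T. \<omega>' k \<in> Opt k" using \<omega>(1) assms(3) by (simp add: \<omega>'_def)
  ultimately show ?thesis
    using \<omega>(2,3) unfolding reach_def by (intro CollectI exI[of _ \<omega>']) (simp add: mod_simps add.commute)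
qed

lemma reach_extend:
  assumes "finite T'" "T \<subseteq> T'" "\<And>k. k \<in> T' \<Longrightarrow> base k \<in> Opt k"
    "\<And>k. k \<in> T' \<Longrightarrow> \<phi> k (base k) = 0 \<and> \<psi> k (base k) = 0"
  shows "reach p Opt \<phi> \<psi> T \<subseteq> reach p Opt \<phi> \<psi> T'"
proof
  fix w assume "w \<in> reach p Opt \<phi> \<psi> T"
  then obtain \<omega> where \<omega>: "\<forall>k\<in>T. \<omega> k \<in> Opt k"
    "w = ((\<Sum>k\<in>T. \<phi> k (\<omega> k)) mod int p, (\<Sum>k\<in>T. \<psi> k (\<omega> k)) mod int p)"
    by (auto simp: reach_def)
  define \<omega>' where "\<omega>' k = (if k \<in> T then \<omega> k else base k)" for k
  have "(\<Sum>k\<in>T. \<phi> k (\<omega> k)) = (\<Sum>k\<in>T'. \<phi> k (\<omega>' k))" "(\<Sum>k\<in>T. \<psi> k (\<omega> k)) = (\<Sum>k\<in>T'. \<psi> k (\<omega>' k))"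
    using assms by (auto intro!: sum.mono_neutral_cong_left simp: \<omega>'_def)
  moreover have "\<forall>k\<in>T'. \<omega>' k \<in> Opt k" using \<omega>(1) assms(2,3) by (auto simp: \<omega>'_def)
  ultimately show "w \<in> reach p Opt \<phi> \<psi> T'" using \<omega>(2) unfolding reach_def by (intro CollectI exI[of _ \<omega>']) simp
qed

text \<open>
  Every block that enlarges the attainable set adds at least one of at most \<open>p^2\<close> pairs. A family \<open>T'\<close> with the largest
  attainable set among those with fewer members than attained pairs can therefore not be improved, and the
  moves of all remaining blocks preserve its attainable set.
\<close>

lemma reach_stabilises:
  fixes p :: nat
  assumes p: "p > 0" and finT: "finite T"
    and base: "\<And>k. k \<in> T \<Longrightarrow> base k \<in> Opt k"
    "\<And>k. k \<in> T \<Longrightarrow> \<phi> k (base k) = 0 \<and> \<psi> k (base k) = 0"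
  obtains T' where "T' \<subseteq> T" "card T' < p\<^sup>2"
    "\<And>k o1 y z. k \<in> T - T' \<Longrightarrow> o1 \<in> Opt k \<Longrightarrow> (y, z) \<in> reach p Opt \<phi> \<psi> T' \<Longrightarrow>
       ((y + \<phi> k o1) mod int p, (z + \<psi> k o1) mod int p) \<in> reach p Opt \<phi> \<psi> T'"
proof -
  let ?R = "reach p Opt \<phi> \<psi>"
  have finR: "finite (?R U)" for U
    using finite_subset[OF reach_subset[OF p]] by blast
  have cR: "card (?R U) \<le> p\<^sup>2" for U
    using card_mono[OF _ reach_subset[OF p, of Opt \<phi> \<psi> U]] by (simp add: power2_eq_square card_cartesian_product)
  \<comment> \<open>The empty family attains one pair, so such families exist.\<close>
  define good where "good U \<longleftrightarrow> U \<subseteq> T \<and> card U < card (?R U)" for U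
  have "?R {} = {(0, 0)}" by (auto simp: reach_def)
  then have "good {}" by (simp add: good_def)
  moreover have "finite {U. good U}" using finT by (simp add: good_def)
  ultimately obtain U where U: "good U" and max: "\<And>U'. good U' \<Longrightarrow> card U' \<le> card U"
    using Max_in[of "card ` {U. good U}"] Max_ge[of "card ` {U. good U}"] by fastforce
  have UT: "U \<subseteq> T" "card U < card (?R U)" "finite U"
    using U finT finite_subset by (auto simp: good_def)
  show thesis
  proof (rule that[of U])
    show "U \<subseteq> T" by (rule UT)
    show "card U < p\<^sup>2" using UT(2) cR[of U] by linarith
    fix k o1 y z assume *: "k \<in> T - U" "o1 \<in> Opt k" "(y, z) \<in> ?R U"
    show "((y + \<phi> k o1) mod int p, (z + \<psi> k o1) mod int p) \<in> ?R U"
    proof (rule ccontr)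
      assume notin: "\<not> ?thesis"
      have "?R U \<subseteq> ?R (insert k U)"
        using * UT base by (intro reach_extend[where base = base]) auto
      moreover have "((y + \<phi> k o1) mod int p, (z + \<psi> k o1) mod int p) \<in> ?R (insert k U)"
        using * UT(3) by (intro reach_insert) auto
      ultimately have "?R U \<subset> ?R (insert k U)" using notin by blast
      then have "card (?R U) < card (?R (insert k U))" by (intro psubset_card_mono finR)
      then have "good (insert k U)" using UT * by (auto simp: good_def)
      from max[OF this] show False using UT(3) * by simp
    qed
  qed
qed

lemma dvd_mod_diff_iff: "q dvd a mod q - b \<longleftrightarrow> q dvd a - (b::int)"
  by (simp add: dvd_eq_mod_eq_0 mod_diff_left_eq)

lemma inverse_mod_prime:
  assumes "Factorial_Ring.prime (p::nat)" "\<not> int p dvd a"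
  obtains b where "int p dvd a * b - 1"
proof -
  have "coprime a (int p)" using assms
    by (metis coprime_commute prime_imp_coprime prime_nat_int_transfer)
  then obtain b where "[a * b = 1] (mod int p)" using cong_solve_coprime_int by blast
  then show thesis using that by (simp add: cong_iff_dvd_diff)
qed

text \<open>
  By \<open>many\<close>, for every line through the origin other than \<open>\<phi> = 0\<close>, some remaining block has a move off that line. So
  the moves that preserve the attainable set generate the vertical direction: either one of them is itself vertical, or two of
  them are linearly independent.
\<close>

lemma block_sums_fill_fibre:
  fixes p :: nat
  assumes p: "Factorial_Ring.prime p" and finT: "finite T"
    and base: "\<And>k. k \<in> T \<Longrightarrow> base k \<in> Opt k"
    "\<And>k. k \<in> T \<Longrightarrow> \<phi> k (base k) = 0 \<and> \<psi> k (base k) = 0"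
    and many: "\<And>\<alpha>. p\<^sup>2 \<le> card {k\<in>T. \<exists>x\<in>Opt k. \<not> int p dvd \<alpha> * \<phi> k x + \<psi> k x}"
  obtains y where "\<And>z. \<exists>\<omega>. (\<forall>k\<in>T. \<omega> k \<in> Opt k) \<and>
     int p dvd (\<Sum>k\<in>T. \<phi> k (\<omega> k)) - y \<and> int p dvd (\<Sum>k\<in>T. \<psi> k (\<omega> k)) - z"
proof -
  let ?R = "reach p Opt \<phi> \<psi>"
  have p0: "p > 0" using p by (rule prime_gt_0_nat)
  obtain T' where T': "T' \<subseteq> T" "card T' < p\<^sup>2" and
    inv: "\<And>k x y z. k \<in> T - T' \<Longrightarrow> x \<in> Opt k \<Longrightarrow> (y, z) \<in> ?R T' \<Longrightarrow>
       ((y + \<phi> k x) mod int p, (z + \<psi> k x) mod int p) \<in> ?R T'"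
    using reach_stabilises[where p = p and T = T and base = base and Opt = Opt and \<phi> = \<phi> and \<psi> = \<psi>] p0 finT base by blast
  have off_line: "\<exists>k\<in>T - T'. \<exists>x\<in>Opt k. \<not> int p dvd \<alpha> * \<phi> k x + \<psi> k x" for \<alpha>
  proof (rule ccontr)
    assume "\<not> ?thesis"
    then have "{k\<in>T. \<exists>x\<in>Opt k. \<not> int p dvd \<alpha> * \<phi> k x + \<psi> k x} \<subseteq> T'" by blast
    then have "card {k\<in>T. \<exists>x\<in>Opt k. \<not> int p dvd \<alpha> * \<phi> k x + \<psi> k x} \<le> card T'"
      using T' finT finite_subset by (intro card_mono) auto
    then show False using many[of \<alpha>] T'(2) by linarith
  qed
  have inv_mult: "((y + int n * \<phi> k x) mod int p, (z + int n * \<psi> k x) mod int p) \<in> ?R T'"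
    if "k \<in> T - T'" "x \<in> Opt k" "(y, z) \<in> ?R T'" for k x y z n
  proof (induction n)
    case 0
    have "y mod int p = y" "z mod int p = z" using that(3) reach_subset[OF p0, of Opt \<phi> \<psi> T'] by auto
    then show ?case using that(3) by simp
  next
    case (Suc n)
    from inv[OF that(1,2) Suc.IH] show ?case by (simp add: mod_simps algebra_simps)
  qed
  have inv_int: "((y + m * \<phi> k x) mod int p, (z + m * \<psi> k x) mod int p) \<in> ?R T'"
    if "k \<in> T - T'" "x \<in> Opt k" "(y, z) \<in> ?R T'" for k x y z m
  proof -
    have "((y + m * \<phi> k x) mod int p, (z + m * \<psi> k x) mod int p)
        = ((y + (m mod int p) * \<phi> k x) mod int p, (z + (m mod int p) * \<psi> k x) mod int p)"
      by (simp add: mod_add_cong[OF refl mod_mult_cong[OF mod_mod_trivial refl]])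
    moreover have "m mod int p = int (nat (m mod int p))" using p0 by simp
    ultimately show ?thesis using inv_mult[OF that] by metis
  qed
  obtain k0 x0 where k0: "k0 \<in> T - T'" "x0 \<in> Opt k0" "\<not> int p dvd \<psi> k0 x0"
    using off_line[of 0] by auto
  let ?a = "\<phi> k0 x0" and ?b = "\<psi> k0 x0"
  have vertical: "\<exists>w. (y, w) \<in> ?R T' \<and> int p dvd w - (z + m)" if yz: "(y, z) \<in> ?R T'" for y z m
  proof (cases "int p dvd ?a")
    case True
    obtain c where c: "int p dvd ?b * c - 1" using inverse_mod_prime[OF p k0(3)] .
    let ?w = "(z + (m * c) * ?b) mod int p"
    have "y = y mod int p" using yz reach_subset[OF p0, of Opt \<phi> \<psi> T'] by auto
    also have "\<dots> = (y + (m * c) * ?a) mod int p" using True by (simp add: mod_eq_dvd_iff)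
    finally have "(y, ?w) \<in> ?R T'" using inv_int[OF k0(1,2) yz, of "m * c"] by simp
    moreover have "int p dvd ?w - (z + m)"
    proof -
      have "z + (m * c) * ?b - (z + m) = m * (?b * c - 1)" by (simp add: algebra_simps)
      then have "int p dvd z + (m * c) * ?b - (z + m)" using c by simp
      then show ?thesis by (simp only: dvd_mod_diff_iff)
    qed
    ultimately show ?thesis by blast
  next
    case False
    obtain c where c: "int p dvd ?a * c - 1" using inverse_mod_prime[OF p False] .
    \<comment> \<open>A move off the line through the first one; a combination of both is vertical with height \<open>m\<close>.\<close>
    obtain k1 x1 where k1: "k1 \<in> T - T'" "x1 \<in> Opt k1" "\<not> int p dvd - (?b * c) * \<phi> k1 x1 + \<psi> k1 x1"
      using off_line[of "- (?b * c)"] by blast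
    let ?a1 = "\<phi> k1 x1" and ?b1 = "\<psi> k1 x1"
    obtain e where e: "int p dvd (- (?b * c) * ?a1 + ?b1) * e - 1" using inverse_mod_prime[OF p k1(3)] .
    define n1 where "n1 = m * e"
    define n0 where "n0 = - (c * ?a1 * n1)"
    let ?y = "(y + n0 * ?a) mod int p" and ?z = "(z + n0 * ?b) mod int p"
    have "(?y, ?z) \<in> ?R T'" using inv_int[OF k0(1,2) yz] .
    from inv_int[OF k1(1,2) this, of n1]
    have mem: "((y + n0 * ?a + n1 * ?a1) mod int p, (z + n0 * ?b + n1 * ?b1) mod int p) \<in> ?R T'"
      by (simp add: mod_simps)
    have "y + n0 * ?a + n1 * ?a1 - y = (?a * c - 1) * (- (?a1 * n1))"
      by (simp add: n0_def algebra_simps)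
    then have "int p dvd y + n0 * ?a + n1 * ?a1 - y" using dvd_mult2[OF c] by (simp only:)
    then have "(y + n0 * ?a + n1 * ?a1) mod int p = y mod int p" by (simp only: mod_eq_dvd_iff)
    also have "\<dots> = y" using yz reach_subset[OF p0, of Opt \<phi> \<psi> T'] by auto
    finally have "(y, (z + n0 * ?b + n1 * ?b1) mod int p) \<in> ?R T'" using mem by simp
    moreover have "int p dvd (z + n0 * ?b + n1 * ?b1) mod int p - (z + m)"
    proof -
      have "z + n0 * ?b + n1 * ?b1 - (z + m) = m * ((- (?b * c) * ?a1 + ?b1) * e - 1)"
        by (simp add: n0_def n1_def algebra_simps)
      then have "int p dvd z + n0 * ?b + n1 * ?b1 - (z + m)" using dvd_mult[OF e] by (simp only:)
      then show ?thesis by (simp only: dvd_mod_diff_iff)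
    qed
    ultimately show ?thesis by blast
  qed
  have "?R {} \<subseteq> ?R T'" using T' finT finite_subset base
    by (intro reach_extend[where base = base]) auto
  moreover have "(0, 0) \<in> ?R {}" by (simp add: reach_def)
  ultimately have start: "(0, 0) \<in> ?R T'" by blast
  have "?R T' \<subseteq> ?R T" using T' finT base by (intro reach_extend[where base = base]) auto
  then have "\<exists>w. (0, w) \<in> ?R T \<and> int p dvd w - z" for z
    using vertical[OF start, of z] by auto
  then have "\<exists>\<omega>. (\<forall>k\<in>T. \<omega> k \<in> Opt k) \<and>
     int p dvd (\<Sum>k\<in>T. \<phi> k (\<omega> k)) - 0 \<and> int p dvd (\<Sum>k\<in>T. \<psi> k (\<omega> k)) - z" for z
    unfolding reach_def by (fastforce simp: dvd_mod_diff_iff)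
  then show thesis by (rule that)
qed

section \<open>Greedy choice of separated pairs\<close>

text \<open>
  Pairs are chosen one after the other outside of the neighbourhoods of the earlier ones; if this stops before
  \<open>m\<close> pairs are found, every related pair meets the neighbourhoods of the chosen points. Two neighbourhood systems are
  used later: singletons, which only make the pairs disjoint, and the closed neighbourhoods of a graph,
  which give an induced matching.
\<close>

lemma separated_pairs_or_cover:
  fixes nb :: "'a \<Rightarrow> 'a set"
  assumes nb: "\<And>i. i \<in> V \<Longrightarrow> i \<in> nb i \<and> finite (nb i) \<and> card (nb i) \<le> D"
    and sym: "\<And>i j. i \<in> V \<Longrightarrow> j \<in> V \<Longrightarrow> i \<in> nb j \<Longrightarrow> j \<in> nb i"
  shows "(\<exists>T. finite T \<and> card T = m \<and> T \<subseteq> V \<times> V \<and> (\<forall>(a, b)\<in>T. a \<noteq> b \<and> R a b) \<and>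
           (\<forall>e\<in>T. \<forall>e'\<in>T. e \<noteq> e' \<longrightarrow> {fst e', snd e'} \<inter> (nb (fst e) \<union> nb (snd e)) = {}))
       \<or> (\<exists>V'\<subseteq>V. card (V - V') \<le> 2 * m * D \<and> (\<forall>a\<in>V'. \<forall>b\<in>V'. a \<noteq> b \<longrightarrow> \<not> R a b))"
    (is "(\<exists>T. ?sep m T) \<or> (\<exists>V'\<subseteq>V. ?cov m V')")
proof (induction m)
  case 0
  show ?case by (intro disjI1 exI[of _ "{}"]) simp
next
  case (Suc m)
  from Suc.IH show ?case
  proof
    assume "\<exists>V'\<subseteq>V. ?cov m V'"
    moreover have "2 * m * D \<le> 2 * Suc m * D" by simp
    ultimately show ?thesis by (meson le_trans)
  next
    assume "\<exists>T. ?sep m T"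
    then obtain T where sep: "?sep m T" ..
    note T = conjunct1[OF sep] conjunct1[OF conjunct2[OF sep]] conjunct1[OF conjunct2[OF conjunct2[OF sep]]]
      conjunct1[OF conjunct2[OF conjunct2[OF conjunct2[OF sep]]]]
    note apart = conjunct2[OF conjunct2[OF conjunct2[OF conjunct2[OF sep]]]]
    define N where "N = (\<Union>e\<in>T. nb (fst e) \<union> nb (snd e))"
    show ?thesis
    proof (cases "\<exists>a\<in>V - N. \<exists>b\<in>V - N. a \<noteq> b \<and> R a b")
      case True
      then obtain a b where ab: "a \<in> V - N" "b \<in> V - N" "a \<noteq> b" "R a b" by blast
      have new: "{a, b} \<inter> (nb (fst e) \<union> nb (snd e)) = {}" if "e \<in> T" for e
        using ab that by (auto simp: N_def)
      have new': "{fst e, snd e} \<inter> (nb a \<union> nb b) = {}" if "e \<in> T" for e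
      proof -
        have "fst e \<in> V" "snd e \<in> V" using that T(3) by auto
        then show ?thesis using new[OF that] sym ab by blast
      qed
      have "(a, b) \<notin> T"
      proof
        assume "(a, b) \<in> T"
        from new[OF this] nb[of a] ab show False by auto
      qed
      then have "?sep (Suc m) (insert (a, b) T)"
        using T ab new new' apart by (intro conjI) auto
      then show ?thesis by blast
    next
      case False
      have "card N \<le> (\<Sum>e\<in>T. card (nb (fst e) \<union> nb (snd e)))"
        unfolding N_def by (rule card_UN_le[OF T(1)])
      also have "\<dots> \<le> (\<Sum>e\<in>T. 2 * D)"
      proof (rule sum_mono)
        fix e assume "e \<in> T"
        then have "fst e \<in> V" "snd e \<in> V" using T(3) by auto
        then have "card (nb (fst e)) + card (nb (snd e)) \<le> 2 * D" using nb[of "fst e"] nb[of "snd e"] by linarith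
        then show "card (nb (fst e) \<union> nb (snd e)) \<le> 2 * D" using card_Un_le le_trans by blast
      qed
      also have "\<dots> \<le> 2 * Suc m * D" using T(2) by simp
      finally have "card N \<le> 2 * Suc m * D" .
      moreover have "finite N" unfolding N_def using T nb by auto
      then have "card (V - (V - N)) \<le> card N" by (intro card_mono) auto
      ultimately have "card (V - (V - N)) \<le> 2 * Suc m * D" by linarith
      then show ?thesis using False by (intro disjI2 exI[of _ "V - N"]) auto
    qed
  qed
qed

section \<open>Matrices of nearly rank one\<close>

text \<open>
  One column that is not sparse serves as a reference: in a sparse combination with it, the coefficient of the
  other column cannot vanish. If there is no such column, the zero vector does.
\<close>

lemma near_parallel_columns:
  fixes p :: nat and H :: "'a \<Rightarrow> 'b \<Rightarrow> int"
  assumes p: "Factorial_Ring.prime p" and K: "K > 0"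
    and par: "\<And>a b. a \<in> V \<Longrightarrow> b \<in> V \<Longrightarrow> a \<noteq> b \<Longrightarrow>
      \<exists>\<alpha> \<beta>. \<not> (int p dvd \<alpha> \<and> int p dvd \<beta>) \<and> card {i\<in>N. \<not> int p dvd \<alpha> * H i a + \<beta> * H i b} < K"
  shows "\<exists>w r. \<forall>j\<in>V. card {i\<in>N. \<not> int p dvd H i j - w j * r i} < K"
proof (cases "\<forall>j\<in>V. card {i\<in>N. \<not> int p dvd H i j} < K")
  case True
  then show ?thesis by (intro exI[of _ "\<lambda>_. 0"]) simp
next
  case False
  then obtain j0 where j0: "j0 \<in> V" "\<not> card {i\<in>N. \<not> int p dvd H i j0} < K" by blast
  have pp: "Factorial_Ring.prime (int p)" using p by simp
  have "\<exists>w. card {i\<in>N. \<not> int p dvd H i j - w * H i j0} < K" if j: "j \<in> V" for j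
  proof (cases "j = j0")
    case True
    then show ?thesis using K by (intro exI[of _ 1]) simp
  next
    case False
    then obtain \<alpha> \<beta> where ab: "\<not> (int p dvd \<alpha> \<and> int p dvd \<beta>)"
      "card {i\<in>N. \<not> int p dvd \<alpha> * H i j0 + \<beta> * H i j} < K"
      using par[OF j0(1) j] by blast
    have nb: "\<not> int p dvd \<beta>"
    proof
      assume b: "int p dvd \<beta>"
      then have "int p dvd \<alpha> * x + \<beta> * y \<longleftrightarrow> int p dvd x" for x y
        using ab(1) pp by (simp add: dvd_add_left_iff prime_dvd_mult_iff)
      then show False using ab(2) j0(2) by simp
    qed
    obtain c where c: "int p dvd \<beta> * c - 1" using inverse_mod_prime[OF p nb] .
    have "int p dvd \<alpha> * x + \<beta> * y \<longleftrightarrow> int p dvd y - (- (c * \<alpha>)) * x" for x y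
    proof -
      have "\<alpha> * x + \<beta> * y = \<beta> * (y - (- (c * \<alpha>)) * x) - (\<beta> * c - 1) * (\<alpha> * x)"
        by (simp add: algebra_simps)
      then have "int p dvd \<alpha> * x + \<beta> * y \<longleftrightarrow> int p dvd \<beta> * (y - (- (c * \<alpha>)) * x)"
        using dvd_diff_left_iff[OF dvd_mult2[OF c]] by (simp only:)
      then show ?thesis using nb pp by (simp only: prime_dvd_mult_iff simp_thms)
    qed
    then show ?thesis using ab(2) by (intro exI[of _ "- (c * \<alpha>)"]) (simp only:)
  qed
  then obtain w where "\<forall>j\<in>V. card {i\<in>N. \<not> int p dvd H i j - w j * H i j0} < K" by metis
  then show ?thesis by (intro exI[of _ w] exI[of _ "\<lambda>i. H i j0"])
qed

text \<open>
  Comparing the entry \<open>H i k\<close> with \<open>H k i\<close> shows that the vectors \<open>(w i, r i)\<close> and \<open>(w k, r k)\<close> in the plane are parallel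
  for most pairs. Some index is then parallel to all but \<open>2 K\<close> others, by averaging, and its direction is the
  common direction of the indices that are kept.
\<close>

lemma symmetric_near_rank_one:
  fixes p :: nat and H :: "'a \<Rightarrow> 'a \<Rightarrow> int"
  assumes p: "Factorial_Ring.prime p" and finN: "finite N" and VN: "V \<subseteq> N" and sym: "\<And>i j. H i j = H j i"
    and near: "\<And>j. j \<in> V \<Longrightarrow> card {i\<in>N. \<not> int p dvd H i j - w j * r i} < K"
  shows "\<exists>V' A l. V' \<subseteq> V \<and> card (V - V') \<le> 2 * K \<and>
           (\<forall>j\<in>V'. card {i\<in>V'. \<not> int p dvd H i j - A * l i * l j} < K)"
proof -
  have finV: "finite V" using VN finN finite_subset by blast
  have pp: "Factorial_Ring.prime (int p)" using p by simp
  define U where "U = {i\<in>V. \<not> (int p dvd w i \<and> int p dvd r i)}"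
  define bad where "bad i k \<longleftrightarrow> \<not> int p dvd w k * r i - w i * r k" for i k
  define D where "D i k \<longleftrightarrow> \<not> int p dvd H i k - w k * r i" for i k
  have finU: "finite U" using finV by (simp add: U_def)
  have DK: "card {i\<in>U. D i k} \<le> K" if "k \<in> V" for k
  proof -
    have "card {i\<in>U. D i k} \<le> card {i\<in>N. D i k}" using finN VN by (intro card_mono) (auto simp: U_def)
    then show ?thesis using near[OF that] by (simp add: D_def)
  qed
  have badD: "D i k \<or> D k i" if "bad i k" for i k
  proof (rule ccontr)
    assume "\<not> ?thesis"
    then have "int p dvd H k i - w i * r k" "int p dvd H i k - w k * r i" by (auto simp: D_def)
    then have "int p dvd (H k i - w i * r k) - (H i k - w k * r i)" by (rule dvd_diff)
    then show False using that sym[of i k] by (simp add: bad_def)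
  qed
  have "\<exists>i0. (U = {} \<or> i0 \<in> U) \<and> card {k\<in>U. bad i0 k} \<le> 2 * K"
  proof (cases "U = {}")
    case False
    show ?thesis
    proof (rule ccontr)
      assume "\<not> ?thesis"
      then have big: "2 * K < card {k\<in>U. bad i k}" if "i \<in> U" for i using that by (meson not_less)
      have "card U * (2 * K) = (\<Sum>i\<in>U. 2 * K)" by simp
      also have "\<dots> < (\<Sum>i\<in>U. card {k\<in>U. bad i k})" using big finU False by (intro sum_strict_mono) auto
      also have "\<dots> \<le> (\<Sum>i\<in>U. card {k\<in>U. D i k} + card {k\<in>U. D k i})"
      proof (rule sum_mono)
        fix i
        have "card {k\<in>U. bad i k} \<le> card ({k\<in>U. D i k} \<union> {k\<in>U. D k i})"
          using badD finU by (intro card_mono) auto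
        also have "\<dots> \<le> card {k\<in>U. D i k} + card {k\<in>U. D k i}" by (rule card_Un_le)
        finally show "card {k\<in>U. bad i k} \<le> card {k\<in>U. D i k} + card {k\<in>U. D k i}" .
      qed
      also have "\<dots> = (\<Sum>i\<in>U. card {k\<in>U. D i k}) + (\<Sum>i\<in>U. card {k\<in>U. D k i})" by (rule sum.distrib)
      also have "(\<Sum>i\<in>U. card {k\<in>U. D i k}) = (\<Sum>i\<in>U. card {k\<in>U. D k i})"
      proof -
        have "(\<Sum>i\<in>U. card {k\<in>U. D i k}) = (\<Sum>i\<in>U. \<Sum>k\<in>U. if D i k then 1 else 0)"
          using finU by (simp add: sum.If_cases Int_def)
        also have "\<dots> = (\<Sum>k\<in>U. \<Sum>i\<in>U. if D i k then 1 else 0)" by (rule sum.swap)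
        also have "\<dots> = (\<Sum>k\<in>U. card {i\<in>U. D i k})" using finU by (simp add: sum.If_cases Int_def)
        finally show ?thesis .
      qed
      also have "(\<Sum>i\<in>U. card {k\<in>U. D k i}) + (\<Sum>i\<in>U. card {k\<in>U. D k i}) \<le> (\<Sum>i\<in>U. K) + (\<Sum>i\<in>U. K)"
        using DK by (intro add_mono sum_mono) (auto simp: U_def)
      also have "\<dots> = card U * (2 * K)" by simp
      finally show False by simp
    qed
  qed simp
  then obtain i0 where i0: "U = {} \<or> i0 \<in> U" "card {k\<in>U. bad i0 k} \<le> 2 * K" by blast
  define V' where "V' = V - {k\<in>U. bad i0 k}"
  have V': "V' \<subseteq> V" "card (V - V') \<le> 2 * K"
  proof -
    show "V' \<subseteq> V" by (auto simp: V'_def)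
    have "V - V' = {k\<in>U. bad i0 k}" by (auto simp: V'_def U_def)
    then show "card (V - V') \<le> 2 * K" using i0(2) by simp
  qed
  have "\<exists>\<tau>. int p dvd w k - \<tau> * w i0 \<and> int p dvd r k - \<tau> * r i0" if k: "k \<in> V'" for k
  proof (cases "k \<in> U")
    case False
    then have "int p dvd w k" "int p dvd r k" using k by (auto simp: U_def V'_def)
    then show ?thesis by (intro exI[of _ 0]) simp
  next
    case True
    then have i0U: "i0 \<in> U" using i0(1) by auto
    have par: "int p dvd w k * r i0 - w i0 * r k" using k True by (auto simp: V'_def bad_def)
    show ?thesis
    proof (cases "int p dvd w i0")
      case False
      obtain c where c: "int p dvd w i0 * c - 1" using inverse_mod_prime[OF p False] .
      have "w k - (c * w k) * w i0 = (w i0 * c - 1) * (- w k)"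
        "r k - (c * w k) * r i0 = (w i0 * c - 1) * (- r k) + (w k * r i0 - w i0 * r k) * (- c)"
        by (simp_all add: algebra_simps)
      then show ?thesis using c par by (intro exI[of _ "c * w k"]) (simp only: dvd_add dvd_mult2 simp_thms)
    next
      case True
      then have "\<not> int p dvd r i0" using i0U by (auto simp: U_def)
      then obtain c where c: "int p dvd r i0 * c - 1" using inverse_mod_prime[OF p] by blast
      have "r k - (c * r k) * r i0 = (r i0 * c - 1) * (- r k)"
        "w k - (c * r k) * w i0 = (r i0 * c - 1) * (- w k) + (w k * r i0 - w i0 * r k) * c"
        by (simp_all add: algebra_simps)
      then show ?thesis using c par by (intro exI[of _ "c * r k"]) (simp only: dvd_add dvd_mult2 simp_thms)
    qed
  qed
  then obtain \<tau> where \<tau>: "\<And>k. k \<in> V' \<Longrightarrow> int p dvd w k - \<tau> k * w i0 \<and> int p dvd r k - \<tau> k * r i0" by metis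
  have "card {i\<in>V'. \<not> int p dvd H i j - (w i0 * r i0) * \<tau> i * \<tau> j} < K" if j: "j \<in> V'" for j
  proof -
    have "int p dvd H i j - (w i0 * r i0) * \<tau> i * \<tau> j \<longleftrightarrow> int p dvd H i j - w j * r i" if i: "i \<in> V'" for i
    proof -
      have "H i j - (w i0 * r i0) * \<tau> i * \<tau> j
         = (H i j - w j * r i) + ((w j - \<tau> j * w i0) * r i + (r i - \<tau> i * r i0) * (\<tau> j * w i0))"
        by (simp add: algebra_simps)
      moreover have "int p dvd (w j - \<tau> j * w i0) * r i + (r i - \<tau> i * r i0) * (\<tau> j * w i0)"
        using \<tau>[OF i] \<tau>[OF j] by (intro dvd_add dvd_mult2) auto
      ultimately show ?thesis by (simp only: dvd_add_left_iff)
    qed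
    then have "{i\<in>V'. \<not> int p dvd H i j - (w i0 * r i0) * \<tau> i * \<tau> j} \<subseteq> {i\<in>N. \<not> int p dvd H i j - w j * r i}"
      using V' VN by auto
    then have "card {i\<in>V'. \<not> int p dvd H i j - (w i0 * r i0) * \<tau> i * \<tau> j} \<le> card {i\<in>N. \<not> int p dvd H i j - w j * r i}"
      using finN by (intro card_mono) auto
    also have "\<dots> < K" using near j V' by blast
    finally show ?thesis .
  qed
  then show ?thesis using V' by blast
qed

text \<open>
  The bilinear part runs over all ordered pairs, so that the index set can be split without being ordered. The univariate
  parts are arbitrary functions since only their values on \<open>S\<close> matter.
\<close>

definition qval :: "'a set \<Rightarrow> ('a \<Rightarrow> int \<Rightarrow> int) \<Rightarrow> ('a \<Rightarrow> 'a \<Rightarrow> int) \<Rightarrow> ('a \<Rightarrow> int) \<Rightarrow> int" where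
  "qval N g H x = (\<Sum>i\<in>N. g i (x i)) + (\<Sum>i\<in>N. \<Sum>j\<in>N. H i j * x i * x j)"

lemma qval_cong:
  assumes "\<And>i. i \<in> N \<Longrightarrow> x i = y i"
  shows "qval N g H x = qval N g H y"
  unfolding qval_def using assms by (intro arg_cong2[where f = "(+)"] sum.cong refl) auto

lemma qval_Un:
  assumes fin: "finite V" "finite I" and disj: "V \<inter> I = {}" and sym: "\<And>i j. H i j = H j i"
  shows "qval (V \<union> I) g H x = qval V g H x + qval I g H x + 2 * (\<Sum>i\<in>V. \<Sum>k\<in>I. H i k * x i * x k)"
proof -
  have "(\<Sum>i\<in>I. \<Sum>j\<in>V. H i j * x i * x j) = (\<Sum>j\<in>V. \<Sum>i\<in>I. H i j * x i * x j)" by (rule sum.swap)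
  also have "\<dots> = (\<Sum>i\<in>V. \<Sum>k\<in>I. H i k * x i * x k)"
    by (intro sum.cong refl) (subst sym, simp add: mult_ac)
  finally show ?thesis
    unfolding qval_def using fin disj
    by (simp add: sum.union_disjoint sum.distrib)
qed

section \<open>Quadratic functions that miss a value\<close>

text \<open>
  The zero diagonal of \<open>H\<close> separates the interactions of different coordinates from the univariate parts \<open>g\<close>. The
  elements \<open>s\<close> and \<open>t\<close> are the two values between which coordinates are switched.
\<close>

locale nonsurjective_quadratic =
  fixes p :: nat and N :: "'a set" and S :: "int set"
    and g :: "'a \<Rightarrow> int \<Rightarrow> int" and H :: "'a \<Rightarrow> 'a \<Rightarrow> int" and z0 s t :: int
  assumes p: "Factorial_Ring.prime p" and odd: "p \<noteq> 2" and finN: "finite N"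
    and sS: "s \<in> S" and tS: "t \<in> S" and st: "\<not> int p dvd t - s"
    and sym: "H i j = H j i" and diag: "H i i = 0"
    and misses: "(\<And>i. i \<in> N \<Longrightarrow> x i \<in> S) \<Longrightarrow> \<not> int p dvd qval N g H x - z0"
begin

lemma pp: "Factorial_Ring.prime (int p)" using p by simp

lemma p_pos: "p > 0" using p by (rule prime_gt_0_nat)

lemma not_dvd_2: "\<not> int p dvd 2"
proof
  assume "int p dvd 2"
  then have "p dvd 2" by (metis int_dvd_int_iff of_nat_numeral)
  then show False using p odd two_is_prime_nat primes_dvd_imp_eq by blast
qed

lemma dvd_cancel: "\<not> int p dvd a \<Longrightarrow> int p dvd a * b \<longleftrightarrow> int p dvd b"
  using pp by (simp add: prime_dvd_mult_iff)

lemma qval_two_valued: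
  assumes UY: "U \<union> Y = N" "U \<inter> Y = {}" and B: "B \<subseteq> U" and C: "C \<subseteq> Y"
  shows "qval N g H (\<lambda>i. s + (t - s) * of_bool (i \<in> B \<union> C)) =
     (qval U g H (\<lambda>i. s + (t - s) * of_bool (i \<in> B)) + 2 * s * (t - s) * (\<Sum>i\<in>B. \<Sum>j\<in>Y. H i j))
   + (qval Y g H (\<lambda>i. s + (t - s) * of_bool (i \<in> C)) + 2 * s * (t - s) * (\<Sum>i\<in>U. \<Sum>j\<in>C. H i j)
       + 2 * s * s * (\<Sum>i\<in>U. \<Sum>j\<in>Y. H i j))
   + (\<Sum>j\<in>C. \<Sum>i\<in>B. 2 * (t - s)\<^sup>2 * H i j)"
proof -
  have fin: "finite U" "finite Y" "finite B" "finite C"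
    using UY B C finN finite_subset by (auto intro: finite_subset)
  let ?x = "\<lambda>i. s + (t - s) * of_bool (i \<in> B \<union> C)"
  let ?u = "\<lambda>i. s + (t - s) * of_bool (i \<in> B)"
  let ?v = "\<lambda>i. s + (t - s) * of_bool (i \<in> C)"
  have xu: "?x i = ?u i" if "i \<in> U" for i using that UY C by auto
  have xv: "?x i = ?v i" if "i \<in> Y" for i using that UY B by auto
  have "qval N g H ?x = qval U g H ?x + qval Y g H ?x + 2 * (\<Sum>i\<in>U. \<Sum>k\<in>Y. H i k * ?x i * ?x k)"
    unfolding UY(1)[symmetric] by (rule qval_Un[OF fin(1,2) UY(2) sym])
  also have "qval U g H ?x = qval U g H ?u" by (rule qval_cong[OF xu])
  also have "qval Y g H ?x = qval Y g H ?v" by (rule qval_cong[OF xv])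
  also have "(\<Sum>i\<in>U. \<Sum>k\<in>Y. H i k * ?x i * ?x k) = (\<Sum>i\<in>U. \<Sum>k\<in>Y. H i k * ?u i * ?v k)"
    by (intro sum.cong refl) (simp only: xu xv)
  also have "\<dots> = (\<Sum>i\<in>U. \<Sum>k\<in>Y. s * s * H i k + s * (t - s) * (of_bool (i \<in> B) * H i k)
       + s * (t - s) * (of_bool (k \<in> C) * H i k) + (t - s)\<^sup>2 * (of_bool (i \<in> B) * (of_bool (k \<in> C) * H i k)))"
    by (intro sum.cong refl) (simp add: algebra_simps power2_eq_square)
  also have "\<dots> = s * s * (\<Sum>i\<in>U. \<Sum>k\<in>Y. H i k)
       + s * (t - s) * (\<Sum>i\<in>U. of_bool (i \<in> B) * (\<Sum>k\<in>Y. H i k))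
       + s * (t - s) * (\<Sum>i\<in>U. \<Sum>k\<in>Y. of_bool (k \<in> C) * H i k)
       + (t - s)\<^sup>2 * (\<Sum>i\<in>U. of_bool (i \<in> B) * (\<Sum>k\<in>Y. of_bool (k \<in> C) * H i k))"
    by (simp only: sum.distrib sum_distrib_left)
  also have "(\<Sum>i\<in>U. of_bool (i \<in> B) * (\<Sum>k\<in>Y. H i k)) = (\<Sum>i\<in>B. \<Sum>k\<in>Y. H i k)"
    using fin B by (intro sum.mono_neutral_cong_right) auto
  also have "(\<Sum>i\<in>U. \<Sum>k\<in>Y. of_bool (k \<in> C) * H i k) = (\<Sum>i\<in>U. \<Sum>k\<in>C. H i k)"
    using fin C by (intro sum.cong refl sum.mono_neutral_cong_right) auto
  also have "(\<Sum>i\<in>U. of_bool (i \<in> B) * (\<Sum>k\<in>Y. of_bool (k \<in> C) * H i k))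
      = (\<Sum>i\<in>B. \<Sum>k\<in>Y. of_bool (k \<in> C) * H i k)"
    using fin B by (intro sum.mono_neutral_cong_right) auto
  also have "\<dots> = (\<Sum>i\<in>B. \<Sum>k\<in>C. H i k)"
    using fin C by (intro sum.cong refl sum.mono_neutral_cong_right) auto
  also have "\<dots> = (\<Sum>k\<in>C. \<Sum>i\<in>B. H i k)" by (rule sum.swap)
  finally have eq: "qval N g H ?x = qval U g H ?u + qval Y g H ?v
       + 2 * (s * s * (\<Sum>i\<in>U. \<Sum>k\<in>Y. H i k) + s * (t - s) * (\<Sum>i\<in>B. \<Sum>k\<in>Y. H i k)
       + s * (t - s) * (\<Sum>i\<in>U. \<Sum>k\<in>C. H i k) + (t - s)\<^sup>2 * (\<Sum>k\<in>C. \<Sum>i\<in>B. H i k))" .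
  have "(\<Sum>j\<in>C. \<Sum>i\<in>B. 2 * (t - s)\<^sup>2 * H i j) = 2 * (t - s)\<^sup>2 * (\<Sum>k\<in>C. \<Sum>i\<in>B. H i k)"
    by (simp only: sum_distrib_left)
  then show ?thesis unfolding eq by (simp only: algebra_simps)
qed

text \<open>
  With the coordinates restricted to \<open>{s, t}\<close>, a point is the set of coordinates that take the value \<open>t\<close>, and \<open>qval_two_valued\<close>
  splits the value into the shape required by \<open>robust_pairs_imp_surj\<close>.
\<close>

lemma few_robust_pairs:
  "\<exists>V\<subseteq>N. card (N - V) \<le> 4 * p ^ 5 \<and> (\<forall>a\<in>V. \<forall>b\<in>V. a \<noteq> b \<longrightarrow>
     (\<exists>\<alpha> \<beta>. \<not> (int p dvd \<alpha> \<and> int p dvd \<beta>) \<and>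
        card {i\<in>N. \<not> int p dvd \<alpha> * H i a + \<beta> * H i b} < 5 * p ^ 5))"
proof -
  define R where "R a b \<longleftrightarrow> (\<forall>\<alpha> \<beta>. \<not> (int p dvd \<alpha> \<and> int p dvd \<beta>) \<longrightarrow>
        5 * p ^ 5 \<le> card {i\<in>N. \<not> int p dvd \<alpha> * H i a + \<beta> * H i b})" for a b
  have "\<not> (\<exists>T. finite T \<and> card T = 2 * p ^ 5 \<and> T \<subseteq> N \<times> N \<and> (\<forall>(a, b)\<in>T. a \<noteq> b \<and> R a b) \<and>
           (\<forall>e\<in>T. \<forall>e'\<in>T. e \<noteq> e' \<longrightarrow> {fst e', snd e'} \<inter> ({fst e} \<union> {snd e}) = {}))"
    (is "\<not> (\<exists>T. ?P T)")
  proof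
    assume "\<exists>T. ?P T"
    then obtain T where PT: "?P T" ..
    note T = conjunct1[OF PT] conjunct1[OF conjunct2[OF PT]] conjunct1[OF conjunct2[OF conjunct2[OF PT]]]
    have TR: "fst e \<noteq> snd e" "R (fst e) (snd e)" if "e \<in> T" for e
      using PT that by (auto simp: case_prod_beta)
    have apart: "{fst e', snd e'} \<inter> ({fst e} \<union> {snd e}) = {}" if "e \<in> T" "e' \<in> T" "e \<noteq> e'" for e e'
      using PT that by blast
    have inj: "inj_on fst T" "inj_on snd T" "fst ` T \<inter> snd ` T = {}"
    proof -
      show "inj_on fst T" "inj_on snd T" by (intro inj_onI; use apart in force)+
      show "fst ` T \<inter> snd ` T = {}"
      proof (rule ccontr)
        assume "fst ` T \<inter> snd ` T \<noteq> {}"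
        then obtain e e' where e: "e \<in> T" "e' \<in> T" "fst e = snd e'" by auto
        then show False using TR(1)[of e] apart[of e e'] by (cases "e = e'") auto
      qed
    qed
    define Y where "Y = fst ` T \<union> snd ` T"
    define U where "U = N - Y"
    have YN: "Y \<subseteq> N" using T(3) by (auto simp: Y_def)
    have UY: "U \<union> Y = N" "U \<inter> Y = {}" using YN by (auto simp: U_def)
    have finU: "finite U" "finite Y" using finN YN finite_subset by (auto simp: U_def)
    have cY: "card Y \<le> 4 * p ^ 5"
    proof -
      have "card Y \<le> card (fst ` T) + card (snd ` T)" unfolding Y_def by (rule card_Un_le)
      also have "\<dots> \<le> card T + card T" by (intro add_mono card_image_le T(1))
      finally show ?thesis using T(2) by simp
    qed
    have "\<exists>B\<subseteq>U. \<exists>C\<subseteq>fst ` T \<union> snd ` T. int p dvd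
        (qval U g H (\<lambda>i. s + (t - s) * of_bool (i \<in> B)) + 2 * s * (t - s) * (\<Sum>i\<in>B. \<Sum>j\<in>Y. H i j))
      + (qval Y g H (\<lambda>i. s + (t - s) * of_bool (i \<in> C)) + 2 * s * (t - s) * (\<Sum>i\<in>U. \<Sum>j\<in>C. H i j)
         + 2 * s * s * (\<Sum>i\<in>U. \<Sum>j\<in>Y. H i j))
      + (\<Sum>j\<in>C. \<Sum>i\<in>B. 2 * (t - s)\<^sup>2 * H i j) - z0"
    proof (rule robust_pairs_imp_surj[OF p finU(1) T(1) inj])
      fix k \<alpha> \<beta> assume k: "k \<in> T" and ab: "\<not> (int p dvd \<alpha> \<and> int p dvd \<beta>)"
      have d2: "\<not> int p dvd 2 * (t - s)\<^sup>2"
        using st not_dvd_2 pp by (simp add: prime_dvd_mult_iff prime_dvd_power_iff)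
      have iff: "int p dvd \<alpha> * (2 * (t - s)\<^sup>2 * H i (fst k)) + \<beta> * (2 * (t - s)\<^sup>2 * H i (snd k))
            \<longleftrightarrow> int p dvd \<alpha> * H i (fst k) + \<beta> * H i (snd k)" for i
      proof -
        have "\<alpha> * (2 * (t - s)\<^sup>2 * H i (fst k)) + \<beta> * (2 * (t - s)\<^sup>2 * H i (snd k))
           = (2 * (t - s)\<^sup>2) * (\<alpha> * H i (fst k) + \<beta> * H i (snd k))" by (simp add: algebra_simps)
        then show ?thesis using dvd_cancel[OF d2] by (simp only:)
      qed
      \<comment> \<open>Of \<open>5 p^5\<close> nonzero entries at least \<open>p^5\<close> lie outside of the at most \<open>4 p^5\<close> columns in \<open>Y\<close>.\<close>
      have "5 * p ^ 5 \<le> card {i\<in>N. \<not> int p dvd \<alpha> * H i (fst k) + \<beta> * H i (snd k)}"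
        using TR(2)[OF k] ab by (auto simp: R_def)
      also have "\<dots> \<le> card ({i\<in>U. \<not> int p dvd \<alpha> * H i (fst k) + \<beta> * H i (snd k)} \<union> Y)"
        using finU by (intro card_mono) (auto simp: U_def)
      also have "\<dots> \<le> card {i\<in>U. \<not> int p dvd \<alpha> * H i (fst k) + \<beta> * H i (snd k)} + card Y"
        by (rule card_Un_le)
      finally show "p ^ 5 \<le> card {i\<in>U. \<not> int p dvd \<alpha> * (2 * (t - s)\<^sup>2 * H i (fst k)) + \<beta> * (2 * (t - s)\<^sup>2 * H i (snd k))}"
        unfolding iff using cY by simp
    qed (use T(2) in simp)
    then obtain B C where BC: "B \<subseteq> U" "C \<subseteq> Y" and
      "int p dvd qval N g H (\<lambda>i. s + (t - s) * of_bool (i \<in> B \<union> C)) - z0"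
      unfolding Y_def[symmetric] using qval_two_valued[OF UY] by metis
    moreover have "s + (t - s) * of_bool (i \<in> B \<union> C) \<in> S" for i using sS tS by (cases "i \<in> B \<union> C") auto
    ultimately show False using misses[of "\<lambda>i. s + (t - s) * of_bool (i \<in> B \<union> C)"] by blast
  qed
  then have no: "\<not> (\<exists>T. ?P T)" .
  have "(\<exists>T. ?P T) \<or> (\<exists>V'\<subseteq>N. card (N - V') \<le> 2 * (2 * p ^ 5) * 1 \<and> (\<forall>a\<in>V'. \<forall>b\<in>V'. a \<noteq> b \<longrightarrow> \<not> R a b))"
    by (rule separated_pairs_or_cover) auto
  then have "\<exists>V'\<subseteq>N. card (N - V') \<le> 2 * (2 * p ^ 5) * 1 \<and> (\<forall>a\<in>V'. \<forall>b\<in>V'. a \<noteq> b \<longrightarrow> \<not> R a b)"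
  proof
    assume "\<exists>T. ?P T"
    with no show ?thesis by (rule notE)
  qed
  then obtain V where "V \<subseteq> N" "card (N - V) \<le> 4 * p ^ 5" "\<forall>a\<in>V. \<forall>b\<in>V. a \<noteq> b \<longrightarrow> \<not> R a b"
    by auto
  then show ?thesis unfolding R_def by (meson not_le)
qed

text \<open>
  The blocks \<open>D k\<close> vary independently and all other coordinates stay at \<open>w\<close>. Because blocks interact only through \<open>A l i l j\<close>, the
  value is \<open>A \<Phi>^2 + \<Psi>\<close> up to a constant, where \<open>\<Phi>\<close> and \<open>\<Psi>\<close> add up the contributions \<open>\<phi> k\<close> and \<open>f k\<close>.
  If \<open>\<Psi>\<close> could take all values while \<open>\<Phi>\<close> is fixed, no value would be missed.
\<close>

lemma few_moving_blocks:
  fixes D :: "'k \<Rightarrow> 'a set" and Opt :: "'k \<Rightarrow> ('a \<Rightarrow> int) set"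
  assumes finT: "finite T" and DN: "\<And>k. k \<in> T \<Longrightarrow> D k \<subseteq> N"
    and disj: "\<And>k k'. k \<in> T \<Longrightarrow> k' \<in> T \<Longrightarrow> k \<noteq> k' \<Longrightarrow> D k \<inter> D k' = {}"
    and E: "\<And>k k' i j. k \<in> T \<Longrightarrow> k' \<in> T \<Longrightarrow> k \<noteq> k' \<Longrightarrow> i \<in> D k \<Longrightarrow> j \<in> D k' \<Longrightarrow>
        int p dvd H i j - A * l i * l j"
    and wS: "\<And>i. i \<in> N \<Longrightarrow> w i \<in> S" and wO: "\<And>k. k \<in> T \<Longrightarrow> w \<in> Opt k"
    and OS: "\<And>k y i. k \<in> T \<Longrightarrow> y \<in> Opt k \<Longrightarrow> i \<in> D k \<Longrightarrow> y i \<in> S"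
  defines "V \<equiv> \<Union>k\<in>T. D k"
  defines "c \<equiv> \<lambda>i. 2 * (\<Sum>k\<in>N - V. H i k * w k)"
  defines "\<phi> \<equiv> \<lambda>k y. \<Sum>i\<in>D k. l i * (y i - w i)"
  defines "f \<equiv> \<lambda>k y. (\<Sum>i\<in>D k. g i (y i) + c i * y i)
                    + (\<Sum>i\<in>D k. \<Sum>j\<in>D k. (H i j - A * l i * l j) * y i * y j)"
  shows "\<exists>\<alpha>. card {k\<in>T. \<exists>y\<in>Opt k. \<not> int p dvd \<alpha> * \<phi> k y + (f k y - f k w)} < p\<^sup>2"
proof (rule ccontr)
  assume "\<not> ?thesis"
  then have many: "p\<^sup>2 \<le> card {k\<in>T. \<exists>y\<in>Opt k. \<not> int p dvd \<alpha> * \<phi> k y + (f k y - f k w)}" for \<alpha>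
    by (meson not_less)
  have finD: "finite (D k)" if "k \<in> T" for k using DN[OF that] finN finite_subset by blast
  have VN: "V \<subseteq> N" using DN by (auto simp: V_def)
  have finV: "finite V" using VN finN finite_subset by blast
  have sumV: "sum F V = (\<Sum>k\<in>T. sum F (D k))" for F :: "'a \<Rightarrow> int"
    unfolding V_def using finT finD disj by (intro sum.UNION_disjoint) auto
  define \<kappa> where "\<kappa> i = (THE k. k \<in> T \<and> i \<in> D k)" for i
  have \<kappa>: "\<kappa> i = k" if "k \<in> T" "i \<in> D k" for i k
    unfolding \<kappa>_def using that disj by (intro the_equality) auto
  define x where "x \<omega> i = (if i \<in> V then \<omega> (\<kappa> i) i else w i)" for \<omega> :: "'k \<Rightarrow> 'a \<Rightarrow> int" and i
  have xD: "x \<omega> i = \<omega> k i" if "k \<in> T" "i \<in> D k" for \<omega> i k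
    using that \<kappa> by (auto simp: x_def V_def)
  have xw: "x \<omega> i = w i" if "i \<in> N - V" for \<omega> i using that by (simp add: x_def)
  define \<Phi>0 where "\<Phi>0 = (\<Sum>i\<in>V. l i * w i)"
  define c0 where "c0 = (\<Sum>k\<in>T. f k w) + qval (N - V) g H w"
  have val: "int p dvd qval N g H (x \<omega>) -
       (A * (\<Phi>0 + (\<Sum>k\<in>T. \<phi> k (\<omega> k)))\<^sup>2 + (\<Sum>k\<in>T. f k (\<omega> k) - f k w) + c0)" for \<omega>
  proof -
    let ?x = "x \<omega>"
    let ?E = "\<lambda>i j. (H i j - A * l i * l j) * ?x i * ?x j"
    have "qval N g H ?x = qval (V \<union> (N - V)) g H ?x" using VN by (simp add: Un_absorb1)
    also have "\<dots> = qval V g H ?x + qval (N - V) g H ?x + 2 * (\<Sum>i\<in>V. \<Sum>k\<in>N - V. H i k * ?x i * ?x k)"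
      using finV finN sym by (intro qval_Un) auto
    also have "qval (N - V) g H ?x = qval (N - V) g H w" by (rule qval_cong) (rule xw)
    also have "2 * (\<Sum>i\<in>V. \<Sum>k\<in>N - V. H i k * ?x i * ?x k) = (\<Sum>i\<in>V. c i * ?x i)"
      unfolding c_def sum_distrib_left sum_distrib_right
      by (intro sum.cong refl) (simp add: xw)
    also have "qval V g H ?x = (\<Sum>i\<in>V. g i (?x i)) + (A * (\<Sum>i\<in>V. l i * ?x i)\<^sup>2 + (\<Sum>i\<in>V. \<Sum>j\<in>V. ?E i j))"
    proof -
      have "(\<Sum>i\<in>V. l i * ?x i)\<^sup>2 = (\<Sum>i\<in>V. \<Sum>j\<in>V. (l i * ?x i) * (l j * ?x j))"
        by (simp only: power2_eq_square sum_product)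
      then have "A * (\<Sum>i\<in>V. l i * ?x i)\<^sup>2 = (\<Sum>i\<in>V. \<Sum>j\<in>V. A * ((l i * ?x i) * (l j * ?x j)))"
        by (simp only: sum_distrib_left)
      then have "A * (\<Sum>i\<in>V. l i * ?x i)\<^sup>2 + (\<Sum>i\<in>V. \<Sum>j\<in>V. ?E i j) = (\<Sum>i\<in>V. \<Sum>j\<in>V. H i j * ?x i * ?x j)"
        by (simp add: sum.distrib[symmetric] algebra_simps)
      then show ?thesis unfolding qval_def by simp
    qed
    finally have q1: "qval N g H ?x = (\<Sum>i\<in>V. g i (?x i) + c i * ?x i) + A * (\<Sum>i\<in>V. l i * ?x i)\<^sup>2
         + (\<Sum>i\<in>V. \<Sum>j\<in>V. ?E i j) + qval (N - V) g H w"
      by (simp add: sum.distrib)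
    have lin: "(\<Sum>i\<in>V. l i * ?x i) = \<Phi>0 + (\<Sum>k\<in>T. \<phi> k (\<omega> k))"
      unfolding \<Phi>0_def \<phi>_def sumV sum.distrib[symmetric]
      by (intro sum.cong refl) (simp add: xD algebra_simps sum.distrib sum_subtractf)
    have "(\<Sum>i\<in>V. \<Sum>j\<in>V. ?E i j) - (\<Sum>k\<in>T. \<Sum>i\<in>D k. \<Sum>j\<in>D k. ?E i j)
        = (\<Sum>k\<in>T. \<Sum>i\<in>D k. \<Sum>j\<in>V - D k. ?E i j)"
    proof -
      have "(\<Sum>j\<in>V. ?E i j) - (\<Sum>j\<in>D k. ?E i j) = (\<Sum>j\<in>V - D k. ?E i j)" if "k \<in> T" for i k
        using that finV by (subst sum_diff) (auto simp: V_def)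
      then show ?thesis unfolding sumV[of "\<lambda>i. \<Sum>j\<in>V. ?E i j"] by (simp add: sum_subtractf[symmetric])
    qed
    also have "int p dvd \<dots>"
    proof (intro dvd_sum)
      fix k i j assume *: "k \<in> T" "i \<in> D k" "j \<in> V - D k"
      then obtain k' where "k' \<in> T" "j \<in> D k'" by (auto simp: V_def)
      then have "int p dvd H i j - A * l i * l j" using * E by blast
      then show "int p dvd ?E i j" by simp
    qed
    finally have q2: "int p dvd (\<Sum>i\<in>V. \<Sum>j\<in>V. ?E i j) - (\<Sum>k\<in>T. \<Sum>i\<in>D k. \<Sum>j\<in>D k. ?E i j)" .
    have "(\<Sum>i\<in>V. g i (?x i) + c i * ?x i) + (\<Sum>k\<in>T. \<Sum>i\<in>D k. \<Sum>j\<in>D k. ?E i j) = (\<Sum>k\<in>T. f k (\<omega> k))"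
      unfolding sumV f_def sum.distrib[symmetric, where A = T] by (intro sum.cong refl) (simp add: xD)
    then have "qval N g H ?x -
       (A * (\<Phi>0 + (\<Sum>k\<in>T. \<phi> k (\<omega> k)))\<^sup>2 + (\<Sum>k\<in>T. f k (\<omega> k) - f k w) + c0)
      = (\<Sum>i\<in>V. \<Sum>j\<in>V. ?E i j) - (\<Sum>k\<in>T. \<Sum>i\<in>D k. \<Sum>j\<in>D k. ?E i j)"
      unfolding q1 lin c0_def by (simp add: sum_subtractf)
    then show ?thesis using q2 by (simp only:)
  qed
  obtain y where y: "\<And>z. \<exists>\<omega>. (\<forall>k\<in>T. \<omega> k \<in> Opt k) \<and>
     int p dvd (\<Sum>k\<in>T. \<phi> k (\<omega> k)) - y \<and> int p dvd (\<Sum>k\<in>T. f k (\<omega> k) - f k w) - z"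
    using block_sums_fill_fibre[where p = p and T = T and base = "\<lambda>_. w" and Opt = Opt and \<phi> = \<phi>
        and \<psi> = "\<lambda>k y. f k y - f k w"] p finT wO many by (auto simp: \<phi>_def)
  obtain \<omega> where \<omega>: "\<forall>k\<in>T. \<omega> k \<in> Opt k" and d1: "int p dvd (\<Sum>k\<in>T. \<phi> k (\<omega> k)) - y"
    and d2: "int p dvd (\<Sum>k\<in>T. f k (\<omega> k) - f k w) - (z0 - A * (\<Phi>0 + y)\<^sup>2 - c0)"
    using y by blast
  have "x \<omega> i \<in> S" if "i \<in> N" for i
  proof (cases "i \<in> V")
    case True
    then obtain k where "k \<in> T" "i \<in> D k" by (auto simp: V_def)
    then show ?thesis using xD OS \<omega> by auto
  next
    case False
    then show ?thesis using xw wS that by simp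
  qed
  then have "\<not> int p dvd qval N g H (x \<omega>) - z0" by (rule misses)
  moreover have "qval N g H (x \<omega>) - z0 = (qval N g H (x \<omega>) -
       (A * (\<Phi>0 + (\<Sum>k\<in>T. \<phi> k (\<omega> k)))\<^sup>2 + (\<Sum>k\<in>T. f k (\<omega> k) - f k w) + c0))
     + ((\<Sum>k\<in>T. f k (\<omega> k) - f k w) - (z0 - A * (\<Phi>0 + y)\<^sup>2 - c0))
     + ((\<Sum>k\<in>T. \<phi> k (\<omega> k)) - y) * (A * (2 * \<Phi>0 + (\<Sum>k\<in>T. \<phi> k (\<omega> k)) + y))"
    by (simp add: power2_eq_square algebra_simps)
  moreover have "int p dvd \<dots>" by (intro dvd_add val d2 dvd_mult2 d1)
  ultimately show False by simp
qed

text \<open>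
  The edges of an induced matching of the error graph are the blocks. On such an edge the mixed second difference of
  \<open>\<alpha> \<phi> + f\<close> is a nonzero multiple of the error, so every block moves off every line, and \<open>p^2\<close> edges are too many.
\<close>

lemma few_error_edges:
  assumes VN: "V \<subseteq> N"
    and sparse: "\<And>j. j \<in> V \<Longrightarrow> card {i\<in>V. \<not> int p dvd H i j - A * l i * l j} < K"
  shows "\<exists>V'\<subseteq>V. card (V - V') \<le> 2 * p\<^sup>2 * K \<and>
           (\<forall>a\<in>V'. \<forall>b\<in>V'. a \<noteq> b \<longrightarrow> int p dvd H a b - A * l a * l b)"
proof -
  have finV: "finite V" using VN finN finite_subset by blast
  define nb where "nb j = insert j {i\<in>V. \<not> int p dvd H i j - A * l i * l j}" for j
  have nb: "i \<in> nb i \<and> finite (nb i) \<and> card (nb i) \<le> K" if "i \<in> V" for i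
  proof -
    have "card (nb i) \<le> Suc (card {j\<in>V. \<not> int p dvd H j i - A * l j * l i})"
      unfolding nb_def by (rule card_insert_le_m1) simp_all
    then show ?thesis using sparse[OF that] finV by (simp add: nb_def)
  qed
  have Esym: "H i j - A * l i * l j = H j i - A * l j * l i" for i j by (simp add: sym[of i j])
  have nbsym: "j \<in> nb i" if "i \<in> V" "j \<in> V" "i \<in> nb j" for i j
    using that Esym[of i j] by (auto simp: nb_def)
  have no: "\<not> (\<exists>T. finite T \<and> card T = p\<^sup>2 \<and> T \<subseteq> V \<times> V \<and>
      (\<forall>(a, b)\<in>T. a \<noteq> b \<and> \<not> int p dvd H a b - A * l a * l b) \<and>
      (\<forall>e\<in>T. \<forall>e'\<in>T. e \<noteq> e' \<longrightarrow> {fst e', snd e'} \<inter> (nb (fst e) \<union> nb (snd e)) = {}))"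
    (is "\<not> (\<exists>T. ?P T)")
  proof
    assume "\<exists>T. ?P T"
    then obtain T where PT: "?P T" ..
    note T = conjunct1[OF PT] conjunct1[OF conjunct2[OF PT]] conjunct1[OF conjunct2[OF conjunct2[OF PT]]]
    have TR: "fst e \<noteq> snd e" "\<not> int p dvd H (fst e) (snd e) - A * l (fst e) * l (snd e)" if "e \<in> T" for e
      using PT that by (auto simp: case_prod_beta)
    have TV: "fst e \<in> V" "snd e \<in> V" if "e \<in> T" for e using T(3) that by auto
    have apart: "{fst e', snd e'} \<inter> (nb (fst e) \<union> nb (snd e)) = {}" if "e \<in> T" "e' \<in> T" "e \<noteq> e'" for e e'
      using PT that by blast
    let ?D = "\<lambda>e. {fst e, snd e}"
    let ?w = "\<lambda>_::'a. s"
    let ?Opt = "\<lambda>_::'a \<times> 'a. {y. \<forall>i. y i \<in> {s, t}}"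
    let ?V = "\<Union>e\<in>T. ?D e"
    let ?c = "\<lambda>i. 2 * (\<Sum>k\<in>N - ?V. H i k * ?w k)"
    let ?\<phi> = "\<lambda>e y. \<Sum>i\<in>?D e. l i * (y i - ?w i)"
    let ?f = "\<lambda>e y. (\<Sum>i\<in>?D e. g i (y i) + ?c i * y i)
                    + (\<Sum>i\<in>?D e. \<Sum>j\<in>?D e. (H i j - A * l i * l j) * y i * y j)"
    have "\<exists>\<alpha>. card {e\<in>T. \<exists>y\<in>?Opt e. \<not> int p dvd \<alpha> * ?\<phi> e y + (?f e y - ?f e ?w)} < p\<^sup>2"
    proof (rule few_moving_blocks)
      show "?D e \<subseteq> N" if "e \<in> T" for e using TV[OF that] VN by auto
      show "?D e \<inter> ?D e' = {}" if "e \<in> T" "e' \<in> T" "e \<noteq> e'" for e e'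
        using apart[OF that] by (auto simp: nb_def)
      show "int p dvd H i j - A * l i * l j"
        if "e \<in> T" "e' \<in> T" "e \<noteq> e'" "i \<in> ?D e" "j \<in> ?D e'" for e e' i j
      proof -
        have "j \<notin> nb i" using apart[OF that(1-3)] that(4,5) by auto
        moreover have "j \<in> V" using TV[OF that(2)] that(5) by auto
        ultimately have "int p dvd H j i - A * l j * l i" by (simp add: nb_def)
        then show ?thesis using Esym[of i j] by (simp only:)
      qed
    qed (use T(1) sS tS in auto)
    then obtain \<alpha> where "card {e\<in>T. \<exists>y\<in>?Opt e. \<not> int p dvd \<alpha> * ?\<phi> e y + (?f e y - ?f e ?w)} < p\<^sup>2" ..
    then have "{e\<in>T. \<exists>y\<in>?Opt e. \<not> int p dvd \<alpha> * ?\<phi> e y + (?f e y - ?f e ?w)} \<noteq> T"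
      using T(2) by auto
    then obtain e where e: "e \<in> T" and all: "\<And>y. y \<in> ?Opt e \<Longrightarrow> int p dvd \<alpha> * ?\<phi> e y + (?f e y - ?f e ?w)"
      by blast
    define a b where "a = fst e" and "b = snd e"
    have ab: "a \<noteq> b" "\<not> int p dvd H a b - A * l a * l b" using TR[OF e] by (simp_all add: a_def b_def)
    define F where "F u v = \<alpha> * (l a * (u - s) + l b * (v - s)) +
       ((g a u + ?c a * u) + (g b v + ?c b * v)
         + ((H a a - A * l a * l a) * u * u + (H a b - A * l a * l b) * u * v
           + ((H a b - A * l a * l b) * v * u + (H b b - A * l b * l b) * v * v))
         - ?f e ?w)" for u v
    have F: "int p dvd F u v" if uv: "u \<in> {s, t}" "v \<in> {s, t}" for u v
    proof -
      define y where "y i = (if i = a then u else if i = b then v else s)" for i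
      have yab: "y a = u" "y b = v" using ab(1) by (simp_all add: y_def)
      have D: "?D e = {a, b}" by (simp add: a_def b_def)
      have "y \<in> ?Opt e" using uv by (auto simp: y_def)
      from all[OF this] have "int p dvd \<alpha> * ?\<phi> e y + (?f e y - ?f e ?w)" .
      moreover have "?\<phi> e y = l a * (u - s) + l b * (v - s)" unfolding D using ab(1) by (simp add: yab)
      moreover have "?f e y = (g a u + ?c a * u) + (g b v + ?c b * v)
         + ((H a a - A * l a * l a) * u * u + (H a b - A * l a * l b) * u * v
           + ((H a b - A * l a * l b) * v * u + (H b b - A * l b * l b) * v * v))"
        unfolding D using ab(1) by (simp add: yab Esym[of b a])
      ultimately show ?thesis unfolding F_def by (simp only:)
    qed
    \<comment> \<open>Linear and univariate contributions cancel in the mixed second difference.\<close>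
    have "int p dvd (F t t - F t s) - (F s t - F s s)" by (intro dvd_diff F) auto
    also have "(F t t - F t s) - (F s t - F s s) = 2 * ((t - s) * ((t - s) * (H a b - A * l a * l b)))"
      unfolding F_def by (simp only: algebra_simps)
    finally show False using not_dvd_2 st ab(2) by (simp only: dvd_cancel simp_thms)
  qed
  have "(\<exists>T. ?P T) \<or> (\<exists>V'\<subseteq>V. card (V - V') \<le> 2 * p\<^sup>2 * K \<and>
           (\<forall>a\<in>V'. \<forall>b\<in>V'. a \<noteq> b \<longrightarrow> \<not> \<not> int p dvd H a b - A * l a * l b))"
    by (rule separated_pairs_or_cover[OF nb nbsym])
  then have "\<exists>V'\<subseteq>V. card (V - V') \<le> 2 * p\<^sup>2 * K \<and>
           (\<forall>a\<in>V'. \<forall>b\<in>V'. a \<noteq> b \<longrightarrow> \<not> \<not> int p dvd H a b - A * l a * l b)"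
  proof
    assume "\<exists>T. ?P T"
    with no show ?thesis by (rule notE)
  qed
  then show ?thesis by (simp only: not_not)
qed

text \<open>
  Here the blocks are single coordinates, and the diagonal error \<open>- A (l i)^2\<close> becomes the quadratic term.
\<close>

lemma few_nonlinear_coordinates:
  assumes VN: "V \<subseteq> N"
    and rank1: "\<And>i j. i \<in> V \<Longrightarrow> j \<in> V \<Longrightarrow> i \<noteq> j \<Longrightarrow> int p dvd H i j - A * l i * l j"
    and wS: "\<And>i. i \<in> N \<Longrightarrow> w i \<in> S"
  shows "\<exists>\<alpha> U. U \<subseteq> V \<and> card U < p\<^sup>2 \<and> (\<forall>i\<in>V - U. \<forall>z\<in>S. int p dvd
       \<alpha> * (l i * (z - w i)) + (g i z - g i (w i)) + 2 * (\<Sum>k\<in>N - V. H i k * w k) * (z - w i)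
         - A * (l i)\<^sup>2 * (z\<^sup>2 - (w i)\<^sup>2))"
proof -
  have finV: "finite V" using VN finN finite_subset by blast
  let ?D = "\<lambda>i. {i}"
  let ?Opt = "\<lambda>i. {y. y i \<in> S}"
  let ?V = "\<Union>k\<in>V. ?D k"
  let ?c = "\<lambda>i. 2 * (\<Sum>k\<in>N - ?V. H i k * w k)"
  let ?\<phi> = "\<lambda>k y. \<Sum>i\<in>?D k. l i * (y i - w i)"
  let ?f = "\<lambda>k y. (\<Sum>i\<in>?D k. g i (y i) + ?c i * y i)
                    + (\<Sum>i\<in>?D k. \<Sum>j\<in>?D k. (H i j - A * l i * l j) * y i * y j)"
  have "\<exists>\<alpha>. card {k\<in>V. \<exists>y\<in>?Opt k. \<not> int p dvd \<alpha> * ?\<phi> k y + (?f k y - ?f k w)} < p\<^sup>2"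
    by (rule few_moving_blocks) (use VN finV rank1 wS in auto)
  then obtain \<alpha> where \<alpha>: "card {k\<in>V. \<exists>y\<in>?Opt k. \<not> int p dvd \<alpha> * ?\<phi> k y + (?f k y - ?f k w)} < p\<^sup>2"
    (is "card ?X < _") ..
  show ?thesis
  proof (intro exI conjI ballI)
    show "?X \<subseteq> V" by blast
    show "card ?X < p\<^sup>2" by (rule \<alpha>)
    fix i z assume i: "i \<in> V - ?X" and z: "z \<in> S"
    then have "int p dvd \<alpha> * ?\<phi> i (\<lambda>_. z) + (?f i (\<lambda>_. z) - ?f i w)" by auto
    also have "\<alpha> * ?\<phi> i (\<lambda>_. z) + (?f i (\<lambda>_. z) - ?f i w) = \<alpha> * (l i * (z - w i)) + (g i z - g i (w i))
       + 2 * (\<Sum>k\<in>N - V. H i k * w k) * (z - w i) - A * (l i)\<^sup>2 * (z\<^sup>2 - (w i)\<^sup>2)"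
      by (simp add: diag power2_eq_square algebra_simps)
    finally show "int p dvd \<dots>" .
  qed
qed

text \<open>
  The last two properties come from \<open>few_nonlinear_coordinates\<close>, applied to the constant point \<open>s\<close> and to the points in
  which one deleted coordinate \<open>k\<close> is switched to \<open>t\<close>. The difference of the two linear relations isolates
  \<open>H i k\<close> and shows that it is proportional to \<open>l i\<close>, with a factor \<open>\<mu> k\<close> that depends only on \<open>k\<close>.
  For the coordinates that are deleted because of these relations, \<open>\<mu> k\<close> is \<open>A l k\<close>.
\<close>

theorem rank_one_structure:
  obtains V A l \<mu> \<nu> where "V \<subseteq> N" "card (N - V) \<le> 53 * p ^ 9" "int p dvd A \<longrightarrow> (\<forall>i. l i = 0)"
    "\<And>i j. i \<in> V \<Longrightarrow> j \<in> V \<Longrightarrow> i \<noteq> j \<Longrightarrow> int p dvd H i j - A * l i * l j"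
    "\<And>i k. i \<in> V \<Longrightarrow> k \<in> N - V \<Longrightarrow> int p dvd H i k - \<mu> k * l i"
    "\<And>i z. i \<in> V \<Longrightarrow> z \<in> S \<Longrightarrow>
        int p dvd g i z - g i s - (A * (l i)\<^sup>2 * (z\<^sup>2 - s\<^sup>2) + \<nu> * l i * (z - s))"
proof -
  obtain V1 where V1: "V1 \<subseteq> N" "card (N - V1) \<le> 4 * p ^ 5" and
    par: "\<forall>a\<in>V1. \<forall>b\<in>V1. a \<noteq> b \<longrightarrow> (\<exists>\<alpha> \<beta>. \<not> (int p dvd \<alpha> \<and> int p dvd \<beta>) \<and>
        card {i\<in>N. \<not> int p dvd \<alpha> * H i a + \<beta> * H i b} < 5 * p ^ 5)"
    using few_robust_pairs by blast
  have "\<exists>w r. \<forall>j\<in>V1. card {i\<in>N. \<not> int p dvd H i j - w j * r i} < 5 * p ^ 5"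
    by (rule near_parallel_columns[OF p]) (use p_pos par in auto)
  then obtain w r where wr: "\<forall>j\<in>V1. card {i\<in>N. \<not> int p dvd H i j - w j * r i} < 5 * p ^ 5" by blast
  have "\<exists>V2 A l. V2 \<subseteq> V1 \<and> card (V1 - V2) \<le> 2 * (5 * p ^ 5) \<and>
           (\<forall>j\<in>V2. card {i\<in>V2. \<not> int p dvd H i j - A * l i * l j} < 5 * p ^ 5)"
    by (rule symmetric_near_rank_one[OF p finN V1(1) sym]) (use wr in auto)
  then obtain V2 A l' where V2: "V2 \<subseteq> V1" "card (V1 - V2) \<le> 10 * p ^ 5"
    "\<forall>j\<in>V2. card {i\<in>V2. \<not> int p dvd H i j - A * l' i * l' j} < 5 * p ^ 5" by auto
  have "\<exists>V3\<subseteq>V2. card (V2 - V3) \<le> 2 * p\<^sup>2 * (5 * p ^ 5) \<and>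
           (\<forall>a\<in>V3. \<forall>b\<in>V3. a \<noteq> b \<longrightarrow> int p dvd H a b - A * l' a * l' b)"
    by (rule few_error_edges) (use V1 V2 in auto)
  then obtain V3 where V3': "V3 \<subseteq> V2" "card (V2 - V3) \<le> 10 * p ^ 7"
    "\<And>a b. a \<in> V3 \<Longrightarrow> b \<in> V3 \<Longrightarrow> a \<noteq> b \<Longrightarrow> int p dvd H a b - A * l' a * l' b"
    by (auto simp flip: power_add)
  \<comment> \<open>If \<open>A\<close> vanishes, the choice \<open>l = 0\<close> avoids a spurious linear form.\<close>
  define l where "l i = (if int p dvd A then 0 else l' i)" for i
  have l0: "int p dvd A \<longrightarrow> (\<forall>i. l i = 0)" by (simp add: l_def)
  have "int p dvd H a b - A * l a * l b" if "a \<in> V3" "b \<in> V3" "a \<noteq> b" for a b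
  proof (cases "int p dvd A")
    case True
    then have "int p dvd H a b - A * l' a * l' b + A * (l' a * l' b)" using V3'(3)[OF that] by (intro dvd_add) auto
    then show ?thesis using True by (simp add: l_def)
  next
    case False
    then show ?thesis using V3'(3)[OF that] by (simp add: l_def)
  qed
  note V3 = V3'(1,2) this
  have V3N: "V3 \<subseteq> N" using V1 V2 V3 by blast
  define I where "I = N - V3"
  have cI: "card I \<le> 24 * p ^ 7"
  proof -
    have "I = (N - V1) \<union> (V1 - V2) \<union> (V2 - V3)" using V1 V2 V3 by (auto simp: I_def)
    then have "card I \<le> card (N - V1) + card (V1 - V2) + card (V2 - V3)"
      by (metis (no_types, opaque_lifting) add_le_mono1 card_Un_le le_trans)
    also have "\<dots> \<le> 14 * p ^ 5 + 10 * p ^ 7" using V1 V2 V3 by simp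
    also have "p ^ 5 \<le> p ^ 7" using p_pos by (intro power_increasing) auto
    finally show ?thesis by simp
  qed
  define d where "d = t - s"
  let ?c = "\<lambda>w i. 2 * (\<Sum>k\<in>I. H i k * w k)"
  let ?P = "\<lambda>w \<alpha> U. U \<subseteq> V3 \<and> card U < p\<^sup>2 \<and> (\<forall>i\<in>V3 - U. \<forall>z\<in>S. int p dvd
       \<alpha> * (l i * (z - w i)) + (g i z - g i (w i)) + ?c w i * (z - w i) - A * (l i)\<^sup>2 * (z\<^sup>2 - (w i)\<^sup>2))"
  have ex: "\<exists>\<alpha> U. ?P w \<alpha> U" if "\<And>i. i \<in> N \<Longrightarrow> w i \<in> S" for w
    unfolding I_def by (rule few_nonlinear_coordinates[OF V3N V3(3) that])
  let ?w0 = "\<lambda>_::'a. s"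
  obtain \<alpha>0 X0 where X0: "?P ?w0 \<alpha>0 X0" using ex[of ?w0] sS by auto
  have "\<exists>\<alpha> U. ?P (?w0(k := t)) \<alpha> U" for k
    using sS tS by (intro ex) auto
  then have "\<forall>k. \<exists>\<alpha> U. ?P (?w0(k := t)) \<alpha> U" by (rule allI)
  from choice[OF this] obtain \<alpha> where "\<forall>k. \<exists>U. ?P (?w0(k := t)) (\<alpha> k) U" ..
  from choice[OF this] obtain U where "\<forall>k. ?P (?w0(k := t)) (\<alpha> k) (U k)" ..
  then have U: "?P (?w0(k := t)) (\<alpha> k) (U k)" for k by (rule spec)
  define X' where "X' = X0 \<union> (\<Union>k\<in>I. U k)"
  define V where "V = V3 - X'"
  have finI: "finite I" using finN by (simp add: I_def)
  have XV: "X' \<subseteq> V3" using X0 U by (auto simp: X'_def)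
  have "card X' \<le> card X0 + card (\<Union>k\<in>I. U k)" unfolding X'_def by (rule card_Un_le)
  also have "card (\<Union>k\<in>I. U k) \<le> (\<Sum>k\<in>I. card (U k))" by (rule card_UN_le[OF finI])
  also have "\<dots> \<le> (\<Sum>k\<in>I. p\<^sup>2)" using U by (intro sum_mono less_imp_le) blast
  also have "card X0 \<le> p\<^sup>2" using X0 by simp
  finally have cX': "card X' \<le> p\<^sup>2 + card I * p\<^sup>2" by simp
  have NV: "N - V = I \<union> X'" using V3N XV by (auto simp: V_def I_def)
  have cV: "card (N - V) \<le> 53 * p ^ 9"
  proof -
    have "card (N - V) \<le> card I + card X'" unfolding NV by (rule card_Un_le)
    also have "\<dots> \<le> card I + (p\<^sup>2 + card I * p\<^sup>2)" using cX' by simp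
    also have "\<dots> \<le> 24 * p ^ 7 + (p\<^sup>2 + 24 * p ^ 7 * p\<^sup>2)" using cI by (intro add_mono mult_right_mono) auto
    also have "\<dots> = 24 * p ^ 7 + p\<^sup>2 + 24 * p ^ 9" by (simp flip: power_add)
    also have "p ^ 7 \<le> p ^ 9" using p_pos by (intro power_increasing) auto
    also have "p\<^sup>2 \<le> p ^ 9" using p_pos by (intro power_increasing) auto
    finally show ?thesis by simp
  qed
  have base: "int p dvd \<alpha>0 * (l i * (z - s)) + (g i z - g i s) + ?c ?w0 i * (z - s) - A * (l i)\<^sup>2 * (z\<^sup>2 - s\<^sup>2)"
    if "i \<in> V" "z \<in> S" for i z
    using X0 that by (auto simp: V_def X'_def)
  have nd: "\<not> int p dvd d" unfolding d_def by (rule st)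
  then have "\<not> int p dvd 2 * d" using not_dvd_2 dvd_cancel by blast
  then obtain e where e: "int p dvd 2 * d * e - 1" using inverse_mod_prime[OF p] by blast
  define \<mu> where "\<mu> k = (if k \<in> I then - ((\<alpha> k - \<alpha>0) * e) else A * l k)" for k
  have \<mu>I: "int p dvd H i k - \<mu> k * l i" if i: "i \<in> V" and k: "k \<in> I" for i k
  proof -
    have ik: "i \<noteq> k" using i k by (auto simp: V_def I_def)
    have iX: "i \<in> V3 - U k" using i k by (auto simp: V_def X'_def)
    have "int p dvd \<alpha> k * (l i * (t - s)) + (g i t - g i s) + ?c (?w0(k := t)) i * (t - s)
         - A * (l i)\<^sup>2 * (t\<^sup>2 - s\<^sup>2)"
      using bspec[OF bspec[OF conjunct2[OF conjunct2[OF U[of k]]] iX] tS] ik by (simp only: fun_upd_other simp_thms)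
    then have "int p dvd (\<alpha> k * (l i * (t - s)) + (g i t - g i s) + ?c (?w0(k := t)) i * (t - s)
         - A * (l i)\<^sup>2 * (t\<^sup>2 - s\<^sup>2))
       - (\<alpha>0 * (l i * (t - s)) + (g i t - g i s) + ?c ?w0 i * (t - s) - A * (l i)\<^sup>2 * (t\<^sup>2 - s\<^sup>2))"
      using base[OF i tS] by (rule dvd_diff)
    moreover have "?c (?w0(k := t)) i = ?c ?w0 i + 2 * (H i k * d)"
    proof -
      have "(\<Sum>m\<in>I. H i m * (?w0(k := t)) m) = (\<Sum>m\<in>I. H i m * s + (if m = k then H i k * d else 0))"
        by (intro sum.cong refl) (auto simp: d_def algebra_simps)
      also have "\<dots> = (\<Sum>m\<in>I. H i m * s) + H i k * d" using finI k by (simp add: sum.distrib)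
      finally show ?thesis by simp
    qed
    moreover have "(\<alpha> k * (l i * (t - s)) + (g i t - g i s) + (u + 2 * (H i k * d)) * (t - s)
         - A * (l i)\<^sup>2 * (t\<^sup>2 - s\<^sup>2))
       - (\<alpha>0 * (l i * (t - s)) + (g i t - g i s) + u * (t - s) - A * (l i)\<^sup>2 * (t\<^sup>2 - s\<^sup>2))
       = d * ((\<alpha> k - \<alpha>0) * l i + 2 * d * H i k)" for u
      unfolding d_def by (simp only: algebra_simps)
    ultimately have "int p dvd d * ((\<alpha> k - \<alpha>0) * l i + 2 * d * H i k)" by (simp only:)
    then have dv: "int p dvd (\<alpha> k - \<alpha>0) * l i + 2 * d * H i k" using dvd_cancel[OF nd] by blast
    have "H i k - \<mu> k * l i = ((\<alpha> k - \<alpha>0) * l i + 2 * d * H i k) * e - (2 * d * e - 1) * H i k"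
      using k by (simp add: \<mu>_def algebra_simps)
    then show ?thesis using dvd_diff[OF dvd_mult2[OF dv] dvd_mult2[OF e]] by (simp only:)
  qed
  have \<mu>: "int p dvd H i k - \<mu> k * l i" if i: "i \<in> V" and k: "k \<in> N - V" for i k
  proof (cases "k \<in> I")
    case False
    then have "k \<in> V3" "i \<in> V3" "i \<noteq> k" using i k NV XV by (auto simp: V_def)
    then have "int p dvd H i k - A * l i * l k" by (intro V3(3))
    then show ?thesis using False by (simp add: \<mu>_def mult_ac)
  qed (use \<mu>I i in blast)
  define M where "M = 2 * (\<Sum>m\<in>I. \<mu> m * s)"
  have lin: "int p dvd g i z - g i s - (A * (l i)\<^sup>2 * (z\<^sup>2 - s\<^sup>2) + (- (\<alpha>0 + M)) * l i * (z - s))"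
    if i: "i \<in> V" and z: "z \<in> S" for i z
  proof -
    have "?c ?w0 i - M * l i = 2 * (\<Sum>m\<in>I. (H i m - \<mu> m * l i) * s)"
      by (simp add: M_def sum_distrib_left sum_distrib_right left_diff_distrib sum_subtractf algebra_simps)
    also have "int p dvd \<dots>" using \<mu>I[OF i] by (intro dvd_mult dvd_sum dvd_mult2) auto
    finally have c: "int p dvd ?c ?w0 i - M * l i" .
    have eq: "g i z - g i s - (A * (l i)\<^sup>2 * (z\<^sup>2 - s\<^sup>2) + (- (\<alpha>0 + M)) * l i * (z - s))
      = (\<alpha>0 * (l i * (z - s)) + (g i z - g i s) + u * (z - s) - A * (l i)\<^sup>2 * (z\<^sup>2 - s\<^sup>2))
        - (u - M * l i) * (z - s)" for u
      by (simp add: algebra_simps)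
    show ?thesis unfolding eq[of "?c ?w0 i"] by (rule dvd_diff[OF base[OF i z] dvd_mult2[OF c]])
  qed
  show thesis
  proof (rule that[OF _ cV l0 _ \<mu> lin])
    show "V \<subseteq> N" using V3N by (auto simp: V_def)
    show "int p dvd H i j - A * l i * l j" if "i \<in> V" "j \<in> V" "i \<noteq> j" for i j
      using that by (intro V3(3)) (auto simp: V_def)
  qed
qed

end

section \<open>Completing the square\<close>

definition quadratic_form :: "'a set \<Rightarrow> int \<Rightarrow> ('a \<Rightarrow> int) \<Rightarrow> ('a \<Rightarrow> 'a \<Rightarrow> int) \<Rightarrow> ('a \<Rightarrow> int) \<Rightarrow> int" where
  "quadratic_form I c b M x = c + (\<Sum>i\<in>I. b i * x i) + (\<Sum>i\<in>I. \<Sum>j\<in>I. M i j * (x i * x j))"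

lemma qval_eq_quadratic_form:
  assumes "finite I"
  shows "qval I (\<lambda>i z. a i * z\<^sup>2 + b i * z) H x
       = quadratic_form I 0 b (\<lambda>i j. H i j + (if i = j then a i else 0)) x"
proof -
  have "(\<Sum>i\<in>I. \<Sum>j\<in>I. (H i j + (if i = j then a i else 0)) * (x i * x j))
      = (\<Sum>i\<in>I. (\<Sum>j\<in>I. H i j * x i * x j) + (\<Sum>j\<in>I. if i = j then a i * (x i)\<^sup>2 else 0))"
    unfolding sum.distrib[symmetric] by (intro sum.cong refl) (auto simp: algebra_simps power2_eq_square)
  also have "\<dots> = (\<Sum>i\<in>I. \<Sum>j\<in>I. H i j * x i * x j) + (\<Sum>i\<in>I. a i * (x i)\<^sup>2)"
    using assms by (simp add: sum.distrib)
  finally show ?thesis by (simp add: qval_def quadratic_form_def sum.distrib)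
qed

context nonsurjective_quadratic
begin

text \<open>
  The vertical moves alone: with \<open>\<phi> = 0\<close>, \<open>block_sums_fill_fibre\<close> is a statement about one sum.
\<close>

lemma linear_form_takes_all_values:
  assumes VN: "V \<subseteq> N" and many: "p\<^sup>2 \<le> card {i\<in>V. \<not> int p dvd l i}"
  obtains x where "\<And>i. i \<in> N \<Longrightarrow> x i \<in> S" "\<And>i. i \<notin> V \<Longrightarrow> x i = s" "int p dvd (\<Sum>i\<in>V. l i * x i) - u"
proof -
  have finV: "finite V" using VN finN finite_subset by blast
  have "{i\<in>V. \<not> int p dvd l i} \<subseteq> {i\<in>V. \<exists>z\<in>S. \<not> int p dvd \<alpha> * 0 + l i * (z - s)}" for \<alpha>
    using tS st pp by (auto simp: prime_dvd_mult_iff)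
  then have "card {i\<in>V. \<not> int p dvd l i} \<le> card {i\<in>V. \<exists>z\<in>S. \<not> int p dvd \<alpha> * 0 + l i * (z - s)}" for \<alpha>
    using finV by (intro card_mono) auto
  then have "p\<^sup>2 \<le> card {i\<in>V. \<exists>z\<in>S. \<not> int p dvd \<alpha> * 0 + l i * (z - s)}" for \<alpha>
    using many le_trans by blast
  then obtain y :: int where "\<And>z. \<exists>\<omega>. (\<forall>i\<in>V. \<omega> i \<in> S) \<and> int p dvd (\<Sum>i\<in>V. 0) - y \<and>
      int p dvd (\<Sum>i\<in>V. l i * (\<omega> i - s)) - z"
    using block_sums_fill_fibre[OF p finV, where base = "\<lambda>_. s" and Opt = "\<lambda>_. S" and \<phi> = "\<lambda>_ _. 0"
        and \<psi> = "\<lambda>i z. l i * (z - s)"] sS by auto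
  then obtain \<omega> where \<omega>: "\<forall>i\<in>V. \<omega> i \<in> S" "int p dvd (\<Sum>i\<in>V. l i * (\<omega> i - s)) - (u - (\<Sum>i\<in>V. l i * s))"
    by blast
  define x where "x i = (if i \<in> V then \<omega> i else s)" for i
  have eq: "(\<Sum>i\<in>V. l i * x i) - u = (\<Sum>i\<in>V. l i * (\<omega> i - s)) - (u - (\<Sum>i\<in>V. l i * s))"
    by (simp add: x_def right_diff_distrib sum_subtractf)
  show thesis
  proof (rule that[of x])
    show "int p dvd (\<Sum>i\<in>V. l i * x i) - u" unfolding eq by (rule \<omega>(2))
  qed (use \<omega>(1) sS in \<open>auto simp: x_def\<close>)
qed

text \<open>
  If \<open>l\<close> has many nonzero entries on the kept coordinates, the value is
  \<open>A \<Lambda>^2 + \<Lambda> (\<nu> + 2 m)\<close> up to a polynomial in the deleted ones, where \<open>\<Lambda>\<close> is the linear form \<open>l\<close> and \<open>m\<close> the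
  linear form \<open>\<mu>\<close> in the deleted coordinates. With \<open>2 A B = 1\<close> this is \<open>A (\<Lambda> + B (\<nu> + 2 m))^2\<close> minus a polynomial in the
  deleted coordinates.
\<close>

theorem quadratic_structure:
  assumes g: "\<And>i z. g i z = a i * z\<^sup>2 + b i * z"
  shows "\<exists>I\<subseteq>N. card I \<le> 54 * p ^ 9 \<and>
    ((\<exists>c \<beta> M. \<forall>x. (\<forall>i\<in>N. x i \<in> S) \<longrightarrow> [qval N g H x = quadratic_form I c \<beta> M x] (mod int p)) \<or>
     (\<exists>A l0 l c \<beta> M. \<not> int p dvd A \<and>
        (\<forall>x. (\<forall>i\<in>N. x i \<in> S) \<longrightarrow>
           [qval N g H x = A * (l0 + (\<Sum>i\<in>N. l i * x i))\<^sup>2 + quadratic_form I c \<beta> M x] (mod int p)) \<and>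
        (\<forall>u. \<exists>x. (\<forall>i\<in>N. x i \<in> S) \<and> (\<forall>i\<in>I. x i = s) \<and> [l0 + (\<Sum>i\<in>N. l i * x i) = u] (mod int p))))"
proof -
  obtain V A l \<mu> \<nu> where V: "V \<subseteq> N" "card (N - V) \<le> 53 * p ^ 9" and l0: "int p dvd A \<longrightarrow> (\<forall>i. l i = 0)"
    and HV: "\<And>i j. i \<in> V \<Longrightarrow> j \<in> V \<Longrightarrow> i \<noteq> j \<Longrightarrow> int p dvd H i j - A * l i * l j"
    and H\<mu>: "\<And>i k. i \<in> V \<Longrightarrow> k \<in> N - V \<Longrightarrow> int p dvd H i k - \<mu> k * l i"
    and g\<nu>: "\<And>i z. i \<in> V \<Longrightarrow> z \<in> S \<Longrightarrow>
        int p dvd g i z - g i s - (A * (l i)\<^sup>2 * (z\<^sup>2 - s\<^sup>2) + \<nu> * l i * (z - s))"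
    by (rule rank_one_structure) blast
  have finV: "finite V" using V(1) finN finite_subset by blast
  define W where "W = {i\<in>V. \<not> int p dvd l i}"
  show ?thesis
  proof (cases "card W < p\<^sup>2")
    case True
    \<comment> \<open>Few nonzero entries of \<open>l\<close>: deleting them leaves no dependence on the kept coordinates.\<close>
    define V0 where "V0 = V - W"
    define I where "I = N - V0"
    have fin: "finite V0" "finite I" using finV finN by (auto simp: V0_def I_def)
    have NI: "V0 \<union> I = N" "V0 \<inter> I = {}" using V(1) by (auto simp: I_def V0_def)
    have "card I \<le> card (N - V) + card W"
    proof -
      have "I \<subseteq> (N - V) \<union> W" by (auto simp: I_def V0_def)
      then have "card I \<le> card ((N - V) \<union> W)"
        using finN finV by (intro card_mono) (auto simp: W_def)
      then show ?thesis using card_Un_le le_trans by blast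
    qed
    also have "\<dots> \<le> 53 * p ^ 9 + p\<^sup>2" using V(2) True by simp
    also have "p\<^sup>2 \<le> p ^ 9" using p_pos by (intro power_increasing) auto
    finally have cI: "card I \<le> 54 * p ^ 9" by simp
    have li: "int p dvd l i" if "i \<in> V0" for i using that by (auto simp: V0_def W_def)
    have H0: "int p dvd H i k" if i: "i \<in> V0" and k: "k \<in> N" for i k
    proof -
      consider "k = i" | "k \<in> V" "k \<noteq> i" | "k \<in> N - V" using k by blast
      then show ?thesis
      proof cases
        case 1
        then show ?thesis by (simp add: diag)
      next
        case 2
        then have "int p dvd (H i k - A * l i * l k) + A * l i * l k"
          using HV[of i k] i li[OF i] by (intro dvd_add) (auto simp: V0_def)
        then show ?thesis by simp
      next
        case 3
        then have "int p dvd (H i k - \<mu> k * l i) + \<mu> k * l i"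
          using H\<mu>[of i k] i li[OF i] by (intro dvd_add) (auto simp: V0_def)
        then show ?thesis by simp
      qed
    qed
    have g0: "[g i z = g i s] (mod int p)" if i: "i \<in> V0" and z: "z \<in> S" for i z
    proof -
      have "int p dvd (g i z - g i s - (A * (l i)\<^sup>2 * (z\<^sup>2 - s\<^sup>2) + \<nu> * l i * (z - s)))
          + (A * (l i)\<^sup>2 * (z\<^sup>2 - s\<^sup>2) + \<nu> * l i * (z - s))"
        using g\<nu>[of i z] i z li[OF i] by (intro dvd_add) (auto simp: V0_def power2_eq_square)
      then show ?thesis by (simp add: cong_iff_dvd_diff)
    qed
    define c where "c = (\<Sum>i\<in>V0. g i s)"
    have main: "[qval N g H x = quadratic_form I c b (\<lambda>i j. H i j + (if i = j then a i else 0)) x] (mod int p)"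
      if x: "\<forall>i\<in>N. x i \<in> S" for x
    proof -
      have "qval N g H x = qval V0 g H x + qval I g H x + 2 * (\<Sum>i\<in>V0. \<Sum>k\<in>I. H i k * x i * x k)"
        unfolding NI(1)[symmetric] by (rule qval_Un[OF fin NI(2) sym])
      moreover have "[(\<Sum>i\<in>V0. g i (x i)) = c] (mod int p)"
        unfolding c_def using g0 x NI by (intro cong_sum) auto
      moreover have "[(\<Sum>i\<in>V0. \<Sum>j\<in>V0. H i j * x i * x j) = 0] (mod int p)"
        unfolding cong_0_iff using H0 NI by (intro dvd_sum dvd_mult2) auto
      moreover have "[2 * (\<Sum>i\<in>V0. \<Sum>k\<in>I. H i k * x i * x k) = 0] (mod int p)"
        unfolding cong_0_iff using H0 NI by (intro dvd_mult dvd_sum dvd_mult2) auto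
      ultimately have "[qval N g H x = (c + 0) + qval I g H x + 0] (mod int p)"
        unfolding qval_def[of V0] by (simp only:) (intro cong_add cong_refl)
      also have "(c + 0) + qval I g H x + 0 = quadratic_form I c b (\<lambda>i j. H i j + (if i = j then a i else 0)) x"
        using qval_eq_quadratic_form[OF fin(2), of a b H x] by (simp add: g[abs_def] quadratic_form_def)
      finally show ?thesis .
    qed
    show ?thesis
      using cI main by (intro exI[of _ I] conjI disjI1 exI[of _ c] exI[of _ b]
          exI[of _ "\<lambda>i j. H i j + (if i = j then a i else 0)"] allI impI) (auto simp: I_def)
  next
    case False
    then have many: "p\<^sup>2 \<le> card {i\<in>V. \<not> int p dvd l i}" by (simp add: W_def)
    have A: "\<not> int p dvd A"
    proof
      assume "int p dvd A"
      then have "W = {}" using l0 by (auto simp: W_def)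
      then show False using False p_pos by simp
    qed
    then have "\<not> int p dvd 2 * A" using not_dvd_2 dvd_cancel by blast
    then obtain B where B: "int p dvd 2 * A * B - 1" using inverse_mod_prime[OF p] by blast
    have B': "int p dvd 1 - 2 * A * B" using B by (subst dvd_diff_commute)
    define I where "I = N - V"
    have fin: "finite V" "finite I" using finV finN by (auto simp: I_def)
    have NI: "V \<union> I = N" "V \<inter> I = {}" using V(1) by (auto simp: I_def)
    define \<kappa> where "\<kappa> = (\<Sum>i\<in>V. g i s - A * (l i)\<^sup>2 * s\<^sup>2 - \<nu> * l i * s)"
    define lam where "lam i = (if i \<in> V then l i else 2 * B * \<mu> i)" for i
    define M where "M i j = H i j + (if i = j then a i else 0) - 4 * A * B\<^sup>2 * \<mu> i * \<mu> j" for i j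
    define \<beta> where "\<beta> i = b i - 4 * A * B\<^sup>2 * \<nu> * \<mu> i" for i
    define c where "c = \<kappa> - A * B\<^sup>2 * \<nu>\<^sup>2"
    have lamx: "B * \<nu> + (\<Sum>i\<in>N. lam i * x i) = (\<Sum>i\<in>V. l i * x i) + B * (\<nu> + 2 * (\<Sum>k\<in>I. \<mu> k * x k))" for x
    proof -
      have "(\<Sum>i\<in>N. lam i * x i) = (\<Sum>i\<in>V. lam i * x i) + (\<Sum>i\<in>I. lam i * x i)"
        unfolding NI(1)[symmetric] by (rule sum.union_disjoint[OF fin NI(2)])
      also have "(\<Sum>i\<in>V. lam i * x i) = (\<Sum>i\<in>V. l i * x i)" by (intro sum.cong) (auto simp: lam_def)
      also have "(\<Sum>i\<in>I. lam i * x i) = (\<Sum>i\<in>I. 2 * B * (\<mu> i * x i))" by (intro sum.cong) (auto simp: lam_def I_def)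
      also have "\<dots> = 2 * B * (\<Sum>i\<in>I. \<mu> i * x i)" by (simp only: sum_distrib_left)
      finally show ?thesis by (simp add: algebra_simps)
    qed
    have main: "[qval N g H x = A * (B * \<nu> + (\<Sum>i\<in>N. lam i * x i))\<^sup>2 + quadratic_form I c \<beta> M x] (mod int p)"
      if x: "\<forall>i\<in>N. x i \<in> S" for x
    proof -
      define \<Lambda> where "\<Lambda> = (\<Sum>i\<in>V. l i * x i)"
      define m where "m = (\<Sum>k\<in>I. \<mu> k * x k)"
      have q1: "qval N g H x = qval V g H x + qval I g H x + 2 * (\<Sum>i\<in>V. \<Sum>k\<in>I. H i k * x i * x k)"
        unfolding NI(1)[symmetric] by (rule qval_Un[OF fin NI(2) sym])
      have "[(\<Sum>i\<in>V. \<Sum>k\<in>I. H i k * x i * x k) = (\<Sum>i\<in>V. \<Sum>k\<in>I. \<mu> k * l i * x i * x k)] (mod int p)"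
        using H\<mu> by (intro cong_sum cong_mult cong_refl) (auto simp: cong_iff_dvd_diff I_def)
      also have "(\<Sum>i\<in>V. \<Sum>k\<in>I. \<mu> k * l i * x i * x k) = \<Lambda> * m"
        unfolding \<Lambda>_def m_def sum_product by (intro sum.cong refl) (simp only: mult_ac)
      finally have q2: "[2 * (\<Sum>i\<in>V. \<Sum>k\<in>I. H i k * x i * x k) = 2 * (\<Lambda> * m)] (mod int p)"
        by (intro cong_mult cong_refl)
      have "[(\<Sum>i\<in>V. \<Sum>j\<in>V. H i j * x i * x j)
          = (\<Sum>i\<in>V. \<Sum>j\<in>V. (A * l i * l j - (if i = j then A * (l i)\<^sup>2 else 0)) * x i * x j)] (mod int p)"
        using HV by (intro cong_sum cong_mult cong_refl) (auto simp: cong_iff_dvd_diff diag power2_eq_square)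
      also have "(\<Sum>i\<in>V. \<Sum>j\<in>V. (A * l i * l j - (if i = j then A * (l i)\<^sup>2 else 0)) * x i * x j)
         = (\<Sum>i\<in>V. \<Sum>j\<in>V. A * ((l i * x i) * (l j * x j)) - (if i = j then A * (l i)\<^sup>2 * (x i)\<^sup>2 else 0))"
        by (intro sum.cong refl) (auto simp: algebra_simps power2_eq_square)
      also have "\<dots> = A * \<Lambda>\<^sup>2 - (\<Sum>i\<in>V. A * (l i)\<^sup>2 * (x i)\<^sup>2)"
      proof -
        have "A * \<Lambda>\<^sup>2 = (\<Sum>i\<in>V. \<Sum>j\<in>V. A * ((l i * x i) * (l j * x j)))"
          unfolding \<Lambda>_def power2_eq_square sum_product by (simp only: sum_distrib_left)
        then show ?thesis using finV by (simp add: sum_subtractf)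
      qed
      finally have q3: "[(\<Sum>i\<in>V. \<Sum>j\<in>V. H i j * x i * x j) = A * \<Lambda>\<^sup>2 - (\<Sum>i\<in>V. A * (l i)\<^sup>2 * (x i)\<^sup>2)] (mod int p)" .
      have "[(\<Sum>i\<in>V. g i (x i)) = (\<Sum>i\<in>V. A * (l i)\<^sup>2 * (x i)\<^sup>2 + \<nu> * (l i * x i)
              + (g i s - A * (l i)\<^sup>2 * s\<^sup>2 - \<nu> * l i * s))] (mod int p)"
      proof (rule cong_sum)
        fix i assume i: "i \<in> V"
        then have "x i \<in> S" using x V(1) by auto
        from g\<nu>[OF i this] show "[g i (x i) = A * (l i)\<^sup>2 * (x i)\<^sup>2 + \<nu> * (l i * x i)
              + (g i s - A * (l i)\<^sup>2 * s\<^sup>2 - \<nu> * l i * s)] (mod int p)"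
          unfolding cong_iff_dvd_diff by (simp only: algebra_simps)
      qed
      also have "(\<Sum>i\<in>V. A * (l i)\<^sup>2 * (x i)\<^sup>2 + \<nu> * (l i * x i)
              + (g i s - A * (l i)\<^sup>2 * s\<^sup>2 - \<nu> * l i * s)) = (\<Sum>i\<in>V. A * (l i)\<^sup>2 * (x i)\<^sup>2) + \<nu> * \<Lambda> + \<kappa>"
        by (simp only: sum.distrib \<Lambda>_def \<kappa>_def sum_distrib_left)
      finally have q4: "[(\<Sum>i\<in>V. g i (x i)) = (\<Sum>i\<in>V. A * (l i)\<^sup>2 * (x i)\<^sup>2) + \<nu> * \<Lambda> + \<kappa>] (mod int p)" .
      have "[qval N g H x = ((\<Sum>i\<in>V. A * (l i)\<^sup>2 * (x i)\<^sup>2) + \<nu> * \<Lambda> + \<kappa>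
             + (A * \<Lambda>\<^sup>2 - (\<Sum>i\<in>V. A * (l i)\<^sup>2 * (x i)\<^sup>2))) + qval I g H x + 2 * (\<Lambda> * m)] (mod int p)"
        unfolding q1 qval_def[of V] by (intro cong_add q2 q3 q4 cong_refl)
      also have "((\<Sum>i\<in>V. A * (l i)\<^sup>2 * (x i)\<^sup>2) + \<nu> * \<Lambda> + \<kappa>
             + (A * \<Lambda>\<^sup>2 - (\<Sum>i\<in>V. A * (l i)\<^sup>2 * (x i)\<^sup>2))) + qval I g H x + 2 * (\<Lambda> * m)
           = A * \<Lambda>\<^sup>2 + 1 * (\<Lambda> * (\<nu> + 2 * m)) + \<kappa> + qval I g H x"
        by (simp add: algebra_simps)
      also have "[\<dots> = A * \<Lambda>\<^sup>2 + 2 * A * B * (\<Lambda> * (\<nu> + 2 * m)) + \<kappa> + qval I g H x] (mod int p)"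
        using B' by (intro cong_add cong_mult cong_refl) (simp only: cong_iff_dvd_diff)
      also have "A * \<Lambda>\<^sup>2 + 2 * A * B * (\<Lambda> * (\<nu> + 2 * m)) + \<kappa> + qval I g H x
          = A * (\<Lambda> + B * (\<nu> + 2 * m))\<^sup>2 + (\<kappa> - A * B\<^sup>2 * (\<nu> + 2 * m)\<^sup>2 + qval I g H x)"
        by (simp add: algebra_simps power2_eq_square)
      also have "\<kappa> - A * B\<^sup>2 * (\<nu> + 2 * m)\<^sup>2 + qval I g H x = quadratic_form I c \<beta> M x"
      proof -
        define s1 where "s1 = (\<Sum>i\<in>I. b i * x i)"
        define s2 where "s2 = (\<Sum>i\<in>I. \<Sum>j\<in>I. (H i j + (if i = j then a i else 0)) * (x i * x j))"
        have "g = (\<lambda>i z. a i * z\<^sup>2 + b i * z)" using g by blast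
        then have e0: "qval I g H x = s1 + s2"
          using qval_eq_quadratic_form[OF fin(2), of a b H x] by (simp add: quadratic_form_def s1_def s2_def)
        have "(\<Sum>i\<in>I. \<beta> i * x i) = (\<Sum>i\<in>I. b i * x i - 4 * A * B\<^sup>2 * \<nu> * (\<mu> i * x i))"
          unfolding \<beta>_def by (intro sum.cong refl) (simp add: algebra_simps)
        also have "\<dots> = s1 - 4 * A * B\<^sup>2 * \<nu> * m"
          unfolding m_def s1_def sum_distrib_left by (rule sum_subtractf)
        finally have e1: "(\<Sum>i\<in>I. \<beta> i * x i) = s1 - 4 * A * B\<^sup>2 * \<nu> * m" .
        have "4 * A * B\<^sup>2 * (m * m) = (\<Sum>i\<in>I. \<Sum>j\<in>I. 4 * A * B\<^sup>2 * ((\<mu> i * x i) * (\<mu> j * x j)))"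
          unfolding m_def sum_product by (simp only: sum_distrib_left)
        then have e2: "(\<Sum>i\<in>I. \<Sum>j\<in>I. M i j * (x i * x j)) = s2 - 4 * A * B\<^sup>2 * (m * m)"
          unfolding M_def s2_def
          by (simp only: sum_subtractf[symmetric]) (intro sum.cong refl, simp add: algebra_simps)
        show ?thesis
          unfolding quadratic_form_def c_def e0 e1 e2 by (simp add: power2_eq_square algebra_simps)
      qed
      finally show ?thesis unfolding lamx \<Lambda>_def m_def .
    qed
    have surj: "\<exists>x. (\<forall>i\<in>N. x i \<in> S) \<and> (\<forall>i\<in>I. x i = s) \<and> [B * \<nu> + (\<Sum>i\<in>N. lam i * x i) = u] (mod int p)" for u
    proof -
      obtain x where x: "\<And>i. i \<in> N \<Longrightarrow> x i \<in> S" "\<And>i. i \<notin> V \<Longrightarrow> x i = s"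
        "int p dvd (\<Sum>i\<in>V. l i * x i) - (u - B * (\<nu> + 2 * (\<Sum>k\<in>I. \<mu> k * s)))"
        by (rule linear_form_takes_all_values[OF V(1) many, of "u - B * (\<nu> + 2 * (\<Sum>k\<in>I. \<mu> k * s))"]) blast
      have "(\<Sum>k\<in>I. \<mu> k * x k) = (\<Sum>k\<in>I. \<mu> k * s)" using x(2) by (intro sum.cong) (auto simp: I_def)
      then have "[B * \<nu> + (\<Sum>i\<in>N. lam i * x i) = u] (mod int p)"
        using x(3) unfolding lamx cong_iff_dvd_diff by (simp add: algebra_simps)
      then show ?thesis using x(1,2) by (intro exI[of _ x]) (auto simp: I_def)
    qed
    have cI: "card I \<le> 54 * p ^ 9" using V(2) by (simp add: I_def)
    show ?thesis
      by (intro exI[of _ I] conjI disjI2 exI[of _ A] exI[of _ "B * \<nu>"] exI[of _ lam] exI[of _ c] exI[of _ \<beta>] exI[of _ M])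
        (use cI main surj A in \<open>auto simp: I_def\<close>)
  qed
qed

end

section \<open>Formal polynomials over a residue ring\<close>

context ring
begin

definition single_monomial :: "'c multiset \<Rightarrow> 'a \<Rightarrow> ('c multiset \<Rightarrow> 'a)" where
  "single_monomial m k = (\<lambda>m'. if m' = m then k else \<zero>)"

lemma single_monomial_in_indexed_pset:
  fixes m :: "'c multiset"
  assumes "set_mset m \<subseteq> I" "k \<in> carrier R"
  shows "single_monomial m k \<in> indexed_pset I (carrier R)"
  using assms(1)
proof (induction m)
  case empty
  have "single_monomial ({#} :: 'c multiset) k = indexed_const k"
    by (auto simp: single_monomial_def indexed_const_def fun_eq_iff)
  then show ?case by (simp add: indexed_pset.indexed_const assms(2))
next
  case (add i m)
  have "single_monomial (add_mset i m) k = indexed_pmult (single_monomial m k) i"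
  proof
    fix m'
    have "m' = add_mset i m \<longleftrightarrow> i \<in># m' \<and> m' - {#i#} = m" by auto
    then show "single_monomial (add_mset i m) k m' = indexed_pmult (single_monomial m k) i m'"
      by (simp add: single_monomial_def indexed_pmult_def)
  qed
  moreover have "indexed_pmult (single_monomial m k) i \<in> indexed_pset I (carrier R)"
    using add by (intro indexed_pset.indexed_pmult) auto
  ultimately show ?case by simp
qed

lemma finite_support_in_indexed_pset:
  assumes "finite \<M>" "\<And>m. m \<in> \<M> \<Longrightarrow> set_mset m \<subseteq> I" "\<And>m. P m \<in> carrier R" "\<And>m. m \<notin> \<M> \<Longrightarrow> P m = \<zero>"
  shows "P \<in> indexed_pset I (carrier R)"
  using assms
proof (induction \<M> arbitrary: P)
  case empty
  then have "P = indexed_const \<zero>" by (auto simp: indexed_const_def fun_eq_iff)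
  then show ?case by (simp add: indexed_pset.indexed_const)
next
  case (insert m \<M>)
  have "P(m := \<zero>) \<in> indexed_pset I (carrier R)"
    using insert.prems by (intro insert.IH) auto
  moreover have "single_monomial m (P m) \<in> indexed_pset I (carrier R)"
    using insert.prems by (intro single_monomial_in_indexed_pset) auto
  moreover have "P = indexed_padd (P(m := \<zero>)) (single_monomial m (P m))"
    using insert.prems by (auto simp: indexed_padd_def single_monomial_def fun_eq_iff)
  ultimately show ?case by (metis indexed_pset.indexed_padd)
qed

lemma indexed_pset_finite_support:
  assumes "P \<in> indexed_pset I (carrier R)"
  shows "finite (monomials R P)" "m \<in> monomials R P \<Longrightarrow> set_mset m \<subseteq> I" "P m \<in> carrier R"
proof -
  have "finite (monomials R P) \<and> (\<forall>m\<in>monomials R P. set_mset m \<subseteq> I) \<and> (\<forall>m. P m \<in> carrier R)"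
    using assms
  proof (induction)
    case (indexed_const k)
    have "monomials R (indexed_const k) \<subseteq> {{#}}" by (auto simp: monomials_def indexed_const_def)
    then show ?case using indexed_const finite_subset by (fastforce simp: indexed_const_def)
  next
    case (indexed_padd P Q)
    have "monomials R (indexed_padd P Q) \<subseteq> monomials R P \<union> monomials R Q"
      by (auto simp: monomials_def indexed_padd_def)
    then show ?case using indexed_padd.IH finite_subset by (fastforce simp: indexed_padd_def)
  next
    case (indexed_pmult P i)
    have "monomials R (indexed_pmult P i) \<subseteq> add_mset i ` monomials R P"
    proof
      fix m assume "m \<in> monomials R (indexed_pmult P i)"
      then have "i \<in># m" "P (m - {#i#}) \<noteq> \<zero>" by (auto simp: monomials_def indexed_pmult_def split: if_splits)
      then show "m \<in> add_mset i ` monomials R P"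
        by (intro image_eqI[of _ _ "m - {#i#}"]) (auto simp: monomials_def)
    qed
    then show ?case using indexed_pmult finite_subset by (fastforce simp: indexed_pmult_def)
  qed
  then show "finite (monomials R P)" "m \<in> monomials R P \<Longrightarrow> set_mset m \<subseteq> I" "P m \<in> carrier R" by auto
qed

end

context residues
begin

text \<open>
  This translates the evaluation in the ring into integer arithmetic, where monomials may be summed over any finite set that
  contains the support.
\<close>

lemma mpoly_eval_residues:
  assumes fin: "finite \<M>" and sub: "monomials R P \<subseteq> \<M>" and P: "\<And>k. P k \<in> carrier R"
    and x: "\<And>k i. k \<in> \<M> \<Longrightarrow> i \<in># k \<Longrightarrow> x i \<in> carrier R"
  shows "mpoly_eval R P x = (\<Sum>k\<in>\<M>. P k * prod_mset (image_mset x k)) mod m"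
proof -
  have finM: "finite (monomials R P)" using sub fin by (rule finite_subset)
  have carr: "z mod m = z" if "z \<in> carrier R" for z using that by (simp add: res_carrier_eq)
  have mon: "(\<Otimes>i\<in>set_mset k. x i [^] count k i) = prod_mset (image_mset x k) mod m" if "k \<in> \<M>" for k
  proof -
    have "(\<Otimes>i\<in>set_mset k. x i [^] count k i) = (\<Otimes>i\<in>set_mset k. (x i ^ count k i) mod m)"
    proof (rule finprod_cong')
      show "x i [^] count k i = (x i ^ count k i) mod m" if "i \<in> set_mset k" for i
        using pow_cong[of "x i" "count k i"] carr[OF x[OF \<open>k \<in> \<M>\<close> that]] by simp
    qed auto
    also have "\<dots> = (\<Prod>i\<in>set_mset k. x i ^ count k i) mod m" by (rule prod_cong) simp
    also have "(\<Prod>i\<in>set_mset k. x i ^ count k i) = prod_mset (image_mset x k)"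
      by (simp add: image_prod_mset_multiplicity)
    finally show ?thesis .
  qed
  have "mpoly_eval R P x = (\<Oplus>k\<in>monomials R P. (P k * prod_mset (image_mset x k)) mod m)"
    unfolding mpoly_eval_def
  proof (rule finsum_cong')
    show "P k \<otimes> (\<Otimes>i\<in>set_mset k. x i [^] count k i) = (P k * prod_mset (image_mset x k)) mod m"
      if "k \<in> monomials R P" for k
    proof -
      have "k \<in> \<M>" using that sub by blast
      then show ?thesis using mult_cong[of "P k" "prod_mset (image_mset x k)"] carr[OF P[of k]] mon by simp
    qed
  qed auto
  also have "\<dots> = (\<Sum>k\<in>monomials R P. P k * prod_mset (image_mset x k)) mod m"
    by (rule sum_cong[OF finM])
  also have "(\<Sum>k\<in>monomials R P. P k * prod_mset (image_mset x k)) = (\<Sum>k\<in>\<M>. P k * prod_mset (image_mset x k))"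
    using fin sub by (intro sum.mono_neutral_left) (auto simp: monomials_def res_zero_eq)
  finally show ?thesis .
qed

text \<open>
  A word names the monomial of its letters, and the coefficients of words that name the same monomial add up. So a double
  sum over ordered pairs of variables can be turned into a polynomial without choosing representatives.
\<close>

definition list_poly :: "'c list set \<Rightarrow> ('c list \<Rightarrow> int) \<Rightarrow> 'c multiset \<Rightarrow> int" where
  "list_poly T c k = (\<Sum>w\<in>{w\<in>T. mset w = k}. c w) mod m"

lemma monomials_list_poly: "monomials R (list_poly T c) \<subseteq> mset ` T"
proof
  fix k assume "k \<in> monomials R (list_poly T c)"
  then have "sum c {w\<in>T. mset w = k} \<noteq> 0" by (auto simp: monomials_def list_poly_def res_zero_eq)
  then have "{w\<in>T. mset w = k} \<noteq> {}" by (metis sum.empty)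
  then show "k \<in> mset ` T" by auto
qed

lemma list_poly_in_indexed_pset:
  assumes "finite T" "\<And>w. w \<in> T \<Longrightarrow> set w \<subseteq> I"
  shows "list_poly T c \<in> indexed_pset I (carrier R)"
proof (rule finite_support_in_indexed_pset[where \<M> = "mset ` T"])
  show "list_poly T c k = \<zero>" if "k \<notin> mset ` T" for k
    using that monomials_list_poly[of T c] by (auto simp: monomials_def)
  show "list_poly T c k \<in> carrier R" for k by (simp add: list_poly_def)
  show "set_mset k \<subseteq> I" if "k \<in> mset ` T" for k using that by (auto dest: subsetD[OF assms(2)])
qed (use assms(1) in simp)

lemma total_degree_list_poly:
  assumes "finite T" "\<And>w. w \<in> T \<Longrightarrow> length w \<le> d"
  shows "total_degree R (list_poly T c) \<le> d"
proof -
  have "finite (monomials R (list_poly T c))"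
    using finite_subset[OF monomials_list_poly] assms(1) by blast
  moreover have "size k \<le> d" if "k \<in> monomials R (list_poly T c)" for k
    using that monomials_list_poly[of T c] assms(2) by auto
  ultimately show ?thesis by (simp add: total_degree_def)
qed

lemma depends_on_list_poly:
  assumes "depends_on R (list_poly T c) i"
  shows "\<exists>w\<in>T. i \<in> set w"
proof -
  obtain k where "i \<in># k" "list_poly T c k \<noteq> \<zero>" using assms by (auto simp: index_free_def)
  then show ?thesis using monomials_list_poly[of T c] by (fastforce simp: monomials_def)
qed

lemma eval_list_poly:
  assumes T: "finite T" and x: "\<And>w i. w \<in> T \<Longrightarrow> i \<in> set w \<Longrightarrow> x i \<in> carrier R"
  shows "mpoly_eval R (list_poly T c) x = (\<Sum>w\<in>T. c w * prod_list (map x w)) mod m"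
proof -
  have "mpoly_eval R (list_poly T c) x = (\<Sum>k\<in>mset ` T. list_poly T c k * prod_mset (image_mset x k)) mod m"
    using T x by (intro mpoly_eval_residues monomials_list_poly) (auto simp: list_poly_def)
  also have "\<dots> = (\<Sum>k\<in>mset ` T. \<Sum>w\<in>{w\<in>T. mset w = k}. c w * prod_list (map x w)) mod m"
  proof -
    have "[(\<Sum>k\<in>mset ` T. list_poly T c k * prod_mset (image_mset x k))
        = (\<Sum>k\<in>mset ` T. (\<Sum>w\<in>{w\<in>T. mset w = k}. c w) * prod_mset (image_mset x k))] (mod m)"
      by (intro cong_sum cong_mult cong_refl) (simp add: list_poly_def cong_def)
    also have "(\<Sum>k\<in>mset ` T. (\<Sum>w\<in>{w\<in>T. mset w = k}. c w) * prod_mset (image_mset x k))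
        = (\<Sum>k\<in>mset ` T. \<Sum>w\<in>{w\<in>T. mset w = k}. c w * prod_list (map x w))"
      unfolding sum_distrib_right
      by (intro sum.cong refl) (auto simp: prod_mset_prod_list[symmetric] simp del: prod_mset_prod_list)
    finally show ?thesis by (simp add: cong_def)
  qed
  also have "(\<Sum>k\<in>mset ` T. \<Sum>w\<in>{w\<in>T. mset w = k}. c w * prod_list (map x w)) = (\<Sum>w\<in>T. c w * prod_list (map x w))"
    by (rule sum.group) (use T in auto)
  finally show ?thesis .
qed

end

section \<open>Polynomials of degree two as sums over words\<close>

definition affine_words :: "'c set \<Rightarrow> 'c list set" where
  "affine_words I = insert [] ((\<lambda>i. [i]) ` I)"

definition quadratic_words :: "'c set \<Rightarrow> 'c list set" where
  "quadratic_words I = affine_words I \<union> (\<lambda>(i, j). [i, j]) ` (I \<times> I)"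

fun word_coeff :: "int \<Rightarrow> ('c \<Rightarrow> int) \<Rightarrow> ('c \<Rightarrow> 'c \<Rightarrow> int) \<Rightarrow> 'c list \<Rightarrow> int" where
  "word_coeff c b M [] = c"
| "word_coeff c b M [i] = b i"
| "word_coeff c b M [i, j] = M i j"
| "word_coeff c b M (i # j # k # w) = 0"

lemma finite_words: "finite I \<Longrightarrow> finite (affine_words I)" "finite I \<Longrightarrow> finite (quadratic_words I)"
  by (simp_all add: affine_words_def quadratic_words_def)

lemma set_words: "w \<in> quadratic_words I \<Longrightarrow> set w \<subseteq> I" "w \<in> affine_words I \<Longrightarrow> set w \<subseteq> I"
  by (auto simp: affine_words_def quadratic_words_def)

lemma length_words: "w \<in> quadratic_words I \<Longrightarrow> length w \<le> 2" "w \<in> affine_words I \<Longrightarrow> length w \<le> 1"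
  by (auto simp: affine_words_def quadratic_words_def)

lemma sum_affine_words:
  assumes "finite I"
  shows "(\<Sum>w\<in>affine_words I. word_coeff c b M w * prod_list (map x w)) = c + (\<Sum>i\<in>I. b i * x i)"
proof -
  have "inj_on (\<lambda>i. [i]) I" by (simp add: inj_on_def)
  then have "(\<Sum>w\<in>(\<lambda>i. [i]) ` I. word_coeff c b M w * prod_list (map x w)) = (\<Sum>i\<in>I. b i * x i)"
    by (simp add: sum.reindex)
  moreover have "[] \<notin> (\<lambda>i. [i]) ` I" by auto
  ultimately show ?thesis using assms by (simp add: affine_words_def)
qed

lemma sum_quadratic_words:
  assumes "finite I"
  shows "(\<Sum>w\<in>quadratic_words I. word_coeff c b M w * prod_list (map x w)) = quadratic_form I c b M x"
proof -
  have "inj_on (\<lambda>(i, j). [i, j]) (I \<times> I)" by (auto simp: inj_on_def)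
  then have "(\<Sum>w\<in>(\<lambda>(i, j). [i, j]) ` (I \<times> I). word_coeff c b M w * prod_list (map x w))
      = (\<Sum>(i, j)\<in>I \<times> I. M i j * (x i * x j))"
    by (subst sum.reindex) (auto intro!: sum.cong)
  also have "\<dots> = (\<Sum>i\<in>I. \<Sum>j\<in>I. M i j * (x i * x j))" by (simp add: sum.cartesian_product)
  finally have pairs: "(\<Sum>w\<in>(\<lambda>(i, j). [i, j]) ` (I \<times> I). word_coeff c b M w * prod_list (map x w)) = \<dots>" .
  have "affine_words I \<inter> (\<lambda>(i, j). [i, j]) ` (I \<times> I) = {}" by (auto simp: affine_words_def)
  then show ?thesis
    using assms pairs sum_affine_words[OF assms, of c b M x]
    by (simp add: quadratic_words_def finite_words sum.union_disjoint quadratic_form_def)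
qed

text \<open>
  A product of two distinct variables is named by two words, each of which gets the weight \<open>h\<close>, one half modulo \<open>p\<close>. This
  is what makes the coefficient matrix symmetric.
\<close>

lemma sum_quadratic_multisets:
  fixes F :: "'c multiset \<Rightarrow> int"
  assumes fin: "finite I" and h: "[2 * h = 1] (mod p)"
  shows "[(\<Sum>k\<in>mset ` quadratic_words I. F k)
     = (\<Sum>w\<in>quadratic_words I. word_coeff 1 (\<lambda>_. 1) (\<lambda>i j. if i = j then 1 else h) w * F (mset w))] (mod p)"
proof -
  let ?wt = "word_coeff 1 (\<lambda>_. 1) (\<lambda>i j. if i = j then 1 else h)"
  have "[(\<Sum>w\<in>{w\<in>quadratic_words I. mset w = k}. ?wt w * F (mset w)) = F k] (mod p)"
    if k: "k \<in> mset ` quadratic_words I" for k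
  proof -
    obtain w0 where w0: "w0 \<in> quadratic_words I" "k = mset w0" using k by blast
    have "[(\<Sum>w\<in>{w\<in>quadratic_words I. mset w = k}. ?wt w) = 1] (mod p)"
    proof -
      consider "w0 = []" | i where "w0 = [i]" | i j where "w0 = [i, j]" "i \<in> I" "j \<in> I"
        using w0(1) by (auto simp: quadratic_words_def affine_words_def)
      then show ?thesis
      proof cases
        case 1
        then have "{w\<in>quadratic_words I. mset w = k} = {[]}" using w0 by auto
        then show ?thesis by simp
      next
        case (2 i)
        then have "{w\<in>quadratic_words I. mset w = k} = {[i]}" using w0 by auto
        then show ?thesis by simp
      next
        case (3 i j)
        have "{w\<in>quadratic_words I. mset w = k} = {[i, j], [j, i]}"
        proof (intro equalityI subsetI)
          fix w assume w: "w \<in> {w\<in>quadratic_words I. mset w = k}"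
          then have "length w = 2" using w0(2) 3(1) by (metis (mono_tags) length_Cons list.size(3) mem_Collect_eq mset_eq_length numeral_2_eq_2)
          then obtain a b where ab: "w = [a, b]" by (auto simp: length_Suc_conv numeral_2_eq_2)
          then have "{#a, b#} = {#i, j#}" using w w0(2) 3(1) by simp
          then have "(a = i \<and> b = j) \<or> (a = j \<and> b = i)" by (auto simp: add_eq_conv_ex)
          then show "w \<in> {[i, j], [j, i]}" using ab by auto
        next
          fix w assume "w \<in> {[i, j], [j, i]}"
          then show "w \<in> {w\<in>quadratic_words I. mset w = k}"
            using w0 3 by (auto simp: quadratic_words_def add_mset_commute)
        qed
        then show ?thesis using h by (cases "i = j") simp_all
      qed
    qed
    then have "[(\<Sum>w\<in>{w\<in>quadratic_words I. mset w = k}. ?wt w) * F k = 1 * F k] (mod p)"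
      by (intro cong_mult cong_refl)
    moreover have "(\<Sum>w\<in>{w\<in>quadratic_words I. mset w = k}. ?wt w * F (mset w))
       = (\<Sum>w\<in>{w\<in>quadratic_words I. mset w = k}. ?wt w) * F k"
      unfolding sum_distrib_right by (intro sum.cong) auto
    ultimately show ?thesis by simp
  qed
  then have "[(\<Sum>k\<in>mset ` quadratic_words I. \<Sum>w\<in>{w\<in>quadratic_words I. mset w = k}. ?wt w * F (mset w))
     = (\<Sum>k\<in>mset ` quadratic_words I. F k)] (mod p)"
    by (intro cong_sum)
  moreover have "(\<Sum>k\<in>mset ` quadratic_words I. \<Sum>w\<in>{w\<in>quadratic_words I. mset w = k}. ?wt w * F (mset w))
      = (\<Sum>w\<in>quadratic_words I. ?wt w * F (mset w))"
    by (rule sum.group) (use finite_words[OF fin] in auto)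
  ultimately show ?thesis by (simp add: cong_sym)
qed

context residues
begin

lemma mem_carrier_mod: "z \<in> carrier R \<Longrightarrow> z mod m = z"
  by (simp add: res_carrier_eq)

definition quadratic_poly :: "'c set \<Rightarrow> int \<Rightarrow> ('c \<Rightarrow> int) \<Rightarrow> ('c \<Rightarrow> 'c \<Rightarrow> int) \<Rightarrow> 'c multiset \<Rightarrow> int" where
  "quadratic_poly I c b M = list_poly (quadratic_words I) (word_coeff c b M)"

definition affine_poly :: "'c set \<Rightarrow> int \<Rightarrow> ('c \<Rightarrow> int) \<Rightarrow> 'c multiset \<Rightarrow> int" where
  "affine_poly I c b = list_poly (affine_words I) (word_coeff c b (\<lambda>_ _. 0))"

lemma quadratic_poly:
  assumes "finite I" "I \<subseteq> N"
  shows "quadratic_poly I c b M \<in> indexed_pset N (carrier R)"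
    and "total_degree R (quadratic_poly I c b M) \<le> 2"
    and "depends_on R (quadratic_poly I c b M) i \<Longrightarrow> i \<in> I"
    and "(\<And>i. i \<in> I \<Longrightarrow> x i \<in> carrier R) \<Longrightarrow>
      mpoly_eval R (quadratic_poly I c b M) x = quadratic_form I c b M x mod m"
proof -
  note fin = finite_words(2)[OF assms(1)]
  show "quadratic_poly I c b M \<in> indexed_pset N (carrier R)"
    unfolding quadratic_poly_def using set_words(1) assms(2) by (intro list_poly_in_indexed_pset fin) blast
  show "total_degree R (quadratic_poly I c b M) \<le> 2"
    unfolding quadratic_poly_def by (intro total_degree_list_poly fin length_words)
  show "i \<in> I" if "depends_on R (quadratic_poly I c b M) i"
    using depends_on_list_poly[OF that[unfolded quadratic_poly_def]] set_words(1) by blast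
  show "mpoly_eval R (quadratic_poly I c b M) x = quadratic_form I c b M x mod m"
    if "\<And>i. i \<in> I \<Longrightarrow> x i \<in> carrier R"
  proof -
    have "mpoly_eval R (quadratic_poly I c b M) x
        = (\<Sum>w\<in>quadratic_words I. word_coeff c b M w * prod_list (map x w)) mod m"
      unfolding quadratic_poly_def using that set_words(1) by (intro eval_list_poly fin) blast
    then show ?thesis by (simp only: sum_quadratic_words[OF assms(1)])
  qed
qed

lemma affine_poly:
  assumes "finite I"
  shows "affine_poly I c b \<in> indexed_pset I (carrier R)"
    and "total_degree R (affine_poly I c b) \<le> 1"
    and "(\<And>i. i \<in> I \<Longrightarrow> x i \<in> carrier R) \<Longrightarrow> mpoly_eval R (affine_poly I c b) x = (c + (\<Sum>i\<in>I. b i * x i)) mod m"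
proof -
  note fin = finite_words(1)[OF assms(1)]
  show "affine_poly I c b \<in> indexed_pset I (carrier R)"
    unfolding affine_poly_def using set_words(2) by (intro list_poly_in_indexed_pset fin) blast
  show "total_degree R (affine_poly I c b) \<le> 1"
    unfolding affine_poly_def by (intro total_degree_list_poly fin length_words)
  show "mpoly_eval R (affine_poly I c b) x = (c + (\<Sum>i\<in>I. b i * x i)) mod m"
    if "\<And>i. i \<in> I \<Longrightarrow> x i \<in> carrier R"
  proof -
    have "mpoly_eval R (affine_poly I c b) x
        = (\<Sum>w\<in>affine_words I. word_coeff c b (\<lambda>_ _. 0) w * prod_list (map x w)) mod m"
      unfolding affine_poly_def using that set_words(2) by (intro eval_list_poly fin) blast
    then show ?thesis by (simp only: sum_affine_words[OF assms(1)])
  qed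
qed

lemma eval_in_carrier:
  assumes P: "P \<in> indexed_pset I (carrier R)" and x: "\<And>i. i \<in> I \<Longrightarrow> x i \<in> carrier R"
  shows "mpoly_eval R P x \<in> carrier R"
proof -
  have "mpoly_eval R P x = (\<Sum>k\<in>monomials R P. P k * prod_mset (image_mset x k)) mod m"
    using indexed_pset_finite_support[OF P] x by (intro mpoly_eval_residues) blast+
  then show ?thesis by simp
qed

lemma eval_cong_qval:
  assumes P: "P \<in> indexed_pset I (carrier R)" and deg: "total_degree R P \<le> 2" and fin: "finite I"
    and h: "[2 * h = 1] (mod m)" and x: "\<And>i. i \<in> I \<Longrightarrow> x i \<in> carrier R"
  shows "[mpoly_eval R P x = P {#} + qval I (\<lambda>i z. P {#i, i#} * z\<^sup>2 + P {#i#} * z)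
            (\<lambda>i j. if i = j then 0 else h * P {#i, j#}) x] (mod m)"
proof -
  let ?QW = "quadratic_words I"
  have sub: "monomials R P \<subseteq> mset ` ?QW"
  proof
    fix k assume k: "k \<in> monomials R P"
    have sizek: "size k \<le> 2"
      using deg indexed_pset_finite_support(1)[OF P] k by (auto simp: total_degree_def)
    have setk: "set_mset k \<subseteq> I" using indexed_pset_finite_support(2)[OF P k] .
    obtain w where w: "mset w = k" using ex_mset by blast
    have lw: "length w \<le> 2" "set w \<subseteq> I" using sizek setk by (auto simp flip: w)
    have "w \<in> ?QW"
    proof (cases w)
      case (Cons i w')
      then show ?thesis using lw by (cases w') (auto simp: quadratic_words_def affine_words_def)
    qed (simp add: quadratic_words_def affine_words_def)
    then show "k \<in> mset ` ?QW" using w by blast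
  qed
  have xk: "x i \<in> carrier R" if "k \<in> mset ` ?QW" "i \<in># k" for k i
  proof -
    obtain w where w: "w \<in> ?QW" "k = mset w" using \<open>k \<in> mset ` ?QW\<close> by blast
    then have "i \<in> I" using set_words(1)[OF w(1)] \<open>i \<in># k\<close> by auto
    then show ?thesis by (rule x)
  qed
  have "mpoly_eval R P x = (\<Sum>k\<in>mset ` ?QW. P k * prod_mset (image_mset x k)) mod m"
    by (rule mpoly_eval_residues[OF finite_imageI[OF finite_words(2)[OF fin]] sub
          indexed_pset_finite_support(3)[OF P] xk])
  then have "[mpoly_eval R P x = (\<Sum>k\<in>mset ` ?QW. P k * prod_mset (image_mset x k))] (mod m)"
    by (simp add: cong_def)
  also have "[(\<Sum>k\<in>mset ` ?QW. P k * prod_mset (image_mset x k)) = (\<Sum>w\<in>?QW.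
      word_coeff 1 (\<lambda>_. 1) (\<lambda>i j. if i = j then 1 else h) w * (P (mset w) * prod_mset (image_mset x (mset w))))] (mod m)"
    by (rule sum_quadratic_multisets[OF fin h])
  also have "(\<Sum>w\<in>?QW. word_coeff 1 (\<lambda>_. 1) (\<lambda>i j. if i = j then 1 else h) w * (P (mset w) * prod_mset (image_mset x (mset w))))
     = (\<Sum>w\<in>?QW. word_coeff (P {#}) (\<lambda>i. P {#i#}) (\<lambda>i j. (if i = j then 0 else h * P {#i, j#}) + (if i = j then P {#i, i#} else 0)) w
           * prod_list (map x w))"
    by (intro sum.cong refl) (auto simp: quadratic_words_def affine_words_def)
  also have "\<dots> = quadratic_form I (P {#}) (\<lambda>i. P {#i#}) (\<lambda>i j. (if i = j then 0 else h * P {#i, j#}) + (if i = j then P {#i, i#} else 0)) x"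
    by (rule sum_quadratic_words[OF fin])
  also have "\<dots> = P {#} + qval I (\<lambda>i z. P {#i, i#} * z\<^sup>2 + P {#i#} * z)
            (\<lambda>i j. if i = j then 0 else h * P {#i, j#}) x"
    by (simp only: qval_eq_quadratic_form[OF fin]) (simp add: quadratic_form_def)
  finally show ?thesis .
qed

end

section \<open>The structure theorem\<close>

context residues_prime
begin

lemma mod_square_add: "(A * (z mod q)\<^sup>2 + w mod q) mod q = (A * z\<^sup>2 + w) mod (q::int)"
proof -
  have "[A * (z mod q)\<^sup>2 + w mod q = A * z\<^sup>2 + w] (mod q)"
    by (intro cong_add cong_mult cong_pow cong_refl) (simp_all add: cong_def)
  then show ?thesis by (simp add: cong_def)
qed

text \<open>
  This leads from congruences between integers back to formal polynomials. The case \<open>A = 0\<close> gives a representation by \<open>J\<close>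
  alone, and the bound \<open>54 p^9\<close> is absorbed into the exponent 15.
\<close>

lemma determined_representation:
  assumes P: "P \<in> indexed_pset {1..n} (carrier R)" and S: "S \<subseteq> carrier R"
    and I: "I \<subseteq> {1..n}" "card I \<le> 54 * p ^ 9"
    and eq: "\<And>x. x \<in> cartesian_power S n \<Longrightarrow>
      [mpoly_eval R P x = A * (l0 + (\<Sum>i\<in>{1..n}. l i * x i))\<^sup>2 + quadratic_form I c b M x] (mod int p)"
  shows "\<exists>L J. L \<in> mpolys R n \<and> total_degree R L \<le> 1 \<and> J \<in> mpolys R n \<and> total_degree R J \<le> 2 \<and>
    determined R n (54 * real p ^ 15) J \<and>
    (\<forall>x\<in>cartesian_power S n.
       mpoly_eval R P x = (A * (mpoly_eval R L x)\<^sup>2 + mpoly_eval R J x) mod int p) \<and>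
    (\<forall>x\<in>cartesian_power S n. mpoly_eval R L x \<in> carrier R \<and> mpoly_eval R J x \<in> carrier R)"
proof -
  let ?N = "{1..n}"
  have finI: "finite I" using I(1) finite_subset by blast
  let ?L = "affine_poly ?N l0 l" and ?J = "quadratic_poly I c b M"
  note L = affine_poly[where I = ?N and c = l0 and b = l] and J = quadratic_poly[OF finI I(1), where c = c and b = b and M = M]
  have LJ: "?L \<in> mpolys R n" "total_degree R ?L \<le> 1" "?J \<in> mpolys R n" "total_degree R ?J \<le> 2"
    using L(1,2) J(1,2) by simp_all
  have "{i \<in> {1..n}. depends_on R ?J i} \<subseteq> I" using J(3) by blast
  then have "card {i \<in> {1..n}. depends_on R ?J i} \<le> 54 * p ^ 9"
    using card_mono[OF finI] I(2) le_trans by blast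
  also have "54 * p ^ 9 \<le> 54 * p ^ 15"
    using prime_gt_0_nat[OF p_prime] by (intro mult_le_mono2 power_increasing) auto
  finally have "real (card {i \<in> {1..n}. depends_on R ?J i}) \<le> real (54 * p ^ 15)"
    by (simp only: of_nat_le_iff)
  then have det: "determined R n (54 * real p ^ 15) ?J" by (simp add: determined_def)
  have vals: "mpoly_eval R P x = (A * (mpoly_eval R ?L x)\<^sup>2 + mpoly_eval R ?J x) mod int p \<and>
      mpoly_eval R ?L x \<in> carrier R \<and> mpoly_eval R ?J x \<in> carrier R"
    if x: "x \<in> cartesian_power S n" for x
  proof (intro conjI)
  have xc: "x i \<in> carrier R" if "i \<in> ?N" for i using x S that by (auto simp: PiE_def)
  have Lx: "mpoly_eval R ?L x = (l0 + (\<Sum>i\<in>?N. l i * x i)) mod int p" using L(3) xc by simp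
  have Jx: "mpoly_eval R ?J x = quadratic_form I c b M x mod int p" using J(4) xc I(1) by blast
  show "mpoly_eval R ?L x \<in> carrier R" "mpoly_eval R ?J x \<in> carrier R" unfolding Lx Jx by simp_all
  have "mpoly_eval R P x = mpoly_eval R P x mod int p"
    using eval_in_carrier[OF P] xc by (simp add: mem_carrier_mod)
  also have "\<dots> = (A * (l0 + (\<Sum>i\<in>{1..n}. l i * x i))\<^sup>2 + quadratic_form I c b M x) mod int p"
    using eq[OF x] by (simp add: cong_def)
  also have "\<dots> = (A * (mpoly_eval R ?L x)\<^sup>2 + mpoly_eval R ?J x) mod int p"
    unfolding Lx Jx by (simp only: mod_square_add)
  finally show "mpoly_eval R P x = (A * (mpoly_eval R ?L x)\<^sup>2 + mpoly_eval R ?J x) mod int p" .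
  qed
  show ?thesis
    by (intro exI[of _ ?L] exI[of _ ?J] conjI LJ det) (use vals in blast)+
qed

text \<open>
  If \<open>P\<close> is constant on the grid, a constant polynomial represents it. Otherwise \<open>p\<close> is odd, since a nonconstant function with
  values in a field with two elements is surjective, \<open>S\<close> has two distinct elements, and \<open>quadratic_structure\<close> applies.
\<close>

lemma few_variables_or_square:
  assumes S: "S \<noteq> {}" "S \<subseteq> carrier R" and P: "P \<in> mpolys R n" and deg: "total_degree R P = 2"
    and miss: "mpoly_eval R P ` cartesian_power S n \<noteq> carrier R"
  obtains (few_variables) I c b M where "I \<subseteq> {1..n}" "card I \<le> 54 * p ^ 9"
      "\<And>x. x \<in> cartesian_power S n \<Longrightarrow> [mpoly_eval R P x = quadratic_form I c b M x] (mod int p)"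
  | (square) I A l0 l c b M where "I \<subseteq> {1..n}" "card I \<le> 54 * p ^ 9" "\<not> int p dvd A"
      "\<And>x. x \<in> cartesian_power S n \<Longrightarrow>
         [mpoly_eval R P x = A * (l0 + (\<Sum>i\<in>{1..n}. l i * x i))\<^sup>2 + quadratic_form I c b M x] (mod int p)"
      "\<exists>e. \<forall>u. \<exists>x\<in>cartesian_power S n. [l0 + (\<Sum>i\<in>{1..n}. l i * x i) = u] (mod int p) \<and>
          quadratic_form I c b M x = e"
proof -
  let ?N = "{1..n}"
  let ?V = "mpoly_eval R P"
  have xc: "x i \<in> carrier R" if "x \<in> cartesian_power S n" "i \<in> ?N" for x i
    using that S(2) by (auto simp: PiE_def)
  have Vc: "?V x \<in> carrier R" if "x \<in> cartesian_power S n" for x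
    using eval_in_carrier[OF P] xc[OF that] by blast
  have ne: "cartesian_power S n \<noteq> {}" using S(1) by (simp add: PiE_eq_empty_iff)
  show thesis
  proof (cases "\<exists>v. \<forall>x\<in>cartesian_power S n. ?V x = v")
    case True
    then obtain v where v: "\<And>x. x \<in> cartesian_power S n \<Longrightarrow> ?V x = v" by blast
    show thesis
      by (rule few_variables[of "{}" v "\<lambda>_. 0" "\<lambda>_ _. 0"]) (use v in \<open>auto simp: quadratic_form_def\<close>)
  next
    case False
    have odd: "p \<noteq> 2"
    proof
      assume p2: "p = 2"
      then have C: "carrier R = {0, 1}" by (auto simp: res_carrier_eq)
      obtain x0 where x0: "x0 \<in> cartesian_power S n" using ne by blast
      obtain x1 where x1: "x1 \<in> cartesian_power S n" "?V x1 \<noteq> ?V x0" using False by blast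
      have "{0, 1} \<subseteq> ?V ` cartesian_power S n"
        using Vc[OF x0] Vc[OF x1(1)] x0 x1 unfolding C by (auto simp: image_iff)
      moreover have "?V ` cartesian_power S n \<subseteq> {0, 1}" using Vc unfolding C by blast
      ultimately show False using miss unfolding C by blast
    qed
    obtain s where s: "s \<in> S" using S(1) by blast
    have "\<exists>t\<in>S. t \<noteq> s"
    proof (rule ccontr)
      assume "\<not> ?thesis"
      then have S1: "S = {s}" using s by blast
      have "x = y" if "x \<in> cartesian_power S n" "y \<in> cartesian_power S n" for x y
        by (rule PiE_ext[OF that]) (use that S1 in auto)
      then show False using False ne by blast
    qed
    then obtain t where t: "t \<in> S" "t \<noteq> s" by blast
    have st: "\<not> int p dvd t - s"
    proof
      assume "int p dvd t - s"
      then have "t mod int p = s mod int p" by (simp only: mod_eq_dvd_iff)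
      then show False using t s S(2) mem_carrier_mod by (metis subsetD)
    qed
    have "\<exists>z0\<in>carrier R. z0 \<notin> ?V ` cartesian_power S n" using miss Vc by blast
    then obtain z0 where z0: "z0 \<in> carrier R" "z0 \<notin> ?V ` cartesian_power S n" by blast
    have "\<not> int p dvd 2"
    proof
      assume "int p dvd 2"
      then have "p dvd 2" by (metis int_dvd_int_iff of_nat_numeral)
      then show False using p_prime odd two_is_prime_nat primes_dvd_imp_eq by blast
    qed
    then obtain h where "int p dvd 2 * h - 1" using inverse_mod_prime[OF p_prime] by blast
    then have h: "[2 * h = 1] (mod int p)" by (simp add: cong_iff_dvd_diff)
    define g where "g i z = P {#i, i#} * z\<^sup>2 + P {#i#} * z" for i z
    define H where "H i j = (if i = j then 0 else h * P {#i, j#})" for i j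
    have VQ: "[?V x = P {#} + qval ?N g H x] (mod int p)" if "\<And>i. i \<in> ?N \<Longrightarrow> x i \<in> carrier R" for x
      using eval_cong_qval[OF P _ _ h that] deg by (simp add: g_def[abs_def] H_def[abs_def])
    have restr: "restrict x ?N \<in> cartesian_power S n" if "\<And>i. i \<in> ?N \<Longrightarrow> x i \<in> S" for x
      using that by auto
    have qrestr: "qval ?N g H (restrict x ?N) = qval ?N g H x" for x by (rule qval_cong) simp
    interpret nonsurjective_quadratic p ?N S g H "z0 - P {#}" s t
    proof
      show "H i j = H j i" for i j by (simp add: H_def add_mset_commute)
      show "H i i = 0" for i by (simp add: H_def)
      fix x assume x: "\<And>i. i \<in> ?N \<Longrightarrow> x i \<in> S"
      show "\<not> int p dvd qval ?N g H x - (z0 - P {#})"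
      proof
        assume d: "int p dvd qval ?N g H x - (z0 - P {#})"
        have rx: "restrict x ?N \<in> cartesian_power S n" by (rule restr) (rule x)
        have "[?V (restrict x ?N) = P {#} + qval ?N g H (restrict x ?N)] (mod int p)"
          by (rule VQ) (rule xc[OF rx])
        also have "P {#} + qval ?N g H (restrict x ?N) = P {#} + qval ?N g H x" by (simp only: qrestr)
        also have "[\<dots> = z0] (mod int p)" using d by (simp add: cong_iff_dvd_diff algebra_simps)
        finally have "?V (restrict x ?N) mod int p = z0 mod int p" by (simp only: cong_def)
        then have "?V (restrict x ?N) = z0" 
          by (simp only: mem_carrier_mod[OF z0(1)] mem_carrier_mod[OF Vc[OF rx]])
        then show False using z0(2) rx by blast
      qed
    qed (use p_prime odd s t st in auto)
    have shift: "quadratic_form I (P {#} + c) b M x = P {#} + quadratic_form I c b M x" for I c b M x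
      by (simp add: quadratic_form_def)
    have xS: "\<forall>i\<in>?N. x i \<in> S" if "x \<in> cartesian_power S n" for x using that by auto
    obtain I where I: "I \<subseteq> ?N" "card I \<le> 54 * p ^ 9" and
      str: "(\<exists>c \<beta> M. \<forall>x. (\<forall>i\<in>?N. x i \<in> S) \<longrightarrow> [qval ?N g H x = quadratic_form I c \<beta> M x] (mod int p)) \<or>
     (\<exists>A l0 l c \<beta> M. \<not> int p dvd A \<and>
        (\<forall>x. (\<forall>i\<in>?N. x i \<in> S) \<longrightarrow>
           [qval ?N g H x = A * (l0 + (\<Sum>i\<in>?N. l i * x i))\<^sup>2 + quadratic_form I c \<beta> M x] (mod int p)) \<and>
        (\<forall>u. \<exists>x. (\<forall>i\<in>?N. x i \<in> S) \<and> (\<forall>i\<in>I. x i = s) \<and> [l0 + (\<Sum>i\<in>?N. l i * x i) = u] (mod int p)))"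
      using quadratic_structure[of "\<lambda>i. P {#i, i#}" "\<lambda>i. P {#i#}", OF g_def]
      by (elim exE conjE) (rule that)
    from str show thesis
    proof (elim disjE exE conjE)
      fix c \<beta> M assume eq: "\<forall>x. (\<forall>i\<in>?N. x i \<in> S) \<longrightarrow> [qval ?N g H x = quadratic_form I c \<beta> M x] (mod int p)"
      show thesis
      proof (rule few_variables[OF I])
        fix x assume x: "x \<in> cartesian_power S n"
        have "[?V x = P {#} + qval ?N g H x] (mod int p)" by (rule VQ) (rule xc[OF x])
        also have "[P {#} + qval ?N g H x = P {#} + quadratic_form I c \<beta> M x] (mod int p)"
          using eq xS[OF x] by (intro cong_add cong_refl) blast
        also have "P {#} + quadratic_form I c \<beta> M x = quadratic_form I (P {#} + c) \<beta> M x" by (simp only: shift)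
        finally show "[?V x = quadratic_form I (P {#} + c) \<beta> M x] (mod int p)" .
      qed
    next
      fix A l0 l c \<beta> M
      assume A: "\<not> int p dvd A" and eq: "\<forall>x. (\<forall>i\<in>?N. x i \<in> S) \<longrightarrow>
           [qval ?N g H x = A * (l0 + (\<Sum>i\<in>?N. l i * x i))\<^sup>2 + quadratic_form I c \<beta> M x] (mod int p)"
        and sur: "\<forall>u. \<exists>x. (\<forall>i\<in>?N. x i \<in> S) \<and> (\<forall>i\<in>I. x i = s) \<and> [l0 + (\<Sum>i\<in>?N. l i * x i) = u] (mod int p)"
      show thesis
      proof (rule square[OF I A])
        fix x assume x: "x \<in> cartesian_power S n"
        have "[?V x = P {#} + qval ?N g H x] (mod int p)" by (rule VQ) (rule xc[OF x])
        also have "[P {#} + qval ?N g H x = P {#} + (A * (l0 + (\<Sum>i\<in>?N. l i * x i))\<^sup>2 + quadratic_form I c \<beta> M x)] (mod int p)"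
          using eq xS[OF x] by (intro cong_add cong_refl) blast
        also have "P {#} + (A * (l0 + (\<Sum>i\<in>?N. l i * x i))\<^sup>2 + quadratic_form I c \<beta> M x)
           = A * (l0 + (\<Sum>i\<in>?N. l i * x i))\<^sup>2 + quadratic_form I (P {#} + c) \<beta> M x" by (simp add: shift)
        finally show "[?V x = A * (l0 + (\<Sum>i\<in>?N. l i * x i))\<^sup>2 + quadratic_form I (P {#} + c) \<beta> M x] (mod int p)" .
      next
        show "\<exists>e. \<forall>u. \<exists>x\<in>cartesian_power S n. [l0 + (\<Sum>i\<in>{1..n}. l i * x i) = u] (mod int p) \<and>
          quadratic_form I (P {#} + c) \<beta> M x = e"
        proof (intro exI[of _ "quadratic_form I (P {#} + c) \<beta> M (\<lambda>_. s)"] allI)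
          fix u
          obtain x where x: "\<forall>i\<in>?N. x i \<in> S" "\<forall>i\<in>I. x i = s" "[l0 + (\<Sum>i\<in>?N. l i * x i) = u] (mod int p)"
            using sur by blast
          have "(\<Sum>i\<in>?N. l i * restrict x ?N i) = (\<Sum>i\<in>?N. l i * x i)" by (intro sum.cong) auto
          then have lin: "[l0 + (\<Sum>i\<in>?N. l i * restrict x ?N i) = u] (mod int p)" using x(3) by (simp only:)
          have quad: "quadratic_form I (P {#} + c) \<beta> M (restrict x ?N) = quadratic_form I (P {#} + c) \<beta> M (\<lambda>_. s)"
            unfolding quadratic_form_def using x(2) I(1)
            by (intro arg_cong2[where f = "(+)"] sum.cong refl) auto
          have "restrict x ?N \<in> cartesian_power S n" using x(1) by (intro restr) blast
          with lin quad show "\<exists>x\<in>cartesian_power S n. [l0 + (\<Sum>i\<in>{1..n}. l i * x i) = u] (mod int p) \<and>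
             quadratic_form I (P {#} + c) \<beta> M x = quadratic_form I (P {#} + c) \<beta> M (\<lambda>_. s)"
            by blast
        qed
      qed
    qed
  qed
qed

lemma eval_square_poly:
  assumes "a \<in> carrier R" "z \<in> carrier R"
  shows "eval [a, \<zero>, \<zero>] z = a \<otimes> z [^] (2::nat)"
  using assms by (simp add: numeral_2_eq_2)

lemma square_poly_in_carrier:
  assumes "a \<in> carrier R" "a \<noteq> \<zero>"
  shows "[a, \<zero>, \<zero>] \<in> carrier (poly_ring R)"
  using assms unfolding univ_poly_carrier[symmetric] polynomial_def by simp

lemma square_form:
  assumes "a = A mod int p" "z \<in> carrier R" "v \<in> carrier R"
  shows "(a \<otimes> z [^] (2::nat)) \<oplus> v = (A * z\<^sup>2 + v) mod int p"
proof -
  have "z [^] (2::nat) = z\<^sup>2 mod int p" using pow_cong[of z 2] assms(2) by (simp add: mem_carrier_mod)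
  then show ?thesis unfolding assms(1) by (simp add: res_add_eq res_mult_eq mod_simps)
qed

text \<open>
  The same witnesses serve for both forms of the representation: \<open>A\<close> is the polynomial \<open>a z^2\<close>, and the constant \<open>c\<close> is zero.
\<close>

lemma square_plus_determined:
  assumes a: "a \<in> carrier R" "a \<noteq> \<zero>"
    and L: "L \<in> mpolys R n" "total_degree R L \<le> 1"
    and J: "J \<in> mpolys R n" "total_degree R J \<le> 2" "determined R n k J"
    and eq: "\<And>x. x \<in> \<Omega> \<Longrightarrow> mpoly_eval R P x = (a * (mpoly_eval R L x)\<^sup>2 + mpoly_eval R J x) mod int p"
    and carr: "\<And>x. x \<in> \<Omega> \<Longrightarrow> mpoly_eval R L x \<in> carrier R \<and> mpoly_eval R J x \<in> carrier R"
  shows "\<exists>L A J. L \<in> mpolys R n \<and> total_degree R L \<le> 1 \<and>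
           A \<in> carrier (poly_ring R) \<and> Polynomials.degree A = 2 \<and>
           J \<in> mpolys R n \<and> total_degree R J \<le> 2 \<and> determined R n k J \<and>
           (\<forall>x \<in> \<Omega>. mpoly_eval R P x = eval A (mpoly_eval R L x) \<oplus> mpoly_eval R J x) \<and>
           (\<exists>L' a c. L' \<in> mpolys R n \<and> total_degree R L' \<le> 1 \<and> a \<in> carrier R \<and> c \<in> carrier R \<and>
              (\<forall>x \<in> \<Omega>. mpoly_eval R P x = a \<otimes> (mpoly_eval R L' x [^] (2::nat)) \<oplus> (mpoly_eval R J x \<oplus> c)))"
proof -
  have P: "mpoly_eval R P x = a \<otimes> (mpoly_eval R L x [^] (2::nat)) \<oplus> mpoly_eval R J x" if "x \<in> \<Omega>" for x
    using eq[OF that] square_form[of a a "mpoly_eval R L x" "mpoly_eval R J x"] carr[OF that] a(1)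
    by (simp add: mem_carrier_mod)
  have second: "\<exists>L' a c. L' \<in> mpolys R n \<and> total_degree R L' \<le> 1 \<and> a \<in> carrier R \<and> c \<in> carrier R \<and>
      (\<forall>x \<in> \<Omega>. mpoly_eval R P x = a \<otimes> (mpoly_eval R L' x [^] (2::nat)) \<oplus> (mpoly_eval R J x \<oplus> c))"
    by (rule exI[of _ L], rule exI[of _ a], rule exI[of _ \<zero>]) (use P carr a L in auto)
  have first: "mpoly_eval R P x = eval [a, \<zero>, \<zero>] (mpoly_eval R L x) \<oplus> mpoly_eval R J x" if "x \<in> \<Omega>" for x
    using P[OF that] eval_square_poly a(1) carr[OF that] by simp
  show ?thesis
    by (rule exI[of _ L], rule exI[of _ "[a, \<zero>, \<zero>]"], rule exI[of _ J])
      (intro conjI L J second ballI first square_poly_in_carrier[OF a], simp)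
qed

end

theorem proposition1p11:
  shows "\<exists>\<kappa>::real. \<kappa> > 0 \<and>
    (\<forall>(p::nat) (S::int set) (n::nat) (P::nat multiset \<Rightarrow> int).
      let F = prime_field p; V = mpoly_eval F in
      Factorial_Ring.prime p \<longrightarrow> S \<noteq> {} \<longrightarrow> S \<subseteq> carrier F \<longrightarrow> n \<ge> 1 \<longrightarrow>
      P \<in> mpolys F n \<longrightarrow> total_degree F P = 2 \<longrightarrow>
      V P ` cartesian_power S n \<noteq> carrier F \<longrightarrow>
        (\<exists>L A J.
           L \<in> mpolys F n \<and> total_degree F L \<le> 1 \<and>
           A \<in> carrier (poly_ring F) \<and> Polynomials.degree A = 2 \<and>
           J \<in> mpolys F n \<and> total_degree F J \<le> 2 \<and> determined F n (\<kappa> * real p ^ 15) J \<and>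
           (\<forall>x \<in> cartesian_power S n. V P x = ring.eval F A (V L x) \<oplus>\<^bsub>F\<^esub> V J x) \<and>
           (\<exists>L' a c.
              L' \<in> mpolys F n \<and> total_degree F L' \<le> 1 \<and> a \<in> carrier F \<and> c \<in> carrier F \<and>
              (\<forall>x \<in> cartesian_power S n.
                 V P x = a \<otimes>\<^bsub>F\<^esub> (V L' x [^]\<^bsub>F\<^esub> (2::nat)) \<oplus>\<^bsub>F\<^esub> (V J x \<oplus>\<^bsub>F\<^esub> c)))) \<and>
        ((\<nexists>T. is_affine_translate p T \<and> T \<subseteq> V P ` cartesian_power S n) \<longrightarrow>
         (\<exists>J.
           J \<in> mpolys F n \<and> total_degree F J \<le> 2 \<and> determined F n (\<kappa> * real p ^ 15) J \<and>
           (\<forall>x \<in> cartesian_power S n. V P x = V J x))))"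
proof (intro exI[of _ "54::real"] conjI allI)
  fix p :: nat and S :: "int set" and n :: nat and P :: "nat multiset \<Rightarrow> int"
  let ?F = "prime_field p"
  let ?V = "mpoly_eval ?F"
  let ?X = "cartesian_power S n"
  show "let F = prime_field p; V = mpoly_eval F in
      Factorial_Ring.prime p \<longrightarrow> S \<noteq> {} \<longrightarrow> S \<subseteq> carrier F \<longrightarrow> n \<ge> 1 \<longrightarrow>
      P \<in> mpolys F n \<longrightarrow> total_degree F P = 2 \<longrightarrow>
      V P ` cartesian_power S n \<noteq> carrier F \<longrightarrow>
        (\<exists>L A J.
           L \<in> mpolys F n \<and> total_degree F L \<le> 1 \<and>
           A \<in> carrier (poly_ring F) \<and> Polynomials.degree A = 2 \<and>
           J \<in> mpolys F n \<and> total_degree F J \<le> 2 \<and> determined F n (54 * real p ^ 15) J \<and>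
           (\<forall>x \<in> cartesian_power S n. V P x = ring.eval F A (V L x) \<oplus>\<^bsub>F\<^esub> V J x) \<and>
           (\<exists>L' a c.
              L' \<in> mpolys F n \<and> total_degree F L' \<le> 1 \<and> a \<in> carrier F \<and> c \<in> carrier F \<and>
              (\<forall>x \<in> cartesian_power S n.
                 V P x = a \<otimes>\<^bsub>F\<^esub> (V L' x [^]\<^bsub>F\<^esub> (2::nat)) \<oplus>\<^bsub>F\<^esub> (V J x \<oplus>\<^bsub>F\<^esub> c)))) \<and>
        ((\<nexists>T. is_affine_translate p T \<and> T \<subseteq> V P ` cartesian_power S n) \<longrightarrow>
         (\<exists>J.
           J \<in> mpolys F n \<and> total_degree F J \<le> 2 \<and> determined F n (54 * real p ^ 15) J \<and>
           (\<forall>x \<in> cartesian_power S n. V P x = V J x)))"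
    unfolding Let_def
  proof (intro impI)
    assume p: "Factorial_Ring.prime p" and S: "S \<noteq> {}" "S \<subseteq> carrier ?F"
      and P: "P \<in> mpolys ?F n" and deg: "total_degree ?F P = 2" and miss: "?V P ` ?X \<noteq> carrier ?F"
    interpret residues_prime p ?F using p by (simp add: residues_prime_def)
    let ?one = "\<exists>L A J.
           L \<in> mpolys ?F n \<and> total_degree ?F L \<le> 1 \<and>
           A \<in> carrier (poly_ring ?F) \<and> Polynomials.degree A = 2 \<and>
           J \<in> mpolys ?F n \<and> total_degree ?F J \<le> 2 \<and> determined ?F n (54 * real p ^ 15) J \<and>
           (\<forall>x \<in> ?X. ?V P x = ring.eval ?F A (?V L x) \<oplus>\<^bsub>?F\<^esub> ?V J x) \<and>
           (\<exists>L' a c.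
              L' \<in> mpolys ?F n \<and> total_degree ?F L' \<le> 1 \<and> a \<in> carrier ?F \<and> c \<in> carrier ?F \<and>
              (\<forall>x \<in> ?X. ?V P x = a \<otimes>\<^bsub>?F\<^esub> (?V L' x [^]\<^bsub>?F\<^esub> (2::nat)) \<oplus>\<^bsub>?F\<^esub> (?V J x \<oplus>\<^bsub>?F\<^esub> c)))"
    let ?two = "(\<nexists>T. is_affine_translate p T \<and> T \<subseteq> ?V P ` ?X) \<longrightarrow>
         (\<exists>J. J \<in> mpolys ?F n \<and> total_degree ?F J \<le> 2 \<and> determined ?F n (54 * real p ^ 15) J \<and>
           (\<forall>x \<in> ?X. ?V P x = ?V J x))"
    show "?one \<and> ?two"
    proof (cases rule: few_variables_or_square[OF S P deg miss])
      case (1 I c b M)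
      have "[?V P x = 0 * (0 + (\<Sum>i\<in>{1..n}. 0 * x i))\<^sup>2 + quadratic_form I c b M x] (mod int p)" if "x \<in> ?X" for x
        using 1(3)[OF that] by simp
      from determined_representation[OF P S(2) 1(1,2) this] obtain L J where J: "J \<in> mpolys ?F n" "total_degree ?F J \<le> 2" "determined ?F n (54 * real p ^ 15) J"
        and eq: "\<And>x. x \<in> ?X \<Longrightarrow> ?V P x = (0 * (?V L x)\<^sup>2 + ?V J x) mod int p"
        and carr: "\<And>x. x \<in> ?X \<Longrightarrow> ?V L x \<in> carrier ?F \<and> ?V J x \<in> carrier ?F"
        by blast
      have PJ: "?V P x = ?V J x" if "x \<in> ?X" for x
        using eq[OF that] carr[OF that] by (simp add: mem_carrier_mod)
      \<comment> \<open>The zero linear form makes the square disappear although its coefficient is 1.\<close>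
      let ?Z = "affine_poly {1..n} 0 (\<lambda>_. 0)"
      have Z: "?V ?Z x = 0" if "x \<in> ?X" for x
      proof -
        have "?V ?Z x = (0 + (\<Sum>i\<in>{1..n}. 0 * x i)) mod int p"
          using that S(2) by (intro affine_poly(3)) auto
        then show ?thesis by simp
      qed
      have ?one
      proof (rule square_plus_determined)
        show "?V P x = (1 * (?V ?Z x)\<^sup>2 + ?V J x) mod int p" if "x \<in> ?X" for x
          using PJ[OF that] Z[OF that] carr[OF that] by (simp add: mem_carrier_mod)
        show "?V ?Z x \<in> carrier ?F \<and> ?V J x \<in> carrier ?F" if "x \<in> ?X" for x
          using Z[OF that] carr[OF that] zero_closed by (simp add: res_zero_eq)
        show "1 \<in> carrier ?F" "1 \<noteq> \<zero>\<^bsub>?F\<^esub>" using one_closed zero_not_one by (simp_all add: res_one_eq res_zero_eq)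
      qed (use J affine_poly(1,2)[of "{1..n}"] in auto)
      moreover have ?two using J PJ by blast
      ultimately show ?thesis by blast
    next
      case (2 I A l0 l c b M)
      obtain L J where L: "L \<in> mpolys ?F n" "total_degree ?F L \<le> 1"
        and J: "J \<in> mpolys ?F n" "total_degree ?F J \<le> 2" "determined ?F n (54 * real p ^ 15) J"
        and eq: "\<And>x. x \<in> ?X \<Longrightarrow> ?V P x = (A * (?V L x)\<^sup>2 + ?V J x) mod int p"
        and carr: "\<And>x. x \<in> ?X \<Longrightarrow> ?V L x \<in> carrier ?F \<and> ?V J x \<in> carrier ?F"
        using determined_representation[OF P S(2) 2(1,2,4)] by blast
      define a where "a = A mod int p"
      have a: "a \<in> carrier ?F" "a \<noteq> \<zero>\<^bsub>?F\<^esub>" using 2(3) by (auto simp: a_def res_zero_eq)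
      have ?one
      proof (rule square_plus_determined[OF a L J _ carr])
        show "?V P x = (a * (?V L x)\<^sup>2 + ?V J x) mod int p" if "x \<in> ?X" for x
          using eq[OF that] unfolding a_def
          by (simp only: mod_add_cong[OF mod_mult_cong[OF mod_mod_trivial refl] refl])
      qed
      moreover have "\<exists>T. is_affine_translate p T \<and> T \<subseteq> ?V P ` ?X"
      proof -
        obtain e where e: "\<And>u. \<exists>x\<in>?X. [l0 + (\<Sum>i\<in>{1..n}. l i * x i) = u] (mod int p) \<and>
          quadratic_form I c b M x = e" using 2(5) by blast
        define d where "d = e mod int p"
        \<comment> \<open>Along the points with constant remainder \<open>e\<close> the values are \<open>A u^2 + e\<close> for all \<open>u\<close>.\<close>
        let ?T = "(\<lambda>q. a \<otimes>\<^bsub>?F\<^esub> q \<oplus>\<^bsub>?F\<^esub> d) ` quadratic_residues p"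
        have d: "d \<in> carrier ?F" by (simp add: d_def)
        have "is_affine_translate p ?T" unfolding is_affine_translate_def using a d by blast
        moreover have "?T \<subseteq> ?V P ` ?X"
        proof
          fix v assume "v \<in> ?T"
          then obtain y where y: "y \<in> carrier ?F" "v = a \<otimes>\<^bsub>?F\<^esub> (y [^]\<^bsub>?F\<^esub> (2::nat)) \<oplus>\<^bsub>?F\<^esub> d"
            by (auto simp: quadratic_residues_def)
          obtain x where x: "x \<in> ?X" "[l0 + (\<Sum>i\<in>{1..n}. l i * x i) = y] (mod int p)"
            "quadratic_form I c b M x = e" using e by blast
          have "v = (A * y\<^sup>2 + d) mod int p" unfolding y(2) by (rule square_form[OF a_def y(1) d])
          also have "\<dots> = (A * y\<^sup>2 + e) mod int p" by (simp add: d_def mod_simps)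
          also have "[A * (l0 + (\<Sum>i\<in>{1..n}. l i * x i))\<^sup>2 + quadratic_form I c b M x = A * y\<^sup>2 + e] (mod int p)"
            unfolding x(3) by (intro cong_add cong_mult cong_pow x(2) cong_refl)
          then have "(A * y\<^sup>2 + e) mod int p = ?V P x mod int p"
            using 2(4)[OF x(1)] by (simp add: cong_def)
          also have "\<dots> = ?V P x" using eq[OF x(1)] by simp
          finally show "v \<in> ?V P ` ?X" using x(1) by blast
        qed
        ultimately show ?thesis by blast
      qed
      ultimately show ?thesis by blast
    qed
  qed
qed simp

end
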